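(* Let $\Phi=(\phi_1,\dots,\phi_6)$ be a system of $6$ linear forms $\phi_i\colon\mathbb{Z}^3\to\mathbb{Z}$, let $p$ be a prime (not necessarily small), and let $G=\mathbb{F}_p^n$ for any $n\ge 1$. Suppose $\Phi$ has true complexity $1$ over $\mathbb{F}_p$. Then for any functions $f_1,\dots,f_6\colon G\to\mathbb{C}$ with $\|f_i\|_\infty\le 1$ for each $i$, and for any $j$ with $1\le j\le 6$, \[ \left|\Lambda_\Phi(f_1,\dots,f_6)\right|\le \|f_j\|_{U^2(G)}^{1/C}, \] where $C=C(\Phi,j)>0$ is a constant depending on the coefficients of $\Phi$ (and possibly on $j$), but not on $p$ or $n$.
   Context: For a system of linear forms $\Phi=(\phi_1,\dots,\phi_r)$, $\phi_i\colon\mathbb{Z}^d\to\mathbb{Z}$, a finite abelian group $G$ (here $G=\mathbb{F}_p^n$), and functions $f_i\colon G\to\mathbb{C}$, define $\Lambda_\Phi(f_1,\dots,f_r)=\mathbb{E}_{x_1,\dots,x_d\in G}\prod_{i=1}^r f_i(\phi_i(x_1,\dots,x_d))$, where each $\phi_i$ induces a map $G^d\to G$ in the obvious way. The Gowers $U^2$ norm is given by $\|f\|_{U^2(G)}^4=\mathbb{E}_{x,h,h'\in G} f(x)\overline{f(x+h)}\,\overline{f(x+h')}f(x+h+h')$. The system $\Phi$ has true complexity $1$ over $\mathbb{F}_p$ if the symmetric bilinear forms $\phi_1^{\otimes 2},\dots,\phi_6^{\otimes 2}$ (with the $\phi_i$ reduced modulo $p$, viewed as linear forms $\mathbb{F}_p^3\to\mathbb{F}_p$)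 are linearly independent (equivalently, $\phi_i^{\otimes 2}$ are linearly independent but this fails for $\phi_i^{\otimes 1}=\phi_i$; in particular the reductions mod $p$ are nonzero). *)

theory Defs
  imports
    Complex_Main
    "HOL-Analysis.Finite_Cartesian_Product"
    "HOL-Algebra.FiniteProduct"
    "HOL-Algebra.Product_Groups"
    "HOL-Number_Theory.Cong"
begin

text \<open>
  A linear form \<open>\<int>\<^sup>d \<rightarrow> \<int>\<close> is given by its coefficient vector \<open>a :: int^'d\<close>, and a system of
  \<open>r\<close> forms by the family of its coefficient vectors \<open>\<Phi> :: int^'d^'r\<close>.
\<close>

definition linear_form :: "int^'d \<Rightarrow> int^'d \<Rightarrow> int" where
  "linear_form a x = (\<Sum>k\<in>UNIV. a $ k * x $ k)"

text \<open>Abelian groups are written multiplicatively, so \<open>\<Sum>\<^sub>k a\<^sub>k x\<^sub>k\<close> in \<open>G\<close> is \<open>\<Prod>\<^sub>k x\<^sub>k\<^bsup>a\<^sub>k\<^esup>\<close>.\<close>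

definition induced_form :: "('g, 'b) monoid_scheme \<Rightarrow> int^'d \<Rightarrow> ('d \<Rightarrow> 'g) \<Rightarrow> 'g" where
  "induced_form G a x = finprod G (\<lambda>k. x k [^]\<^bsub>G\<^esub> (a $ k)) UNIV"

definition expect :: "'a set \<Rightarrow> ('a \<Rightarrow> complex) \<Rightarrow> complex" where
  "expect A f = (\<Sum>x\<in>A. f x) / of_nat (card A)"

definition Lambda_form ::
    "('g, 'b) monoid_scheme \<Rightarrow> int^'d^'r \<Rightarrow> ('r \<Rightarrow> 'g \<Rightarrow> complex) \<Rightarrow> complex" where
  "Lambda_form G \<Phi> f =
     expect (UNIV \<rightarrow> carrier G) (\<lambda>x. \<Prod>i\<in>UNIV. f i (induced_form G (\<Phi> $ i) x))"

definition U2_average :: "('g, 'b) monoid_scheme \<Rightarrow> ('g \<Rightarrow> complex) \<Rightarrow> complex" where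
  "U2_average G f =
     expect (carrier G \<times> carrier G \<times> carrier G)
       (\<lambda>(x, h, h'). f x * cnj (f (x \<otimes>\<^bsub>G\<^esub> h)) * cnj (f (x \<otimes>\<^bsub>G\<^esub> h')) * f (x \<otimes>\<^bsub>G\<^esub> h \<otimes>\<^bsub>G\<^esub> h'))"

text \<open>The average is a nonnegative real number; see \<open>U2_norm_power4\<close> below.\<close>

definition U2_norm :: "('g, 'b) monoid_scheme \<Rightarrow> ('g \<Rightarrow> complex) \<Rightarrow> real" where
  "U2_norm G f = root 4 (Re (U2_average G f))"

definition Fp_vectors :: "nat \<Rightarrow> nat \<Rightarrow> (nat \<Rightarrow> int) monoid" where
  "Fp_vectors p n = product_group {..<n} (\<lambda>_. integer_mod_group p)"

definition tensor_square :: "int^'d \<Rightarrow> int^'d \<Rightarrow> int^'d \<Rightarrow> int" where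
  "tensor_square a x y = linear_form a x * linear_form a y"

text \<open>
  Linear independence over \<open>\<F>\<^sub>p\<close> of the bilinear forms \<open>\<phi>\<^sub>i \<otimes> \<phi>\<^sub>i\<close> on \<open>\<F>\<^sub>p\<^sup>3\<close>, with scalars and vectors
  represented by arbitrary integer lifts. Six linear forms in three variables are always linearly
  dependent over \<open>\<F>\<^sub>p\<close>, so for such systems the true complexity is then exactly 1.
\<close>

definition true_complexity_1 :: "nat \<Rightarrow> int^3^6 \<Rightarrow> bool" where
  "true_complexity_1 p \<Phi> \<longleftrightarrow>
     (\<forall>c :: 6 \<Rightarrow> int.
        (\<forall>x y. [(\<Sum>i\<in>UNIV. c i * tensor_square (\<Phi> $ i) x y) = 0] (mod int p)) \<longrightarrow>
        (\<forall>i. [c i = 0] (mod int p)))"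

lemma U2_norm_power4:
  assumes "comm_group G" "finite (carrier G)"
  shows "complex_of_real (U2_norm G f ^ 4) = U2_average G f"
proof -
  interpret comm_group G by fact
  let ?C = "carrier G"
  define A where "A h = (\<Sum>x\<in>?C. f x * cnj (f (x \<otimes>\<^bsub>G\<^esub> h)))" for h
  have "(\<Sum>(x,h,h')\<in>?C \<times> ?C \<times> ?C.
           f x * cnj (f (x \<otimes>\<^bsub>G\<^esub> h)) * cnj (f (x \<otimes>\<^bsub>G\<^esub> h')) * f (x \<otimes>\<^bsub>G\<^esub> h \<otimes>\<^bsub>G\<^esub> h'))
      = (\<Sum>x\<in>?C. \<Sum>h\<in>?C. \<Sum>h'\<in>?C. f x * cnj (f (x \<otimes>\<^bsub>G\<^esub> h)) *
           (cnj (f (x \<otimes>\<^bsub>G\<^esub> h')) * f (x \<otimes>\<^bsub>G\<^esub> h' \<otimes>\<^bsub>G\<^esub> h)))"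
    unfolding sum.cartesian_product[symmetric]
    by (intro sum.cong refl) (simp add: m_ac mult.assoc)
  also have "\<dots> = (\<Sum>x\<in>?C. \<Sum>h\<in>?C. f x * cnj (f (x \<otimes>\<^bsub>G\<^esub> h)) * cnj (A h))"
  proof (intro sum.cong refl)
    fix x h assume x: "x \<in> ?C" and h: "h \<in> ?C"
    have "bij_betw (\<lambda>y. x \<otimes>\<^bsub>G\<^esub> y) ?C ?C"
      using x by (simp add: bij_betw_def inj_on_cmult surj_const_mult)
    then have "(\<Sum>h'\<in>?C. cnj (f (x \<otimes>\<^bsub>G\<^esub> h')) * f (x \<otimes>\<^bsub>G\<^esub> h' \<otimes>\<^bsub>G\<^esub> h)) =
               (\<Sum>y\<in>?C. cnj (f y) * f (y \<otimes>\<^bsub>G\<^esub> h))"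
      by (rule sum.reindex_bij_betw)
    then show "(\<Sum>h'\<in>?C. f x * cnj (f (x \<otimes>\<^bsub>G\<^esub> h)) *
           (cnj (f (x \<otimes>\<^bsub>G\<^esub> h')) * f (x \<otimes>\<^bsub>G\<^esub> h' \<otimes>\<^bsub>G\<^esub> h))) = f x * cnj (f (x \<otimes>\<^bsub>G\<^esub> h)) * cnj (A h)"
      by (simp add: sum_distrib_left[symmetric] A_def)
  qed
  also have "\<dots> = (\<Sum>h\<in>?C. A h * cnj (A h))"
    by (subst sum.swap) (simp add: A_def sum_distrib_right)
  also have "\<dots> = of_real (\<Sum>h\<in>?C. (cmod (A h))\<^sup>2)"
    by (simp add: complex_norm_square[symmetric])
  finally have "U2_average G f =
      of_real ((\<Sum>h\<in>?C. (cmod (A h))\<^sup>2) / real (card (?C \<times> ?C \<times> ?C)))"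
    unfolding U2_average_def expect_def by simp
  moreover have "(\<Sum>h\<in>?C. (cmod (A h))\<^sup>2) / real (card (?C \<times> ?C \<times> ?C)) \<ge> 0"
    by (intro divide_nonneg_nonneg sum_nonneg) auto
  ultimately show ?thesis
    unfolding U2_norm_def by simp
qed

end

theory Submission
  imports Defs "HOL-Library.Function_Algebras" "HOL-Analysis.Convex" "HOL-Analysis.Cartesian_Space"
begin

text \<open>
  Fix the form \<open>\<phi>\<^sub>j\<close> and a second form \<open>\<phi>\<^sub>e\<close>. Averaging the other four functions over the fibres of
  \<open>(\<phi>\<^sub>j, \<phi>\<^sub>e)\<close> turns \<open>\<Lambda>\<close> into \<open>E\<^sub>x\<^sub>y f\<^sub>j(x) f\<^sub>e(y) T(x, y)\<close>. If each of the four remaining forms vanishes at one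
  of two vectors \<open>a\<close>, \<open>b\<close>, then \<open>T\<close> along \<open>s a + t b\<close> is a mixture of products \<open>A(s) B(t)\<close>. Splitting the
  four forms into pairs in two ways gives two such planes, and since no conic passes through the six
  forms, the ratios \<open>\<phi>\<^sub>e(a) \<phi>\<^sub>e(b) / \<phi>\<^sub>j(a) \<phi>\<^sub>j(b)\<close> differ. For quadratic phases with forms \<open>M\<^sub>j\<close>, \<open>M\<^sub>e\<close> the two
  planes say \<open>M\<^sub>j = \<kappa> M\<^sub>e = \<kappa>' M\<^sub>e\<close> with \<open>\<kappa> \<noteq> \<kappa>'\<close>, so that \<open>M\<^sub>j = 0\<close>.

  In general, let \<open>g(y) = E\<^sub>x f\<^sub>j(x) T(x, y)\<close>. If \<open>\<Lambda>\<close> is large then \<open>g\<close> has large \<open>U\<^sup>3\<close> norm, and positivity of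
  the Fourier coefficients of \<open>k \<mapsto> E\<^sub>y \<Delta>\<^sub>h\<Delta>\<^sub>k g(y)\<close> yields, for every integer \<open>u\<close>, a kernel \<open>K\<close> with
  \<open>\<langle>g, K g\<rangle>\<close> large that is a mixture of products both along \<open>(u s + t, u s + t)\<close> and along
  \<open>(s + u t, u s + t)\<close>; this is where the additivity \<open>M(u s, t) = M(s, u t)\<close> of bilinear forms enters and
  why the exponent depends on the coefficients. Composing \<open>T\<close>, two such kernels and \<open>T\<close> again gives a
  kernel \<open>B\<close> correlating with \<open>f\<^sub>j \<otimes> f\<^sub>j\<close> that is a mixture of products along two planes with a common
  direction, and for such \<open>B\<close> the correlation is bounded by the \<open>U\<^sup>2\<close> norm by Fourier analysis in that
  direction.
\<close>

subsection \<open>Six forms whose squares are independent\<close>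

lemma linear_form_3: "linear_form a x = a $ 1 * x $ 1 + a $ 2 * x $ 2 + a $ 3 * x $ 3" for a :: "int^3"
  by (simp add: linear_form_def sum_3)

text \<open>Vector product: \<open>linear_form a (cross b c)\<close> is the determinant of the three
  coefficient vectors, and \<open>cross b c\<close> is a direction killed by both \<open>b\<close>
  and \<open>c\<close>. For points of the projective plane of forms modulo \<open>p\<close>, a
  vanishing determinant means collinearity.\<close>

definition cross :: "int^3 \<Rightarrow> int^3 \<Rightarrow> int^3" where
  "cross a b = (\<chi> k. if k = 1 then a $ 2 * b $ 3 - a $ 3 * b $ 2
     else if k = 2 then a $ 3 * b $ 1 - a $ 1 * b $ 3 else a $ 1 * b $ 2 - a $ 2 * b $ 1)"

lemma cross_nth [simp]:
  "cross a b $ 1 = a $ 2 * b $ 3 - a $ 3 * b $ 2"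
  "cross a b $ 2 = a $ 3 * b $ 1 - a $ 1 * b $ 3"
  "cross a b $ 3 = a $ 1 * b $ 2 - a $ 2 * b $ 1"
  by (simp_all add: cross_def)

lemma linear_form_cross_self [simp]: "linear_form a (cross a b) = 0" "linear_form b (cross a b) = 0"
  by (simp_all add: linear_form_3 algebra_simps)

lemma linear_form_cross_rotate: "linear_form a (cross b c) = linear_form b (cross c a)"
  by (simp add: linear_form_3 algebra_simps)

lemma linear_form_cross_flip: "linear_form a (cross c b) = - linear_form a (cross b c)"
  by (simp add: linear_form_3 algebra_simps)

lemma cauchy_binet: "linear_form a x * linear_form b y - linear_form a y * linear_form b x
    = linear_form (cross a b) (cross x y)"
  by (simp add: linear_form_3 algebra_simps)

lemma linear_form_add_left: "linear_form (a + b) x = linear_form a x + linear_form b x"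
  by (simp add: linear_form_def sum.distrib algebra_simps)

text \<open>Independence of six vectors in a six-dimensional space is turned into spanning by counting.\<close>

lemma squares_span:
  assumes p: "Factorial_Ring.prime p" and tc: "true_complexity_1 p \<Phi>"
  shows "\<exists>c. \<forall>x y. [linear_form a x * linear_form a y = (\<Sum>i\<in>UNIV. c i * tensor_square (\<Phi> $ i) x y)] (mod int p)"
proof -
  define A where "A = {0..<int p}"
  have p0: "int p > 0" using prime_gt_0_nat[OF p] by simp
  define s where "s k l c = (\<Sum>i\<in>UNIV. c i * (\<Phi> $ i $ k * \<Phi> $ i $ l))" for k l :: 3 and c :: "6 \<Rightarrow> int"
  \<comment> \<open>A symmetric form in three variables is determined by six entries, so
    \<open>F\<close> maps a set of \<open>p^6\<close> coefficient vectors into a set of the same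
    size. Independence makes it injective, hence onto.\<close>
  define F where "F c = (s 1 1 c mod int p, s 2 2 c mod int p, s 3 3 c mod int p,
    s 1 2 c mod int p, s 1 3 c mod int p, s 2 3 c mod int p)" for c
  have expand: "(\<Sum>i\<in>UNIV. c i * tensor_square (\<Phi> $ i) x y)
      = s 1 1 c * (x $ 1 * y $ 1) + s 2 2 c * (x $ 2 * y $ 2) + s 3 3 c * (x $ 3 * y $ 3)
      + s 1 2 c * (x $ 1 * y $ 2 + x $ 2 * y $ 1) + s 1 3 c * (x $ 1 * y $ 3 + x $ 3 * y $ 1)
      + s 2 3 c * (x $ 2 * y $ 3 + x $ 3 * y $ 2)" for c x y
    unfolding s_def tensor_square_def linear_form_3 sum_distrib_right sum.distrib[symmetric]
    by (intro sum.cong refl) (simp add: algebra_simps)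
  let ?X = "PiE (UNIV :: 6 set) (\<lambda>_. A)" and ?Y = "A \<times> A \<times> A \<times> A \<times> A \<times> A"
  have fin: "finite ?X" "finite ?Y"
    by (auto simp: A_def intro!: finite_PiE)
  have card: "card ?X = card ?Y"
    by (simp add: card_PiE A_def power_numeral_reduce algebra_simps)
  have "F ` ?X \<subseteq> ?Y"
    using p0 by (auto simp: F_def A_def)
  moreover have "inj_on F ?X"
  proof (rule inj_onI)
    fix c c' assume c: "c \<in> ?X" "c' \<in> ?X" and eq: "F c = F c'"
    have diff: "s k l (\<lambda>i. c i - c' i) = s k l c - s k l c'" for k l
      by (simp add: s_def sum_subtractf algebra_simps)
    have z: "int p dvd s 1 1 (\<lambda>i. c i - c' i)" "int p dvd s 2 2 (\<lambda>i. c i - c' i)"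
      "int p dvd s 3 3 (\<lambda>i. c i - c' i)" "int p dvd s 1 2 (\<lambda>i. c i - c' i)"
      "int p dvd s 1 3 (\<lambda>i. c i - c' i)" "int p dvd s 2 3 (\<lambda>i. c i - c' i)"
      using eq unfolding diff F_def by (simp_all add: mod_eq_dvd_iff)
    have "\<forall>x y. [(\<Sum>i\<in>UNIV. (c i - c' i) * tensor_square (\<Phi> $ i) x y) = 0] (mod int p)"
      unfolding expand cong_0_iff by (intro allI dvd_add dvd_mult2 z)
    from mp[OF spec[OF tc[unfolded true_complexity_1_def], of "\<lambda>i. c i - c' i"] this]
    have "[c i - c' i = 0] (mod int p)" for i
      by (rule spec)
    then have "c i mod int p = c' i mod int p" for i
      by (simp add: cong_0_iff mod_eq_dvd_iff)
    moreover have "c i \<in> A" "c' i \<in> A" for i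
      using c by (auto simp: PiE_def Pi_def)
    ultimately show "c = c'"
      by (intro ext) (simp add: A_def)
  qed
  ultimately have "F ` ?X = ?Y"
    using fin card by (intro card_subset_eq) (simp_all add: card_image)
  moreover define Z where "Z = (a $ 1 * a $ 1 mod int p, a $ 2 * a $ 2 mod int p, a $ 3 * a $ 3 mod int p,
      a $ 1 * a $ 2 mod int p, a $ 1 * a $ 3 mod int p, a $ 2 * a $ 3 mod int p)"
  then have "Z \<in> ?Y"
    using p0 by (simp add: A_def)
  ultimately have "Z \<in> F ` ?X" by (simp only:)
  then obtain c where "Z = F c" by (rule imageE)
  then have c: "[s 1 1 c = a $ 1 * a $ 1] (mod int p)" "[s 2 2 c = a $ 2 * a $ 2] (mod int p)"
    "[s 3 3 c = a $ 3 * a $ 3] (mod int p)" "[s 1 2 c = a $ 1 * a $ 2] (mod int p)"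
    "[s 1 3 c = a $ 1 * a $ 3] (mod int p)" "[s 2 3 c = a $ 2 * a $ 3] (mod int p)"
    by (simp_all add: F_def Z_def cong_def)
  have "[linear_form a x * linear_form a y = (\<Sum>i\<in>UNIV. c i * tensor_square (\<Phi> $ i) x y)] (mod int p)" for x y
  proof -
    have "linear_form a x * linear_form a y = a $ 1 * a $ 1 * (x $ 1 * y $ 1) + a $ 2 * a $ 2 * (x $ 2 * y $ 2)
        + a $ 3 * a $ 3 * (x $ 3 * y $ 3) + a $ 1 * a $ 2 * (x $ 1 * y $ 2 + x $ 2 * y $ 1)
        + a $ 1 * a $ 3 * (x $ 1 * y $ 3 + x $ 3 * y $ 1) + a $ 2 * a $ 3 * (x $ 2 * y $ 3 + x $ 3 * y $ 2)"
      by (simp add: linear_form_3 algebra_simps)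
    then show ?thesis
      unfolding expand by (simp only:) (intro cong_add cong_mult c[THEN cong_sym] cong_refl)
  qed
  then show ?thesis by blast
qed

text \<open>The expression is a quadratic form in \<open>a\<close>, thus linear in the square of
  \<open>a\<close>, and by \<open>squares_span\<close> that square is a combination of the six given
  ones. Geometrically, a conic through all six points is identically zero.\<close>

lemma no_conic:
  assumes p: "Factorial_Ring.prime p" and tc: "true_complexity_1 p \<Phi>"
    and van: "\<And>i. int p dvd k * (linear_form (\<Phi> $ i) x * linear_form (\<Phi> $ i) y)
      + k' * (linear_form (\<Phi> $ i) x' * linear_form (\<Phi> $ i) y')"
  shows "int p dvd k * (linear_form a x * linear_form a y) + k' * (linear_form a x' * linear_form a y')"
proof -
  obtain c where c: "\<And>x y. [linear_form a x * linear_form a y = (\<Sum>i\<in>UNIV. c i * tensor_square (\<Phi> $ i) x y)] (mod int p)"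
    using squares_span[OF p tc, of a] by blast
  have "[k * (linear_form a x * linear_form a y) + k' * (linear_form a x' * linear_form a y')
      = k * (\<Sum>i\<in>UNIV. c i * tensor_square (\<Phi> $ i) x y) + k' * (\<Sum>i\<in>UNIV. c i * tensor_square (\<Phi> $ i) x' y')] (mod int p)"
    by (intro cong_add cong_mult c cong_refl)
  also have "k * (\<Sum>i\<in>UNIV. c i * tensor_square (\<Phi> $ i) x y) + k' * (\<Sum>i\<in>UNIV. c i * tensor_square (\<Phi> $ i) x' y')
      = (\<Sum>i\<in>UNIV. c i * (k * (linear_form (\<Phi> $ i) x * linear_form (\<Phi> $ i) y)
      + k' * (linear_form (\<Phi> $ i) x' * linear_form (\<Phi> $ i) y')))"
    by (simp add: tensor_square_def sum_distrib_left sum.distrib algebra_simps)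
  finally show ?thesis
    using van by (simp add: cong_dvd_iff dvd_sum)
qed

text \<open>If all these determinants vanish, \<open>cauchy_binet\<close> makes the two forms
  proportional modulo \<open>p\<close>, which turns into a relation between their squares.\<close>

lemma cross_nonzero:
  fixes \<Phi> :: "int^3^6"
  assumes p: "Factorial_Ring.prime p" and tc: "true_complexity_1 p \<Phi>" and ij: "i \<noteq> j"
  obtains a where "\<not> int p dvd linear_form a (cross (\<Phi> $ i) (\<Phi> $ j))"
proof (rule ccontr)
  assume "\<not> thesis"
  then have z: "int p dvd linear_form a (cross (\<Phi> $ i) (\<Phi> $ j))" for a
    using that by blast
  have "int p dvd linear_form (cross (\<Phi> $ i) (\<Phi> $ j)) (cross x y)" for x y
    using z[of "cross x y"] by (simp add: linear_form_3 mult.commute)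
  then have sw: "[linear_form (\<Phi> $ i) x * linear_form (\<Phi> $ j) y = linear_form (\<Phi> $ i) y * linear_form (\<Phi> $ j) x] (mod int p)" for x y
    by (simp add: cong_iff_dvd_diff cauchy_binet)
  have tc': "int p dvd c k" if "\<And>x y. int p dvd (\<Sum>i\<in>UNIV. c i * tensor_square (\<Phi> $ i) x y)" for c k
    using tc that unfolding true_complexity_1_def cong_0_iff by blast
  have prime: "Factorial_Ring.prime (int p)" using p by simp
  have "int p dvd linear_form (\<Phi> $ j) r" for r
  proof -
    define \<alpha> where "\<alpha> = linear_form (\<Phi> $ i) r"
    define \<beta> where "\<beta> = linear_form (\<Phi> $ j) r"
    \<comment> \<open>The relation between the two squares, with the ratio of the forms read off at
      \<open>r\<close>. Independence forces \<open>\<beta>\<close> to vanish for every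
      \<open>r\<close>, and then the square of \<open>\<Phi> $ j\<close> alone is dependent.\<close>
    define c where "c k = (if k = i then \<beta>\<^sup>2 else if k = j then - \<alpha>\<^sup>2 else 0)" for k
    have "int p dvd (\<Sum>k\<in>UNIV. c k * tensor_square (\<Phi> $ k) x y)" for x y
    proof -
      have "(\<Sum>k\<in>UNIV. c k * tensor_square (\<Phi> $ k) x y) = (\<Sum>k\<in>{i, j}. c k * tensor_square (\<Phi> $ k) x y)"
        by (rule sum.mono_neutral_right) (auto simp: c_def)
      also have "\<dots> = (linear_form (\<Phi> $ i) x * \<beta>) * (linear_form (\<Phi> $ i) y * \<beta>)
          - (\<alpha> * linear_form (\<Phi> $ j) x) * (\<alpha> * linear_form (\<Phi> $ j) y)"
        using ij by (simp add: c_def tensor_square_def power2_eq_square algebra_simps)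
      finally show ?thesis
        using cong_mult[OF sw[of x r] sw[of y r]] unfolding \<alpha>_def \<beta>_def by (simp add: cong_iff_dvd_diff)
    qed
    from tc'[OF this, of i] have "int p dvd \<beta>\<^sup>2" by (simp add: c_def)
    then show ?thesis
      using prime unfolding \<beta>_def by (simp add: prime_dvd_power_iff)
  qed
  then have "int p dvd (\<Sum>k\<in>UNIV. (if k = j then 1 else 0) * tensor_square (\<Phi> $ k) x y)" for x y
    by (intro dvd_sum) (simp add: tensor_square_def)
  from tc'[OF this, of j] show False
    using prime by (simp add: not_prime_unit)
qed

lemma six_cover:
  fixes a b c d :: 6
  assumes "distinct [a, b, c, d]"
  obtains e f where "UNIV = {a, b, c, d, e, f}" "distinct [a, b, c, d, e, f]"
proof -
  have "card (UNIV - {a, b, c, d}) = 2"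
    using assms by (simp add: card_Diff_subset)
  then obtain e f where "UNIV - {a, b, c, d} = {e, f}" "e \<noteq> f"
    by (auto simp: card_2_iff)
  moreover from this have "e \<notin> {a, b, c, d}" "f \<notin> {a, b, c, d}" "UNIV = {a, b, c, d, e, f}"
    by blast+
  ultimately show ?thesis
    using assms that by auto
qed

text \<open>A vector space is not the union of two hyperplanes: if neither \<open>a\<close> nor
  \<open>b\<close> works, then \<open>a\<close> vanishes at \<open>y\<close> and \<open>b\<close> at
  \<open>x\<close>, so \<open>a + b\<close> works.\<close>

lemma product_of_forms_nonzero:
  assumes p: "Factorial_Ring.prime p"
    and "\<not> int p dvd linear_form a x" "\<not> int p dvd linear_form b y"
  obtains e where "\<not> int p dvd linear_form e x * linear_form e y"
proof -
  have prime: "Factorial_Ring.prime (int p)" using p by simp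
  have "\<exists>e\<in>{a, b, a + b}. \<not> int p dvd linear_form e x * linear_form e y"
    using assms(2,3) unfolding prime_dvd_mult_iff[OF prime]
    by (auto simp: linear_form_add_left dvd_add_right_iff dvd_add_left_iff)
  then show ?thesis using that by blast
qed

text \<open>The line through four collinear points and the line through the other two would form a
  conic through all six; \<open>no_conic\<close> is used with second coefficient 0.\<close>

lemma no_four_collinear:
  fixes \<Phi> :: "int^3^6"
  assumes p: "Factorial_Ring.prime p" and tc: "true_complexity_1 p \<Phi>" and d: "distinct [a, b, c, d]"
    and z: "int p dvd linear_form (\<Phi> $ c) (cross (\<Phi> $ a) (\<Phi> $ b))" "int p dvd linear_form (\<Phi> $ d) (cross (\<Phi> $ a) (\<Phi> $ b))"
  shows False
proof -
  obtain e f where ef: "UNIV = {a, b, c, d, e, f}" "distinct [a, b, c, d, e, f]"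
    using six_cover[OF d] by blast
  let ?v = "cross (\<Phi> $ a) (\<Phi> $ b)" and ?w = "cross (\<Phi> $ e) (\<Phi> $ f)"
  obtain a1 where a1: "\<not> int p dvd linear_form a1 ?v"
    using cross_nonzero[OF p tc, of a b] ef(2) by auto
  obtain a2 where a2: "\<not> int p dvd linear_form a2 ?w"
    using cross_nonzero[OF p tc, of e f] ef(2) by auto
  obtain g where g: "\<not> int p dvd linear_form g ?v * linear_form g ?w"
    using product_of_forms_nonzero[OF p a1 a2] .
  have "int p dvd 1 * (linear_form (\<Phi> $ i) ?v * linear_form (\<Phi> $ i) ?w)
      + 0 * (linear_form (\<Phi> $ i) 0 * linear_form (\<Phi> $ i) 0)" for i
  proof -
    have "i \<in> {a, b, c, d, e, f}" using ef(1) by blast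
    then show ?thesis using z by auto
  qed
  from no_conic[OF p tc this, of g] g show False by simp
qed

text \<open>If the two products agreed, the conic through \<open>k\<close>, \<open>l\<close>,
  \<open>m\<close>, \<open>n\<close> and \<open>j\<close> would also pass through \<open>e\<close>.
  By \<open>no_conic\<close> it would vanish identically, which forces too many collinear
  triples.\<close>

lemma cross_ratios_differ:
  fixes \<Phi> :: "int^3^6"
  defines "D \<equiv> \<lambda>i k l. linear_form (\<Phi> $ i) (cross (\<Phi> $ k) (\<Phi> $ l))"
  assumes p: "Factorial_Ring.prime p" and tc: "true_complexity_1 p \<Phi>"
    and cover: "UNIV = {j, e, k, l, m, n}" "distinct [j, e, k, l, m, n]"
    and nz: "\<not> int p dvd D j k l" "\<not> int p dvd D j m n" "\<not> int p dvd D j k m" "\<not> int p dvd D j l n"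
  shows "\<not> int p dvd D j k l * D j m n * D e k m * D e l n - D e k l * D e m n * D j k m * D j l n"
proof
  assume eq: "int p dvd D j k l * D j m n * D e k m * D e l n - D e k l * D e m n * D j k m * D j l n"
  have prime: "Factorial_Ring.prime (int p)" using p by simp
  \<comment> \<open>Both line pairs pass through \<open>k\<close>, \<open>l\<close>,
    \<open>m\<close>, \<open>n\<close>; the coefficients are chosen so that the combination vanishes
    at \<open>j\<close> too.\<close>
  let ?q = "\<lambda>a. (D j k m * D j l n) * (linear_form a (cross (\<Phi> $ k) (\<Phi> $ l)) * linear_form a (cross (\<Phi> $ m) (\<Phi> $ n)))
      + (- (D j k l * D j m n)) * (linear_form a (cross (\<Phi> $ k) (\<Phi> $ m)) * linear_form a (cross (\<Phi> $ l) (\<Phi> $ n)))"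
  have "int p dvd ?q (\<Phi> $ i)" for i
  proof -
    have e: "?q (\<Phi> $ e) = - (D j k l * D j m n * D e k m * D e l n - D e k l * D e m n * D j k m * D j l n)"
      by (simp add: D_def algebra_simps)
    have "int p dvd ?q (\<Phi> $ e)"
      unfolding e using eq by (simp only: dvd_minus_iff)
    moreover have "?q (\<Phi> $ j) = 0"
      by (simp add: D_def algebra_simps)
    moreover have "i \<in> {j, e, k, l, m, n}" using cover(1) by blast
    ultimately show ?thesis by auto
  qed
  then have q: "int p dvd ?q a" for a
    by (rule no_conic[OF p tc])
  \<comment> \<open>At a sum of two base points one of the two line pairs drops out, leaving a
    product of determinants of base points.\<close>
  have "int p dvd D l k m * D k l n"
  proof -
    have "?q (\<Phi> $ k + \<Phi> $ l) = - (D j k l * D j m n) * (D l k m * D k l n)"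
      by (simp add: linear_form_add_left D_def)
    then show ?thesis using q[of "\<Phi> $ k + \<Phi> $ l"] nz prime by (simp add: prime_dvd_mult_iff)
  qed
  moreover have "int p dvd D n k m * D m l n"
  proof -
    have "?q (\<Phi> $ m + \<Phi> $ n) = - (D j k l * D j m n) * (D n k m * D m l n)"
      by (simp add: linear_form_add_left D_def)
    then show ?thesis using q[of "\<Phi> $ m + \<Phi> $ n"] nz prime by (simp add: prime_dvd_mult_iff)
  qed
  moreover have "int p dvd D m k l * D k m n"
  proof -
    have "?q (\<Phi> $ k + \<Phi> $ m) = (D j k m * D j l n) * (D m k l * D k m n)"
      by (simp add: linear_form_add_left D_def)
    then show ?thesis using q[of "\<Phi> $ k + \<Phi> $ m"] nz prime by (simp add: prime_dvd_mult_iff)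
  qed
  moreover have "int p dvd D n k l * D l m n"
  proof -
    have "?q (\<Phi> $ l + \<Phi> $ n) = (D j k m * D j l n) * (D n k l * D l m n)"
      by (simp add: linear_form_add_left D_def)
    then show ?thesis using q[of "\<Phi> $ l + \<Phi> $ n"] nz prime by (simp add: prime_dvd_mult_iff)
  qed
  moreover have flip: "int p dvd D a c b \<longleftrightarrow> int p dvd D a b c" for a b c
    unfolding D_def by (subst linear_form_cross_flip) simp
  have rot: "D a b c = D b c a" for a b c
    unfolding D_def by (rule linear_form_cross_rotate)
  have perm: "int p dvd D b a c \<longleftrightarrow> int p dvd D a b c" "int p dvd D c a b \<longleftrightarrow> int p dvd D a b c" for a b c
    using flip rot by metis+
  ultimately have *: "int p dvd D k l m \<or> int p dvd D k l n" "int p dvd D k m n \<or> int p dvd D l m n"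
    "int p dvd D k l m \<or> int p dvd D k m n" "int p dvd D k l n \<or> int p dvd D l m n"
    unfolding prime_dvd_mult_iff[OF prime] by (simp_all add: perm flip[of k n m] flip[of k m l] flip[of k n l] flip[of l n m])
  have four: "\<not> (int p dvd D c a b \<and> int p dvd D d a b)" if "distinct [a, b, c, d]" for a b c d
    using no_four_collinear[OF p tc that] unfolding D_def by blast
  \<comment> \<open>Any choice in these disjunctions yields two different collinear triples; they
    share two points, so all four base points would be collinear.\<close>
  show False
    using * four[of k m l n] four[of l m k n] four[of k n l m] cover(2)
    by (auto simp: perm flip[of k n m] flip[of k m l] flip[of k n l] flip[of l n m])
qed

text \<open>The pairs collinear with \<open>j\<close> are disjoint, so they are avoided by some 4-cycle on the remaining forms.\<close>

lemma good_cycle: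
  fixes \<Phi> :: "int^3^6" and j :: 6
  defines "D \<equiv> \<lambda>i k l. linear_form (\<Phi> $ i) (cross (\<Phi> $ k) (\<Phi> $ l))"
  assumes p: "Factorial_Ring.prime p" and tc: "true_complexity_1 p \<Phi>"
  obtains e k l m n where "UNIV = {j, e, k, l, m, n}" "distinct [j, e, k, l, m, n]"
    "\<not> int p dvd D j k l" "\<not> int p dvd D j m n" "\<not> int p dvd D j k m" "\<not> int p dvd D j l n"
proof -
  have "card (UNIV - {j}) = 5"
    by (simp add: card_Diff_subset)
  then obtain xs where xs: "set xs = UNIV - {j}" "distinct xs" "length xs = 5"
    by (metis finite_distinct_list distinct_card finite)
  then obtain e q r s t where xs': "xs = [e, q, r, s, t]"
    by (auto simp: numeral_eq_Suc length_Suc_conv)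
  have cover: "UNIV = {j, e, q, r, s, t}" "distinct [j, e, q, r, s, t]"
    using xs unfolding xs' by auto
  have flip: "int p dvd D j b a \<longleftrightarrow> int p dvd D j a b" for a b
    unfolding D_def by (subst linear_form_cross_flip) simp
  have rot: "D a b c = D c a b" for a b c
    unfolding D_def using linear_form_cross_rotate by metis
  have excl: "\<not> (int p dvd D j a b \<and> int p dvd D j a c)" if "distinct [j, a, b, c]" for a b c
    using no_four_collinear[OF p tc that] rot[of j a b] rot[of j a c] unfolding D_def by auto
  note d = cover(2)
  consider "int p dvd D j q r \<or> int p dvd D j s t" | "int p dvd D j q s \<or> int p dvd D j r t"
    | "\<not> int p dvd D j q r" "\<not> int p dvd D j s t" "\<not> int p dvd D j q s" "\<not> int p dvd D j r t"
    by blast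
  then show ?thesis
  proof cases
    \<comment> \<open>Take the cycle that omits the edges \<open>q r\<close> and \<open>s t\<close>:
      each of its edges shares a point with the pair collinear with \<open>j\<close>, so by
      \<open>excl\<close> it is not collinear with \<open>j\<close> itself.\<close>
    case 1
    have "\<not> int p dvd D j q s \<and> \<not> int p dvd D j t r \<and> \<not> int p dvd D j q t \<and> \<not> int p dvd D j s r"
      using 1 d excl[of q r s] excl[of q r t] excl[of r q t] excl[of r q s]
        excl[of s t q] excl[of s t r] excl[of t s q] excl[of t s r] flip by auto
    then show ?thesis
      using that[of e q s t r] cover by (auto simp: insert_commute)
  next
    case 2
    have "\<not> int p dvd D j q r \<and> \<not> int p dvd D j t s \<and> \<not> int p dvd D j q t \<and> \<not> int p dvd D j r s"
      using 2 d excl[of q s r] excl[of q s t] excl[of s q t] excl[of s q r]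
        excl[of r t q] excl[of r t s] excl[of t r q] excl[of t r s] flip by auto
    then show ?thesis
      using that[of e q r t s] cover by (auto simp: insert_commute)
  next
    case 3
    then show ?thesis
      using that[of e q r s t] cover by auto
  qed
qed

subsection \<open>Averages over a finite quotient\<close>

lemma real_le_cmod: "complex_of_real r = z \<Longrightarrow> r \<le> cmod z"
  by auto

text \<open>A convex function lies above its tangent at \<open>t\<close>; in the induction the
  defect is a nonnegative multiple of the square of \<open>x - t\<close>.\<close>

lemma power_Suc_ge_tangent:
  fixes x t :: real
  assumes "0 \<le> x" "0 \<le> t"
  shows "t ^ Suc n + of_nat (Suc n) * t ^ n * (x - t) \<le> x ^ Suc n"
proof (induction n)
  case 0
  show ?case by simp
next
  case (Suc n)
  have "t ^ Suc (Suc n) + of_nat (Suc (Suc n)) * t ^ Suc n * (x - t)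
      = x * (t ^ Suc n + of_nat (Suc n) * t ^ n * (x - t)) - of_nat (Suc n) * t ^ n * (x - t)\<^sup>2"
    by (simp add: power2_eq_square algebra_simps)
  also have "\<dots> \<le> x * (t ^ Suc n + of_nat (Suc n) * t ^ n * (x - t))"
    using assms by simp
  also have "\<dots> \<le> x * x ^ Suc n"
    using Suc assms by (intro mult_left_mono)
  finally show ?case by simp
qed

text \<open>
  Elements of the finite group are represented by arbitrary lifts in the ring \<open>'a\<close> and functions on it by
  functions invariant under \<open>red\<close>, so that identities between lifts are plain ring identities.
\<close>

locale averaging =
  fixes S :: "'a::comm_ring_1 set" and p :: nat and red :: "'a \<Rightarrow> 'a"
    and ch :: "'a \<Rightarrow> 'a \<Rightarrow> complex"
  assumes prime_p: "Factorial_Ring.prime p"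
    and finite_S: "finite S"
    and red_in [simp]: "\<And>x. red x \<in> S"
    and red_id: "\<And>x. x \<in> S \<Longrightarrow> red x = x"
    and red_add: "\<And>x x' y y'. red x = red x' \<Longrightarrow> red y = red y' \<Longrightarrow> red (x + y) = red (x' + y')"
    and red_scale: "\<And>k x x'. red x = red x' \<Longrightarrow> red (of_int k * x) = red (of_int k * x')"
    and red_p: "\<And>x. red (of_int (int p) * x) = red 0"
    and ch_add: "\<And>\<xi> x y. ch \<xi> (x + y) = ch \<xi> x * ch \<xi> y"
    and ch_sym: "\<And>\<xi> x. ch \<xi> x = ch x \<xi>"
    and norm_ch [simp]: "\<And>\<xi> x. cmod (ch \<xi> x) = 1"
    and ch_red: "\<And>\<xi> x y. red x = red y \<Longrightarrow> ch \<xi> x = ch \<xi> y"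
    and ch_scale: "\<And>c \<xi> x. ch (c * \<xi>) x = ch \<xi> (c * x)"
    and ch_nondeg: "\<And>\<xi>. red \<xi> \<noteq> red 0 \<Longrightarrow> \<exists>x. ch \<xi> x \<noteq> 1"
begin

section \<open>The averaging operator and functions on the quotient\<close>

definition E :: "('a \<Rightarrow> 'b::real_normed_field) \<Rightarrow> 'b" where
  "E f = (\<Sum>x\<in>S. f x) / of_nat (card S)"

lemma S_nonempty: "S \<noteq> {}"
  using red_in by blast

lemma card_S: "card S \<noteq> 0"
  using S_nonempty finite_S by simp

lemma red_red [simp]: "red (red x) = red x"
  by (simp add: red_id)

text \<open>\<open>per\<close> singles out the functions, and \<open>compat\<close> the self-maps,
  that descend to the quotient. Their closure properties license the changes of variables in
  averages.\<close>

definition per :: "('a \<Rightarrow> 'b) \<Rightarrow> bool" where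
  "per f \<longleftrightarrow> (\<forall>x y. red x = red y \<longrightarrow> f x = f y)"

definition compat :: "('a \<Rightarrow> 'a) \<Rightarrow> bool" where
  "compat l \<longleftrightarrow> (\<forall>x y. red x = red y \<longrightarrow> red (l x) = red (l y))"

definition bdd :: "('a \<Rightarrow> complex) \<Rightarrow> bool" where
  "bdd f \<longleftrightarrow> per f \<and> (\<forall>x. cmod (f x) \<le> 1)"

definition bdd2 :: "('a \<Rightarrow> 'a \<Rightarrow> complex) \<Rightarrow> bool" where
  "bdd2 K \<longleftrightarrow> (\<forall>x. bdd (K x)) \<and> (\<forall>y. bdd (\<lambda>x. K x y))"

lemma red_diff:
  assumes "red x = red x'" "red y = red y'"
  shows "red (x - y) = red (x' - y')"
  using red_add[OF assms(1) red_scale[OF assms(2), of "-1"]] by simp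

lemma perI: "(\<And>x y. red x = red y \<Longrightarrow> f x = f y) \<Longrightarrow> per f"
  unfolding per_def by blast

lemma perD: "per f \<Longrightarrow> red x = red y \<Longrightarrow> f x = f y"
  unfolding per_def by blast

lemma compatI: "(\<And>x y. red x = red y \<Longrightarrow> red (l x) = red (l y)) \<Longrightarrow> compat l"
  unfolding compat_def by blast

lemma compatD: "compat l \<Longrightarrow> red x = red y \<Longrightarrow> red (l x) = red (l y)"
  unfolding compat_def by blast

lemma compat_id: "compat (\<lambda>x. x)" and compat_const: "compat (\<lambda>x. c)"
  by (rule compatI, assumption) (rule compatI, rule refl)

lemma compat_add: "compat l \<Longrightarrow> compat m \<Longrightarrow> compat (\<lambda>x. l x + m x)"
  by (rule compatI, rule red_add) (erule (1) compatD)+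

lemma compat_diff: "compat l \<Longrightarrow> compat m \<Longrightarrow> compat (\<lambda>x. l x - m x)"
  by (rule compatI, rule red_diff) (erule (1) compatD)+

lemma compat_scale: "compat l \<Longrightarrow> compat (\<lambda>x. of_int k * l x)"
  by (rule compatI, rule red_scale) (erule (1) compatD)

lemma per_const: "per (\<lambda>x. c)"
  by (rule perI) (rule refl)

lemma per_comp: "per f \<Longrightarrow> compat l \<Longrightarrow> per (\<lambda>x. f (l x))"
  by (rule perI, erule perD) (erule (1) compatD)

lemma per_mult: "per f \<Longrightarrow> per g \<Longrightarrow> per (\<lambda>x. f x * (g x :: complex))"
  by (rule perI, rule arg_cong2[where f = "(*)"]) (erule (1) perD)+

lemma per_cnj: "per f \<Longrightarrow> per (\<lambda>x. cnj (f x))"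
  by (rule perI, rule arg_cong[where f = cnj]) (erule (1) perD)

lemma per_power: "per f \<Longrightarrow> per (\<lambda>x. f x ^ m)"
  by (rule perI, rule arg_cong[where f = "\<lambda>z. z ^ m"]) (erule (1) perD)

lemma per_norm: "per f \<Longrightarrow> per (\<lambda>x. (cmod (f x))\<^sup>2)"
  by (rule perI, rule arg_cong[where f = "\<lambda>z. (cmod z)\<^sup>2"]) (erule (1) perD)

lemma per_E: "(\<And>z. per (\<lambda>x. F x z)) \<Longrightarrow> per (\<lambda>x. E (\<lambda>z. F x z))"
  by (rule perI, rule arg_cong[where f = E], rule ext) (rule perD)

lemma per_bdd: "bdd f \<Longrightarrow> compat l \<Longrightarrow> per (\<lambda>x. f (l x))"
  by (auto simp: bdd_def intro: per_comp)

lemma per_bdd2: "bdd2 K \<Longrightarrow> compat l \<Longrightarrow> compat m \<Longrightarrow> per (\<lambda>x. K (l x) (m x))"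
proof (rule perI)
  fix x y assume K: "bdd2 K" and l: "compat l" and m: "compat m" and xy: "red x = red y"
  have "K (l x) (m x) = K (l y) (m x)"
    using K unfolding bdd2_def bdd_def by (blast intro: perD[of "\<lambda>z. K z (m x)"] compatD[OF l xy])
  also have "\<dots> = K (l y) (m y)"
    using K unfolding bdd2_def bdd_def by (blast intro: perD[of "K (l y)"] compatD[OF m xy])
  finally show "K (l x) (m x) = K (l y) (m y)" .
qed

lemma per_ch: "compat l \<Longrightarrow> per (\<lambda>x. ch \<xi> (l x))"
  by (rule perI, rule ch_red, rule compatD)

lemma per_ch': "compat l \<Longrightarrow> per (\<lambda>x. ch (l x) \<xi>)"
  by (subst ch_sym) (rule per_ch)

lemmas compat_intros = compat_id compat_const compat_add compat_diff compat_scale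

lemmas per_intros = per_const per_mult per_cnj per_power per_norm per_E per_ch per_ch' compat_intros

lemma bdd_const: "cmod c \<le> 1 \<Longrightarrow> bdd (\<lambda>x. c)"
  by (simp add: bdd_def per_const)

lemma bdd_comp: "bdd f \<Longrightarrow> compat l \<Longrightarrow> bdd (\<lambda>x. f (l x))"
  by (simp add: bdd_def per_comp)

lemma bdd_mult: "bdd f \<Longrightarrow> bdd g \<Longrightarrow> bdd (\<lambda>x. f x * g x)"
  by (auto simp: bdd_def norm_mult intro: per_mult mult_le_one)

lemma bdd_cnj: "bdd f \<Longrightarrow> bdd (\<lambda>x. cnj (f x))"
  by (auto simp: bdd_def intro: per_cnj)

lemma bdd_power: "bdd f \<Longrightarrow> bdd (\<lambda>x. f x ^ m)"
  by (auto simp: bdd_def norm_power intro: per_power power_le_one)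

lemma bdd_ch: "compat l \<Longrightarrow> bdd (\<lambda>x. ch \<xi> (l x))"
  by (simp add: bdd_def per_ch)

lemma bdd_norm_le: "bdd f \<Longrightarrow> cmod (f x) \<le> 1"
  by (simp add: bdd_def)

lemma bdd_per: "bdd f \<Longrightarrow> per f"
  by (simp add: bdd_def)

lemma bdd2_norm_le: "bdd2 K \<Longrightarrow> cmod (K x y) \<le> 1"
  by (simp add: bdd2_def bdd_def)

lemma bdd2_comp: "bdd2 K \<Longrightarrow> compat l \<Longrightarrow> compat m \<Longrightarrow> bdd (\<lambda>x. K (l x) (m x))"
  by (simp add: bdd_def per_bdd2 bdd2_norm_le)

section \<open>Algebra of averages\<close>

lemma E_cong: "(\<And>x. f x = g x) \<Longrightarrow> E f = E g"
  by (simp add: E_def)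

lemma E_swap: "E (\<lambda>x. E (\<lambda>y. F x y)) = E (\<lambda>y. E (\<lambda>x. F x y))"
  unfolding E_def sum_divide_distrib[symmetric] by (subst sum.swap) (rule refl)

lemma E_cmult: "E (\<lambda>x. c * f x) = c * E f"
  by (simp add: E_def sum_distrib_left)

lemma E_mult_right: "E (\<lambda>x. f x * c) = E f * c"
  by (simp add: E_def sum_distrib_right)

lemma E_const [simp]: "E (\<lambda>x. c) = c"
  using card_S by (simp add: E_def)

lemma E_add: "E (\<lambda>x. f x + g x) = E f + E g"
  by (simp add: E_def sum.distrib add_divide_distrib)

lemma E_sum: "E (\<lambda>x. \<Sum>i\<in>I. f i x) = (\<Sum>i\<in>I. E (f i))"
  by (simp add: E_def sum_divide_distrib[symmetric] sum.swap[of _ S])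

lemma E_cnj: "E (\<lambda>x. cnj (f x)) = cnj (E f)"
  by (simp add: E_def)

lemma E_of_real: "E (\<lambda>x. complex_of_real (f x)) = complex_of_real (E f)"
  by (simp add: E_def)

lemma E_mono: "(\<And>x. f x \<le> g x) \<Longrightarrow> E f \<le> (E g :: real)"
  by (simp add: E_def divide_right_mono sum_mono)

lemma E_nonneg: "(\<And>x. 0 \<le> f x) \<Longrightarrow> 0 \<le> (E f :: real)"
  by (simp add: E_def sum_nonneg)

lemma E_le_const: "(\<And>x. f x \<le> c) \<Longrightarrow> E f \<le> (c :: real)"
  using E_mono[of f "\<lambda>_. c"] by simp

lemma norm_E_le: "norm (E f) \<le> E (\<lambda>x. norm (f x))"
  by (simp add: E_def norm_divide divide_right_mono norm_sum)

lemma norm_E_le_const: "(\<And>x. norm (f x) \<le> c) \<Longrightarrow> norm (E f) \<le> c"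
  by (rule order_trans[OF norm_E_le E_le_const])

lemma E_prod2: "E f * E g = E (\<lambda>x. E (\<lambda>y. f x * g y))"
  by (simp add: E_cmult E_mult_right)

lemma E_norm_square:
  "complex_of_real ((cmod (E f))\<^sup>2) = E (\<lambda>x. E (\<lambda>y. f x * cnj (f y)))"
  unfolding complex_norm_square E_cnj[symmetric] E_prod2 ..

lemma bdd_E: "(\<And>z. bdd (\<lambda>x. F x z)) \<Longrightarrow> bdd (\<lambda>x. E (\<lambda>z. F x z))"
  by (auto simp: bdd_def intro: per_E norm_E_le_const)

lemmas bdd_intros = bdd_const bdd_mult bdd_cnj bdd_power bdd_ch bdd_E compat_intros

lemma bdd2I: "(\<And>x. bdd (K x)) \<Longrightarrow> (\<And>y. bdd (\<lambda>x. K x y)) \<Longrightarrow> bdd2 K"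
  by (simp add: bdd2_def)

section \<open>Changes of variables\<close>

lemma sum_reindex:
  assumes "per (F :: 'a \<Rightarrow> 'b::comm_monoid_add)" "compat l"
    and inj: "\<And>x y. red (l x) = red (l y) \<Longrightarrow> red x = red y"
  shows "(\<Sum>x\<in>S. F (l x)) = (\<Sum>x\<in>S. F x)"
proof -
  have "inj_on (\<lambda>x. red (l x)) S"
    by (rule inj_onI) (metis inj red_id)
  then have "bij_betw (\<lambda>x. red (l x)) S S"
    using finite_S by (simp add: bij_betw_def endo_inj_surj image_subset_iff)
  then have "(\<Sum>x\<in>S. F (red (l x))) = (\<Sum>x\<in>S. F x)"
    by (rule sum.reindex_bij_betw)
  moreover have "F (red (l x)) = F (l x)" for x
    using assms(1) red_red unfolding per_def by blast
  ultimately show ?thesis by simp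
qed

lemma E_reindex:
  assumes "per F" "compat l" "\<And>x y. red (l x) = red (l y) \<Longrightarrow> red x = red y"
  shows "E (\<lambda>x. F (l x)) = E F"
  using sum_reindex[OF assms] by (simp add: E_def)

lemma inj_shift: "red (x + c) = red (y + c) \<Longrightarrow> red x = red y"
  using red_diff[of "x + c" "y + c" c c] by simp

lemma E_shift: "per F \<Longrightarrow> E (\<lambda>x. F (x + c)) = E F"
  by (rule E_reindex[where l = "\<lambda>x. x + c"]) (assumption, intro compat_intros, erule inj_shift)

lemma E_shift_left: "per F \<Longrightarrow> E (\<lambda>x. F (c + x)) = E F"
  using E_shift[of F c] by (simp add: add.commute)

lemma E_shift_diff: "per F \<Longrightarrow> E (\<lambda>x. F (x - c)) = E F"
  using E_shift[of F "- c"] by simp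

lemma red_cong_scalar:
  assumes "[k = l] (mod int p)" shows "red (of_int k * x) = red (of_int l * x)"
proof -
  obtain m where "k = l + int p * m"
    using assms by (metis cong_iff_lin mult.commute cong_sym)
  then have "of_int k * x = of_int l * x + of_int (int p) * (of_int m * x)"
    by (simp add: algebra_simps)
  then show ?thesis
    using red_add[OF refl[of "red (of_int l * x)"] red_p[of "of_int m * x"]] by simp
qed

definition unit_mod :: "int \<Rightarrow> bool" where
  "unit_mod k \<longleftrightarrow> \<not> [k = 0] (mod int p)"

lemma unit_mod_inverse:
  assumes "unit_mod k" obtains k' where "[k' * k = 1] (mod int p)"
proof -
  have "coprime k (int p)"
    using assms prime_p unfolding unit_mod_def
    by (metis cong_0_iff coprime_commute prime_imp_coprime prime_nat_int_transfer)
  then show ?thesis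
    using that by (metis cong_solve_coprime_int mult.commute)
qed

lemma unit_mod_mult: "unit_mod a \<Longrightarrow> unit_mod b \<Longrightarrow> unit_mod (a * b)"
  using prime_p unfolding unit_mod_def
  by (simp add: cong_0_iff prime_dvd_mult_iff)

lemma inj_scale:
  assumes "unit_mod k" "red (of_int k * x) = red (of_int k * y)"
  shows "red x = red y"
proof -
  obtain k' where k': "[k' * k = 1] (mod int p)"
    using unit_mod_inverse[OF assms(1)] by blast
  have "red (of_int 1 * z) = red (of_int k' * (of_int k * z))" for z
    using red_cong_scalar[OF k', of z] by (simp add: mult.assoc)
  then show ?thesis
    using red_scale[OF assms(2), of k'] by simp
qed

lemma E_scale: "per F \<Longrightarrow> unit_mod k \<Longrightarrow> E (\<lambda>x. F (of_int k * x)) = E F"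
  by (rule E_reindex[where l = "\<lambda>x. of_int k * x"]) (assumption, intro compat_intros, erule (1) inj_scale)

lemma unit_mod_minus1: "unit_mod (-1)"
  using prime_p unfolding unit_mod_def
  by (metis cong_0_iff dvd_minus_iff not_prime_unit prime_nat_int_transfer)

lemma E_reflect: "per F \<Longrightarrow> E (\<lambda>x. F (c - x)) = E F"
proof -
  assume F: "per F"
  have "E (\<lambda>x. F (c + of_int (-1) * x)) = E (\<lambda>x. F (c + x))"
    by (rule E_scale[OF _ unit_mod_minus1, of "\<lambda>x. F (c + x)"]) (intro per_comp[OF F] compat_intros)
  then show ?thesis
    using E_shift_left[OF F] by simp
qed

section \<open>Inequalities of Cauchy-Schwarz and Jensen\<close>

lemma E_cauchy_schwarz:
  "(cmod (E (\<lambda>x. f x * g x)))\<^sup>2 \<le> E (\<lambda>x. (cmod (f x))\<^sup>2) * E (\<lambda>x. (cmod (g x))\<^sup>2)"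
proof -
  have "cmod (\<Sum>x\<in>S. f x * g x) \<le> (\<Sum>x\<in>S. cmod (f x) * cmod (g x))"
    by (rule order_trans[OF norm_sum]) (simp add: norm_mult)
  then have "(cmod (\<Sum>x\<in>S. f x * g x))\<^sup>2 \<le> (\<Sum>x\<in>S. cmod (f x) * cmod (g x))\<^sup>2"
    by (intro power_mono) auto
  also have "\<dots> \<le> (\<Sum>x\<in>S. (cmod (f x))\<^sup>2) * (\<Sum>x\<in>S. (cmod (g x))\<^sup>2)"
    by (rule Cauchy_Schwarz_ineq_sum)
  finally show ?thesis
    by (simp add: E_def norm_divide power_divide power2_eq_square divide_right_mono)
qed

lemma E_cauchy_schwarz_bdd:
  assumes "\<And>x. cmod (f x) \<le> 1"
  shows "(cmod (E (\<lambda>x. f x * g x)))\<^sup>2 \<le> E (\<lambda>x. (cmod (g x))\<^sup>2)"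
proof -
  have "E (\<lambda>x. (cmod (f x))\<^sup>2) \<le> 1"
    using assms by (intro E_le_const) (simp add: power_le_one)
  moreover have "0 \<le> E (\<lambda>x. (cmod (g x))\<^sup>2)" by (intro E_nonneg) simp
  ultimately show ?thesis
    using E_cauchy_schwarz[of f g] mult_right_mono[of "E (\<lambda>x. (cmod (f x))\<^sup>2)" 1 "E (\<lambda>x. (cmod (g x))\<^sup>2)"]
    by linarith
qed

lemma E_jensen_square: "(E f)\<^sup>2 \<le> E (\<lambda>x. (f x)\<^sup>2)" for f :: "'a \<Rightarrow> real"
proof -
  have "(\<Sum>x\<in>S. 1 * f x)\<^sup>2 \<le> (\<Sum>x\<in>S. 1\<^sup>2) * (\<Sum>x\<in>S. (f x)\<^sup>2)"
    by (rule Cauchy_Schwarz_ineq_sum)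
  then show ?thesis
    using card_S by (simp add: E_def power_divide power2_eq_square field_simps)
qed

subsection \<open>Fourier analysis\<close>

text \<open>Averages on the physical side, sums on the frequency side. Frequencies range over the
  same set \<open>S\<close>, since \<open>ch\<close> identifies the group with its dual.\<close>

definition fourier :: "('a \<Rightarrow> complex) \<Rightarrow> 'a \<Rightarrow> complex" where
  "fourier f \<xi> = E (\<lambda>x. f x * cnj (ch \<xi> x))"

lemma ch_zero [simp]: "ch \<xi> 0 = 1"
proof -
  have "ch \<xi> 0 * ch \<xi> 0 = ch \<xi> 0 * 1"
    using ch_add[of \<xi> 0 0] by simp
  moreover have "ch \<xi> 0 \<noteq> 0"
    using norm_ch[of \<xi> 0] by fastforce
  ultimately show ?thesis by simp
qed

lemma ch_cnj_mult [simp]: "ch \<xi> x * cnj (ch \<xi> x) = 1"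
  by (simp add: complex_norm_square[symmetric])

lemma ch_minus: "ch \<xi> (- x) = cnj (ch \<xi> x)"
proof -
  have "ch \<xi> (- x) * (ch \<xi> x * cnj (ch \<xi> x)) = (ch \<xi> (- x) * ch \<xi> x) * cnj (ch \<xi> x)"
    by (simp only: mult.assoc)
  also have "ch \<xi> (- x) * ch \<xi> x = 1"
    by (simp add: ch_add[symmetric])
  finally show ?thesis by simp
qed

lemma ch_diff: "ch \<xi> (x - y) = ch \<xi> x * cnj (ch \<xi> y)"
  using ch_add[of \<xi> x "- y"] by (simp add: ch_minus)

lemma ch_diff_left: "ch (\<xi> - \<zeta>) x = ch \<xi> x * cnj (ch \<zeta> x)"
  by (simp add: ch_sym[of _ x] ch_diff)

text \<open>Orthogonality: translating by some \<open>c\<close> with \<open>ch \<xi> c\<close>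
  different from 1 multiplies the average by that value, so it is 0.\<close>

lemma E_ch: "E (ch \<xi>) = (if red \<xi> = red 0 then 1 else 0)"
proof (cases "red \<xi> = red 0")
  case True
  have "ch \<xi> x = 1" for x
    by (metis True ch_red ch_sym ch_zero)
  then show ?thesis using True by (simp cong: E_cong)
next
  case False
  then obtain c where c: "ch \<xi> c \<noteq> 1"
    using ch_nondeg by blast
  have "E (ch \<xi>) = E (\<lambda>x. ch \<xi> (x + c))"
    by (rule E_shift[symmetric]) (intro per_intros)
  also have "\<dots> = E (ch \<xi>) * ch \<xi> c"
    by (simp add: ch_add E_mult_right)
  finally show ?thesis
    using c False by simp
qed

lemma sum_ch: "(\<Sum>\<xi>\<in>S. ch \<xi> x) = (if red x = red 0 then of_nat (card S) else 0)"
  using E_ch[of x] card_S unfolding E_def ch_sym[of x] by (auto split: if_splits)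

lemma red_diff_zero_iff: "red (x - y) = red 0 \<longleftrightarrow> red x = red y"
  using red_add[of "x - y" 0 y y] red_diff[of x y y y] by auto

lemma fourier_inversion:
  assumes "per f" shows "f x = (\<Sum>\<xi>\<in>S. fourier f \<xi> * ch \<xi> x)"
proof -
  have "(\<Sum>\<xi>\<in>S. fourier f \<xi> * ch \<xi> x) = E (\<lambda>y. f y * (\<Sum>\<xi>\<in>S. ch \<xi> (x - y)))"
    unfolding fourier_def E_mult_right[symmetric] E_sum[symmetric]
    by (intro E_cong) (simp add: sum_distrib_left ch_diff mult_ac)
  also have "\<dots> = E (\<lambda>y. if red x = red y then f y * of_nat (card S) else 0)"
    by (intro E_cong) (simp add: sum_ch red_diff_zero_iff)
  also have "\<dots> = (\<Sum>y\<in>S. if red x = y then f y * of_nat (card S) else 0) / of_nat (card S)"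
    unfolding E_def by (intro arg_cong2[where f = "(/)"] sum.cong refl) (simp add: red_id)
  also have "\<dots> = f (red x)"
    using finite_S card_S by simp
  also have "\<dots> = f x"
    by (rule perD[OF assms]) simp
  finally show ?thesis by simp
qed

lemma parseval_inner:
  assumes "per f" shows "E (\<lambda>x. f x * cnj (g x)) = (\<Sum>\<xi>\<in>S. fourier f \<xi> * cnj (fourier g \<xi>))"
proof -
  have "E (\<lambda>x. f x * cnj (g x)) = E (\<lambda>x. \<Sum>\<xi>\<in>S. fourier f \<xi> * (ch \<xi> x * cnj (g x)))"
    by (intro E_cong, subst fourier_inversion[OF assms]) (simp add: sum_distrib_right mult.assoc)
  also have "\<dots> = (\<Sum>\<xi>\<in>S. fourier f \<xi> * cnj (fourier g \<xi>))"
    unfolding E_sum E_cmult fourier_def E_cnj[symmetric]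
    by (intro sum.cong refl arg_cong2[where f = "(*)"] E_cong) simp
  finally show ?thesis .
qed

lemma parseval:
  assumes "per f" shows "(\<Sum>\<xi>\<in>S. (cmod (fourier f \<xi>))\<^sup>2) = E (\<lambda>x. (cmod (f x))\<^sup>2)"
proof -
  have "complex_of_real (\<Sum>\<xi>\<in>S. (cmod (fourier f \<xi>))\<^sup>2) = complex_of_real (E (\<lambda>x. (cmod (f x))\<^sup>2))"
    unfolding of_real_sum E_of_real[symmetric] complex_norm_square
    by (rule parseval_inner[OF assms, symmetric])
  then show ?thesis by (simp only: of_real_eq_iff)
qed

lemma parseval_le_1:
  assumes "bdd f" shows "(\<Sum>\<xi>\<in>S. (cmod (fourier f \<xi>))\<^sup>2) \<le> 1"
  unfolding parseval[OF bdd_per[OF assms]]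
  using bdd_norm_le[OF assms] by (intro E_le_const) (simp add: power_le_one)

lemma fourier_pairing:
  assumes "per f"
  shows "E (\<lambda>x. f x * g x) = (\<Sum>\<xi>\<in>S. fourier f \<xi> * E (\<lambda>x. g x * ch \<xi> x))"
  using parseval_inner[OF assms, of "\<lambda>x. cnj (g x)"]
  by (simp add: fourier_def E_cnj[symmetric])

subsection \<open>Mixtures of products\<close>

text \<open>Nested averages of bounded rank-one functions of \<open>s\<close> and \<open>t\<close>.
  The class is closed under products, and the bounds proved for it are convex in the kernel, so they
  pass from products to mixtures by induction.\<close>

inductive rk :: "('a \<Rightarrow> 'a \<Rightarrow> complex) \<Rightarrow> bool" where
  rk_base: "bdd A \<Longrightarrow> bdd B \<Longrightarrow> rk (\<lambda>s t. A s * B t)"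
| rk_E: "(\<And>z. rk (\<Psi> z)) \<Longrightarrow> rk (\<lambda>s t. E (\<lambda>z. \<Psi> z s t))"

lemma rk_left: "bdd A \<Longrightarrow> rk (\<lambda>s t. A s)"
  using rk_base[of A "\<lambda>_. 1"] by (simp add: bdd_const)

lemma rk_right: "bdd B \<Longrightarrow> rk (\<lambda>s t. B t)"
  using rk_base[of "\<lambda>_. 1" B] by (simp add: bdd_const)

lemma rk_const: "cmod c \<le> 1 \<Longrightarrow> rk (\<lambda>s t. c)"
  using rk_left[of "\<lambda>_. c"] by (simp add: bdd_const)

lemma rk_comp: "rk \<Psi> \<Longrightarrow> compat l \<Longrightarrow> compat m \<Longrightarrow> rk (\<lambda>s t. \<Psi> (l s) (m t))"
proof (induction rule: rk.induct)
  case (rk_base A B)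
  show ?case
    by (rule rk.rk_base[OF bdd_comp[OF rk_base(1,3)] bdd_comp[OF rk_base(2,4)]])
next
  case (rk_E \<Psi>)
  show ?case by (rule rk.rk_E) (rule rk_E.IH[OF rk_E.prems])
qed

lemma rk_cnj: "rk \<Psi> \<Longrightarrow> rk (\<lambda>s t. cnj (\<Psi> s t))"
proof (induction rule: rk.induct)
  case (rk_base A B)
  show ?case
    using rk.rk_base[OF bdd_cnj[OF rk_base(1)] bdd_cnj[OF rk_base(2)]] by simp
next
  case (rk_E \<Psi>)
  show ?case
    using rk.rk_E[of "\<lambda>z s t. cnj (\<Psi> z s t)", OF rk_E.IH] by (simp add: E_cnj)
qed

lemma rk_mult: "rk \<Psi> \<Longrightarrow> rk \<Theta> \<Longrightarrow> rk (\<lambda>s t. \<Psi> s t * \<Theta> s t)"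
proof (induction arbitrary: \<Theta> rule: rk.induct)
  case (rk_base A B)
  from rk_base(3) show ?case
  proof (induction rule: rk.induct)
    case (rk_base A' B')
    show ?case
      using rk.rk_base[OF bdd_mult[OF \<open>bdd A\<close> rk_base(1)] bdd_mult[OF \<open>bdd B\<close> rk_base(2)]]
      by (simp add: mult_ac)
  next
    case (rk_E \<Theta>)
    show ?case
      using rk.rk_E[of "\<lambda>z s t. A s * B t * \<Theta> z s t", OF rk_E.IH] by (simp add: E_cmult)
  qed
next
  case (rk_E \<Psi>)
  show ?case
    using rk.rk_E[of "\<lambda>z s t. \<Psi> z s t * \<Theta> s t", OF rk_E.IH[OF rk_E.prems]]
    by (simp add: E_mult_right)
qed

lemma rk_power: "rk \<Psi> \<Longrightarrow> rk (\<lambda>s t. \<Psi> s t ^ m)"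
proof (induction m)
  case 0
  show ?case using rk_const[of 1] by simp
next
  case (Suc m)
  show ?case using rk_mult[OF Suc(2) Suc(1)[OF Suc(2)]] by simp
qed

text \<open>For a product the coefficient at \<open>\<xi>\<close> factors into one coefficient of
  \<open>A\<close> at \<open>\<alpha> * \<xi>\<close> and one of \<open>B\<close> at
  \<open>\<beta> * \<xi>\<close>. The units permute the frequencies, so Parseval and the inequality
  of arithmetic and geometric means give the bound.\<close>

lemma rk_sum_fourier:
  assumes "rk \<Psi>" "unit_mod \<alpha>" "unit_mod \<beta>"
  shows "(\<Sum>\<xi>\<in>S. cmod (E (\<lambda>s. E (\<lambda>t. \<Psi> s t * ch \<xi> (of_int \<alpha> * s + of_int \<beta> * t))))) \<le> 1"
  using assms(1)
proof (induction rule: rk.induct)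
  case (rk_base A B)
  define a where "a k = E (\<lambda>s. A s * ch k s)" for k
  define b where "b k = E (\<lambda>s. B s * ch k s)" for k
  have sq: "(\<Sum>\<xi>\<in>S. (cmod (E (\<lambda>s. F s * ch (of_int \<gamma> * \<xi>) s)))\<^sup>2) \<le> 1"
    if F: "bdd F" and \<gamma>: "unit_mod \<gamma>" for F \<gamma>
  proof -
    have "(\<Sum>\<xi>\<in>S. (cmod (E (\<lambda>s. F s * ch (of_int \<gamma> * \<xi>) s)))\<^sup>2)
        = (\<Sum>\<xi>\<in>S. (cmod (E (\<lambda>s. F s * ch \<xi> s)))\<^sup>2)"
      by (rule sum_reindex[of "\<lambda>\<xi>. (cmod (E (\<lambda>s. F s * ch \<xi> s)))\<^sup>2" "\<lambda>\<xi>. of_int \<gamma> * \<xi>"])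
        (intro per_intros, intro compat_intros, erule inj_scale[OF \<gamma>])
    also have "\<dots> = (\<Sum>\<xi>\<in>S. (cmod (fourier (\<lambda>s. cnj (F s)) \<xi>))\<^sup>2)"
    proof (intro sum.cong refl)
      fix \<xi>
      have "fourier (\<lambda>s. cnj (F s)) \<xi> = cnj (E (\<lambda>s. F s * ch \<xi> s))"
        by (simp add: fourier_def E_cnj[symmetric])
      then show "(cmod (E (\<lambda>s. F s * ch \<xi> s)))\<^sup>2 = (cmod (fourier (\<lambda>s. cnj (F s)) \<xi>))\<^sup>2"
        by simp
    qed
    also have "\<dots> \<le> 1" by (rule parseval_le_1[OF bdd_cnj[OF F]])
    finally show ?thesis .
  qed
  have "E (\<lambda>s. E (\<lambda>t. A s * B t * ch \<xi> (of_int \<alpha> * s + of_int \<beta> * t)))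
      = a (of_int \<alpha> * \<xi>) * b (of_int \<beta> * \<xi>)" for \<xi>
    unfolding a_def b_def E_prod2 ch_scale ch_add by (intro E_cong) simp
  then have "(\<Sum>\<xi>\<in>S. cmod (E (\<lambda>s. E (\<lambda>t. A s * B t * ch \<xi> (of_int \<alpha> * s + of_int \<beta> * t)))))
      = (\<Sum>\<xi>\<in>S. cmod (a (of_int \<alpha> * \<xi>)) * cmod (b (of_int \<beta> * \<xi>)))"
    by (simp add: norm_mult)
  also have "\<dots> \<le> (\<Sum>\<xi>\<in>S. ((cmod (a (of_int \<alpha> * \<xi>)))\<^sup>2 + (cmod (b (of_int \<beta> * \<xi>)))\<^sup>2) / 2)"
  proof (rule sum_mono)
    fix \<xi>
    show "cmod (a (of_int \<alpha> * \<xi>)) * cmod (b (of_int \<beta> * \<xi>))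
        \<le> ((cmod (a (of_int \<alpha> * \<xi>)))\<^sup>2 + (cmod (b (of_int \<beta> * \<xi>)))\<^sup>2) / 2"
      using sum_squares_bound[of "cmod (a (of_int \<alpha> * \<xi>))" "cmod (b (of_int \<beta> * \<xi>))"] by simp
  qed
  also have "\<dots> = ((\<Sum>\<xi>\<in>S. (cmod (a (of_int \<alpha> * \<xi>)))\<^sup>2) + (\<Sum>\<xi>\<in>S. (cmod (b (of_int \<beta> * \<xi>)))\<^sup>2)) / 2"
    by (simp add: sum.distrib sum_divide_distrib[symmetric])
  also have "\<dots> \<le> 1"
    using sq[OF rk_base(1) assms(2)] sq[OF rk_base(2) assms(3)] unfolding a_def b_def by simp
  finally show ?case .
next
  case (rk_E \<Psi>)
  let ?F = "\<lambda>z \<xi>. E (\<lambda>s. E (\<lambda>t. \<Psi> z s t * ch \<xi> (of_int \<alpha> * s + of_int \<beta> * t)))"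
  have eq: "E (\<lambda>s. E (\<lambda>t. E (\<lambda>z. \<Psi> z s t) * ch \<xi> (of_int \<alpha> * s + of_int \<beta> * t))) = E (\<lambda>z. ?F z \<xi>)" for \<xi>
    unfolding E_mult_right[symmetric] by (subst (3) E_swap, subst (2) E_swap, rule refl)
  have "(\<Sum>\<xi>\<in>S. cmod (E (\<lambda>z. ?F z \<xi>))) \<le> (\<Sum>\<xi>\<in>S. E (\<lambda>z. cmod (?F z \<xi>)))"
    by (intro sum_mono norm_E_le)
  also have "\<dots> = E (\<lambda>z. \<Sum>\<xi>\<in>S. cmod (?F z \<xi>))"
    by (simp add: E_sum)
  also have "\<dots> \<le> 1"
    by (intro E_le_const rk_E.IH)
  finally show ?case unfolding eq .
qed

text \<open>For a product, fixing \<open>s\<close> only contributes the bounded factor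
  \<open>A s\<close>, so the squared coefficients of \<open>B\<close> serve as \<open>w\<close> for
  all \<open>s\<close> at once; for mixtures these weights are averaged. The uniformity in
  \<open>s\<close> is the point.\<close>

lemma rk_fibre_fourier:
  assumes "rk \<Psi>" "unit_mod \<beta>"
  shows "\<exists>w. (\<forall>\<xi>. 0 \<le> w \<xi>) \<and> (\<Sum>\<xi>\<in>S. w \<xi>) \<le> (1::real) \<and>
    (\<forall>s \<xi>. (cmod (E (\<lambda>t. \<Psi> s t * ch \<xi> (of_int \<beta> * t))))\<^sup>2 \<le> w \<xi>)"
  using assms(1)
proof (induction rule: rk.induct)
  case (rk_base A B)
  define w where "w \<xi> = (cmod (E (\<lambda>t. B t * ch \<xi> (of_int \<beta> * t))))\<^sup>2" for \<xi>
  have "(\<Sum>\<xi>\<in>S. w \<xi>) \<le> 1"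
  proof -
    have "w \<xi> = (cmod (fourier (\<lambda>s. cnj (B s)) (of_int \<beta> * \<xi>)))\<^sup>2" for \<xi>
    proof -
      have "fourier (\<lambda>s. cnj (B s)) (of_int \<beta> * \<xi>) = cnj (E (\<lambda>t. B t * ch \<xi> (of_int \<beta> * t)))"
        by (simp add: fourier_def E_cnj[symmetric] ch_scale)
      then show ?thesis by (simp add: w_def)
    qed
    then have "(\<Sum>\<xi>\<in>S. w \<xi>) = (\<Sum>\<xi>\<in>S. (cmod (fourier (\<lambda>s. cnj (B s)) (of_int \<beta> * \<xi>)))\<^sup>2)"
      by simp
    also have "\<dots> = (\<Sum>\<xi>\<in>S. (cmod (fourier (\<lambda>s. cnj (B s)) \<xi>))\<^sup>2)"
      unfolding fourier_def
      by (rule sum_reindex[of "\<lambda>\<xi>. (cmod (E (\<lambda>x. cnj (B x) * cnj (ch \<xi> x))))\<^sup>2" "\<lambda>\<xi>. of_int \<beta> * \<xi>"])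
        (intro per_intros, intro compat_intros, erule inj_scale[OF assms(2)])
    also have "\<dots> \<le> 1" by (rule parseval_le_1[OF bdd_cnj[OF rk_base(2)]])
    finally show ?thesis .
  qed
  moreover have "(cmod (E (\<lambda>t. A s * B t * ch \<xi> (of_int \<beta> * t))))\<^sup>2 \<le> w \<xi>" for s \<xi>
  proof -
    have "cmod (A s) * cmod (E (\<lambda>t. B t * ch \<xi> (of_int \<beta> * t))) \<le> cmod (E (\<lambda>t. B t * ch \<xi> (of_int \<beta> * t)))"
      using bdd_norm_le[OF rk_base(1)] by (intro mult_left_le_one_le) auto
    then show ?thesis
      unfolding w_def mult.assoc E_cmult norm_mult by (intro power_mono) auto
  qed
  ultimately show ?case by (intro exI[of _ w]) (auto simp: w_def)
next
  case (rk_E \<Psi>)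
  then obtain w where w: "\<And>z \<xi>. 0 \<le> w z \<xi>" "\<And>z. (\<Sum>\<xi>\<in>S. w z \<xi>) \<le> (1::real)"
    "\<And>z s \<xi>. (cmod (E (\<lambda>t. \<Psi> z s t * ch \<xi> (of_int \<beta> * t))))\<^sup>2 \<le> w z \<xi>"
    by metis
  define W where "W \<xi> = E (\<lambda>z. w z \<xi>)" for \<xi>
  have "(\<Sum>\<xi>\<in>S. W \<xi>) \<le> 1"
    unfolding W_def E_sum[symmetric] by (intro E_le_const w)
  moreover have "0 \<le> W \<xi>" for \<xi>
    unfolding W_def by (intro E_nonneg w)
  moreover have "(cmod (E (\<lambda>t. E (\<lambda>z. \<Psi> z s t) * ch \<xi> (of_int \<beta> * t))))\<^sup>2 \<le> W \<xi>" for s \<xi>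
  proof -
    have "E (\<lambda>t. E (\<lambda>z. \<Psi> z s t) * ch \<xi> (of_int \<beta> * t)) = E (\<lambda>z. E (\<lambda>t. \<Psi> z s t * ch \<xi> (of_int \<beta> * t)))"
      unfolding E_mult_right[symmetric] by (subst E_swap) (rule refl)
    then have "(cmod (E (\<lambda>t. E (\<lambda>z. \<Psi> z s t) * ch \<xi> (of_int \<beta> * t))))\<^sup>2
        \<le> (E (\<lambda>z. cmod (E (\<lambda>t. \<Psi> z s t * ch \<xi> (of_int \<beta> * t)))))\<^sup>2"
      by (simp add: power_mono norm_E_le)
    also have "\<dots> \<le> W \<xi>"
      unfolding W_def by (rule order_trans[OF E_jensen_square E_mono[OF w(3)]])
    finally show ?thesis .
  qed
  ultimately show ?case by blast
qed

subsection \<open>Box norms\<close>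

lemma E_rotate: "E (\<lambda>x. E (\<lambda>y. E (\<lambda>z. F x y z))) = E (\<lambda>y. E (\<lambda>z. E (\<lambda>x. F x y z)))"
  by (rule trans[OF E_swap], rule E_cong, rule E_swap)

lemma E_swap_pairs:
  "E (\<lambda>x. E (\<lambda>y. E (\<lambda>s. E (\<lambda>t. F x y s t)))) = E (\<lambda>s. E (\<lambda>t. E (\<lambda>x. E (\<lambda>y. F x y s t))))"
proof -
  have "E (\<lambda>x. E (\<lambda>y. E (\<lambda>s. E (\<lambda>t. F x y s t)))) = E (\<lambda>x. E (\<lambda>s. E (\<lambda>t. E (\<lambda>y. F x y s t))))"
    by (intro E_cong E_rotate)
  also have "\<dots> = E (\<lambda>s. E (\<lambda>t. E (\<lambda>x. E (\<lambda>y. F x y s t))))"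
    by (rule E_rotate)
  finally show ?thesis .
qed

lemma E_jensen_square2: "(E (\<lambda>x. E (\<lambda>y. F x y)))\<^sup>2 \<le> E (\<lambda>x. E (\<lambda>y. (F x y)\<^sup>2))"
  for F :: "'a \<Rightarrow> 'a \<Rightarrow> real"
  by (rule order_trans[OF E_jensen_square E_mono[OF E_jensen_square]])

lemma E_jensen_power4: "(E f) ^ 4 \<le> E (\<lambda>x. (f x) ^ 4)" for f :: "'a \<Rightarrow> real"
proof -
  have "((E f)\<^sup>2)\<^sup>2 \<le> (E (\<lambda>x. (f x)\<^sup>2))\<^sup>2"
    by (intro power_mono E_jensen_square) simp
  also have "\<dots> \<le> E (\<lambda>x. ((f x)\<^sup>2)\<^sup>2)" by (rule E_jensen_square)
  finally show ?thesis by simp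
qed

lemma norm_E_power4_le: "(cmod (E f)) ^ 4 \<le> E (\<lambda>x. (cmod (f x)) ^ 4)"
  by (rule order_trans[OF power_mono[OF norm_E_le] E_jensen_power4]) simp

text \<open>Fourth power of the Gowers box norm, with the average over two values of
  \<open>s\<close> collapsed into a square.\<close>

definition box :: "('a \<Rightarrow> 'a \<Rightarrow> complex) \<Rightarrow> real" where
  "box F = E (\<lambda>t. E (\<lambda>t'. (cmod (E (\<lambda>s. F s t * cnj (F s t'))))\<^sup>2))"

text \<open>One Cauchy-Schwarz removes \<open>A\<close>, expanding the square and a second one
  remove \<open>B\<close>; mixtures follow by convexity of the fourth power.\<close>

lemma rk_box:
  assumes "rk \<Psi>"
  shows "(cmod (E (\<lambda>s. E (\<lambda>t. F s t * \<Psi> s t)))) ^ 4 \<le> box F"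
  using assms
proof (induction rule: rk.induct)
  case (rk_base A B)
  define N where "N t t' = cmod (E (\<lambda>s. F s t * cnj (F s t')))" for t t'
  define X where "X = E (\<lambda>s. E (\<lambda>t. F s t * (A s * B t)))"
  define Y where "Y = E (\<lambda>s. (cmod (E (\<lambda>t. F s t * B t)))\<^sup>2)"
  have "X = E (\<lambda>s. A s * E (\<lambda>t. F s t * B t))"
    unfolding X_def E_cmult[symmetric] by (intro E_cong) (simp add: mult_ac)
  then have XY: "(cmod X)\<^sup>2 \<le> Y"
    unfolding Y_def using E_cauchy_schwarz_bdd[of A] bdd_norm_le[OF rk_base(1)] by simp
  have "complex_of_real Y = E (\<lambda>s. E (\<lambda>t. E (\<lambda>t'. F s t * B t * cnj (F s t' * B t'))))"
    unfolding Y_def E_of_real[symmetric] E_norm_square ..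
  also have "\<dots> = E (\<lambda>t. E (\<lambda>t'. B t * cnj (B t') * E (\<lambda>s. F s t * cnj (F s t'))))"
    unfolding E_cmult[symmetric] by (subst E_rotate) (intro E_cong, simp add: mult_ac)
  finally have "Y \<le> cmod (E (\<lambda>t. E (\<lambda>t'. B t * cnj (B t') * E (\<lambda>s. F s t * cnj (F s t')))))"
    by (metis complex_Re_le_cmod Re_complex_of_real)
  also have "\<dots> \<le> E (\<lambda>t. E (\<lambda>t'. N t t'))"
  proof (intro order_trans[OF norm_E_le] E_mono)
    fix t t'
    have "cmod (B t) * cmod (B t') \<le> 1"
      using bdd_norm_le[OF rk_base(2)] by (intro mult_le_one) auto
    then show "cmod (B t * cnj (B t') * E (\<lambda>s. F s t * cnj (F s t'))) \<le> N t t'"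
      unfolding N_def norm_mult complex_mod_cnj by (intro mult_left_le_one_le) auto
  qed
  finally have "Y \<le> E (\<lambda>t. E (\<lambda>t'. N t t'))" .
  moreover have "0 \<le> Y"
    unfolding Y_def by (intro E_nonneg) simp
  ultimately have "Y\<^sup>2 \<le> (E (\<lambda>t. E (\<lambda>t'. N t t')))\<^sup>2"
    by (intro power_mono)
  also have "\<dots> \<le> box F"
    unfolding box_def N_def[symmetric] by (rule E_jensen_square2)
  finally have "Y\<^sup>2 \<le> box F" .
  moreover have "((cmod X)\<^sup>2)\<^sup>2 \<le> Y\<^sup>2"
    using XY by (intro power_mono) auto
  ultimately show ?case
    unfolding X_def by simp
next
  case (rk_E \<Psi>)
  have "E (\<lambda>s. E (\<lambda>t. F s t * E (\<lambda>z. \<Psi> z s t))) = E (\<lambda>z. E (\<lambda>s. E (\<lambda>t. F s t * \<Psi> z s t)))"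
    unfolding E_cmult[symmetric] by (rule E_rotate[symmetric])
  then show ?case
    using order_trans[OF norm_E_power4_le E_le_const[OF rk_E.IH]] by simp
qed

text \<open>The vertices other than \<open>y\<close> of a parallelogram; \<open>y\<close> is kept
  apart because Cauchy-Schwarz will remove the function there. With differences instead of sums,
  moving \<open>a\<close>, \<open>b\<close> and \<open>y\<close> together leaves each vertex
  dependent on at most one of the shifts.\<close>

definition corners :: "('a \<Rightarrow> complex) \<Rightarrow> 'a \<Rightarrow> 'a \<Rightarrow> 'a \<Rightarrow> complex" where
  "corners f y a b = cnj (f (y - a)) * cnj (f (y - b)) * f (y - a - b)"

definition pgram :: "('a \<Rightarrow> complex) \<Rightarrow> 'a \<Rightarrow> 'a \<Rightarrow> complex" where
  "pgram f a b = E (\<lambda>y. f y * corners f y a b)"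

text \<open>Fourth power of the U2 norm with both side directions reversed;
  \<open>Fp_U2_average\<close> undoes the reversal.\<close>

definition U2_pow4 :: "('a \<Rightarrow> complex) \<Rightarrow> complex" where
  "U2_pow4 f = E (\<lambda>a. E (\<lambda>b. pgram f a b))"

lemma bdd_corners:
  "bdd f \<Longrightarrow> compat l \<Longrightarrow> compat m \<Longrightarrow> compat n \<Longrightarrow> bdd (\<lambda>x. corners f (l x) (m x) (n x))"
  unfolding corners_def
  by (intro bdd_mult bdd_cnj) (rule bdd_comp, assumption, intro compat_intros, assumption+)+

lemma bdd_pgram: "bdd f \<Longrightarrow> compat l \<Longrightarrow> compat m \<Longrightarrow> bdd (\<lambda>x. pgram f (l x) (m x))"
  unfolding pgram_def
  by (intro bdd_E bdd_mult bdd_corners bdd_const compat_const) (auto simp: bdd_norm_le)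

lemmas bdd_gowers_intros = bdd_corners bdd_pgram bdd_intros

lemma E_differences:
  assumes "\<And>t. per (\<lambda>s. F s t)" "\<And>s. per (F s)"
  shows "E (\<lambda>t. E (\<lambda>t'. E (\<lambda>s. E (\<lambda>s'. F (s - s') (t - t'))))) = E (\<lambda>s. E (\<lambda>t. F s t))"
proof -
  have "E (\<lambda>s. E (\<lambda>s'. F (s - s') d)) = E (\<lambda>s. F s d)" for d
    using E_reflect[OF assms(1)] by simp
  then have "E (\<lambda>t. E (\<lambda>t'. E (\<lambda>s. E (\<lambda>s'. F (s - s') (t - t'))))) = E (\<lambda>t. E (\<lambda>t'. E (\<lambda>s. F s (t - t'))))"
    by simp
  also have "\<dots> = E (\<lambda>s. E (\<lambda>t. E (\<lambda>t'. F s (t - t'))))"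
    by (rule E_rotate[symmetric])
  also have "\<dots> = E (\<lambda>s. E (\<lambda>t. F s t))"
    using E_reflect[OF assms(2)] by simp
  finally show ?thesis .
qed

lemma E_parallelogram:
  assumes "bdd f"
  shows "E (\<lambda>x. f (x + (a * s + b * t)) * cnj (f (x + (a * s + b * t'))) *
            (cnj (f (x + (a * s' + b * t))) * f (x + (a * s' + b * t'))))
       = pgram f (a * (s - s')) (b * (t - t'))"
proof -
  have "E (\<lambda>x. f (x + (a * s + b * t)) * corners f (x + (a * s + b * t)) (a * (s - s')) (b * (t - t')))
      = pgram f (a * (s - s')) (b * (t - t'))"
    unfolding pgram_def
    by (rule E_shift[of "\<lambda>x. f x * corners f x (a * (s - s')) (b * (t - t'))"])
      (intro bdd_per bdd_gowers_intros assms)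
  then show ?thesis
    by (simp add: corners_def algebra_simps)
qed

text \<open>Average over all translates of the given plane and apply \<open>rk_box\<close> on each.
  The box norm of a product of a function of \<open>x\<close> and one of \<open>y\<close> factors,
  after averaging over translates, into parallelogram averages of the two.\<close>

lemma box_average:
  assumes f: "bdd f" and h: "bdd h" and T: "bdd2 T"
    and rk: "\<And>x y. rk (\<lambda>s t. T (x + (of_int a * s + of_int b * t)) (y + (of_int a' * s + of_int b' * t)))"
  shows "(cmod (E (\<lambda>x. E (\<lambda>y. f x * h y * T x y)))) ^ 4
    \<le> cmod (E (\<lambda>s. E (\<lambda>t. pgram f (of_int a * s) (of_int b * t) * pgram h (of_int a' * s) (of_int b' * t))))"
proof -
  define l where "l s t = of_int a * s + of_int b * t" for s t :: 'a
  define l' where "l' s t = of_int a' * s + of_int b' * t" for s t :: 'a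
  define F where "F x y s t = f (x + l s t) * h (y + l' s t)" for x y s t
  have "E (\<lambda>x. E (\<lambda>y. f x * h y * T x y))
      = E (\<lambda>x. E (\<lambda>y. f (x + c) * h (y + d) * T (x + c) (y + d)))" for c d
  proof -
    have "E (\<lambda>y. f x * h (y + d) * T x (y + d)) = E (\<lambda>y. f x * h y * T x y)" for x
      by (rule E_shift[of "\<lambda>y. f x * h y * T x y"])
        (intro per_mult per_const per_bdd[OF h] per_bdd2[OF T] compat_intros)
    moreover have "E (\<lambda>x. E (\<lambda>y. f (x + c) * h (y + d) * T (x + c) (y + d)))
        = E (\<lambda>x. E (\<lambda>y. f x * h (y + d) * T x (y + d)))"
      by (rule E_shift[of "\<lambda>x. E (\<lambda>y. f x * h (y + d) * T x (y + d))"])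
        (intro per_E per_mult per_const per_bdd[OF f] per_bdd2[OF T] compat_intros)
    ultimately show ?thesis by simp
  qed
  then have "E (\<lambda>x. E (\<lambda>y. f x * h y * T x y))
      = E (\<lambda>s. E (\<lambda>t. E (\<lambda>x. E (\<lambda>y. f (x + l s t) * h (y + l' s t) * T (x + l s t) (y + l' s t)))))"
    by (simp flip: \<open>\<And>c d. _ = E (\<lambda>x. E (\<lambda>y. f (x + c) * h (y + d) * T (x + c) (y + d)))\<close>)
  also have "\<dots> = E (\<lambda>x. E (\<lambda>y. E (\<lambda>s. E (\<lambda>t. F x y s t * T (x + l s t) (y + l' s t)))))"
    unfolding F_def by (rule E_swap_pairs)
  finally have "(cmod (E (\<lambda>x. E (\<lambda>y. f x * h y * T x y)))) ^ 4
      \<le> E (\<lambda>x. E (\<lambda>y. (cmod (E (\<lambda>s. E (\<lambda>t. F x y s t * T (x + l s t) (y + l' s t))))) ^ 4))"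
    by (simp add: order_trans[OF norm_E_power4_le E_mono[OF norm_E_power4_le]])
  also have "\<dots> \<le> E (\<lambda>x. E (\<lambda>y. box (F x y)))"
    unfolding l_def l'_def by (intro E_mono rk_box rk)
  also have "complex_of_real (E (\<lambda>x. E (\<lambda>y. box (F x y))))
      = E (\<lambda>s. E (\<lambda>t. pgram f (of_int a * s) (of_int b * t) * pgram h (of_int a' * s) (of_int b' * t)))"
  proof -
    have "complex_of_real (E (\<lambda>x. E (\<lambda>y. box (F x y)))) = E (\<lambda>x. E (\<lambda>y. E (\<lambda>t. E (\<lambda>t'. E (\<lambda>s. E (\<lambda>s'.
        (F x y s t * cnj (F x y s t')) * cnj (F x y s' t * cnj (F x y s' t'))))))))"
      unfolding box_def E_of_real[symmetric] E_norm_square ..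
    also have "\<dots> = E (\<lambda>t. E (\<lambda>t'. E (\<lambda>x. E (\<lambda>y. E (\<lambda>s. E (\<lambda>s'.
        (F x y s t * cnj (F x y s t')) * cnj (F x y s' t * cnj (F x y s' t'))))))))"
      by (rule E_swap_pairs)
    also have "\<dots> = E (\<lambda>t. E (\<lambda>t'. E (\<lambda>s. E (\<lambda>s'. E (\<lambda>x. E (\<lambda>y.
        (F x y s t * cnj (F x y s t')) * cnj (F x y s' t * cnj (F x y s' t'))))))))"
      by (intro E_cong E_swap_pairs)
    also have "\<dots> = E (\<lambda>t. E (\<lambda>t'. E (\<lambda>s. E (\<lambda>s'.
        pgram f (of_int a * (s - s')) (of_int b * (t - t')) * pgram h (of_int a' * (s - s')) (of_int b' * (t - t'))))))"
    proof (intro E_cong)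
      fix t t' s s'
      show "E (\<lambda>x. E (\<lambda>y. (F x y s t * cnj (F x y s t')) * cnj (F x y s' t * cnj (F x y s' t'))))
        = pgram f (of_int a * (s - s')) (of_int b * (t - t')) * pgram h (of_int a' * (s - s')) (of_int b' * (t - t'))"
        unfolding E_parallelogram[OF f, symmetric] E_parallelogram[OF h, symmetric] E_prod2 F_def l_def l'_def
        by (intro E_cong) (simp add: mult_ac)
    qed
    also have "\<dots> = E (\<lambda>s. E (\<lambda>t. pgram f (of_int a * s) (of_int b * t) * pgram h (of_int a' * s) (of_int b' * t)))"
      by (rule E_differences[of "\<lambda>s t. pgram f (of_int a * s) (of_int b * t) * pgram h (of_int a' * s) (of_int b' * t)"])
        (intro bdd_per bdd_gowers_intros f h)+
    finally show ?thesis .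
  qed
  then have "E (\<lambda>x. E (\<lambda>y. box (F x y)))
      \<le> cmod (E (\<lambda>s. E (\<lambda>t. pgram f (of_int a * s) (of_int b * t) * pgram h (of_int a' * s) (of_int b' * t))))"
    by (metis complex_Re_le_cmod Re_complex_of_real)
  finally show ?thesis .
qed

section \<open>Control of two-variable averages by U2 and U3 norms\<close>

lemma E_scale2:
  assumes "\<And>t. per (\<lambda>s. F s t)" "\<And>s. per (F s)" "unit_mod a" "unit_mod b"
  shows "E (\<lambda>s. E (\<lambda>t. F (of_int a * s) (of_int b * t))) = E (\<lambda>s. E (\<lambda>t. F s t))"
proof -
  have "E (\<lambda>s. E (\<lambda>t. F (of_int a * s) (of_int b * t))) = E (\<lambda>s. E (\<lambda>t. F (of_int a * s) t))"
    by (intro E_cong E_scale[OF assms(2,4)])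
  also have "\<dots> = E (\<lambda>s. E (\<lambda>t. F s t))"
    by (rule E_scale[of "\<lambda>s. E (\<lambda>t. F s t)"]) (intro per_E assms)+
  finally show ?thesis .
qed

text \<open>Here \<open>h\<close> belongs to the kernel and the constant 1 takes its place, whose
  parallelogram averages are 1. This serves the case in which \<open>h\<close> along the plane
  depends on one variable only.\<close>

lemma U2_control:
  assumes f: "bdd f" and h: "bdd h" and T: "bdd2 T"
    and rk: "\<And>x y. rk (\<lambda>s t. h (y + (of_int a' * s + of_int b' * t)) *
      T (x + (of_int a * s + of_int b * t)) (y + (of_int a' * s + of_int b' * t)))"
    and units: "unit_mod a" "unit_mod b"
  shows "(cmod (E (\<lambda>x. E (\<lambda>y. f x * h y * T x y)))) ^ 4 \<le> cmod (U2_pow4 f)"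
proof -
  have one: "pgram (\<lambda>_. 1) x y = 1" for x y
    by (simp add: pgram_def corners_def)
  have hT: "bdd2 (\<lambda>x y. h y * T x y)"
    by (intro bdd2I bdd_mult bdd_const h bdd2_comp[OF T] compat_intros bdd_norm_le[OF h])
  have "(cmod (E (\<lambda>x. E (\<lambda>y. f x * 1 * (h y * T x y))))) ^ 4
    \<le> cmod (E (\<lambda>s. E (\<lambda>t. pgram f (of_int a * s) (of_int b * t) * pgram (\<lambda>_. 1) (of_int a' * s) (of_int b' * t))))"
    by (rule box_average[OF f bdd_const hT]) (simp, rule rk)
  also have "E (\<lambda>s. E (\<lambda>t. pgram f (of_int a * s) (of_int b * t) * pgram (\<lambda>_. 1) (of_int a' * s) (of_int b' * t))) = U2_pow4 f"
    unfolding U2_pow4_def one mult_1_right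
    by (rule E_scale2[OF _ _ units]) (intro bdd_per bdd_gowers_intros f)+
  finally show ?thesis by (simp add: mult.assoc)
qed

text \<open>The right-hand side is the eighth power of the U3 norm of \<open>h\<close>. The factor
  of \<open>box_average\<close> coming from \<open>f\<close> is bounded by 1 and discarded.\<close>

lemma U3_control:
  assumes f: "bdd f" and h: "bdd h" and T: "bdd2 T"
    and rk: "\<And>x y. rk (\<lambda>s t. T (x + (of_int a * s + of_int b * t)) (y + (of_int a' * s + of_int b' * t)))"
    and units: "unit_mod a'" "unit_mod b'"
  shows "(cmod (E (\<lambda>x. E (\<lambda>y. f x * h y * T x y)))) ^ 8 \<le> E (\<lambda>s. E (\<lambda>t. (cmod (pgram h s t))\<^sup>2))"
proof -
  let ?P = "\<lambda>s t. pgram f (of_int a * s) (of_int b * t)"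
  let ?Q = "\<lambda>s t. pgram h (of_int a' * s) (of_int b' * t)"
  have "((cmod (E (\<lambda>x. E (\<lambda>y. f x * h y * T x y)))) ^ 4)\<^sup>2 \<le> (cmod (E (\<lambda>s. E (\<lambda>t. ?P s t * ?Q s t))))\<^sup>2"
    by (intro power_mono box_average[OF f h T rk]) simp
  also have "\<dots> \<le> (E (\<lambda>s. E (\<lambda>t. cmod (?Q s t))))\<^sup>2"
  proof (intro power_mono order_trans[OF norm_E_le] E_mono)
    fix s t
    have "cmod (?P s t) \<le> 1"
      by (rule bdd_norm_le[of "\<lambda>_. ?P s t"]) (intro bdd_gowers_intros f)
    then show "cmod (?P s t * ?Q s t) \<le> cmod (?Q s t)"
      unfolding norm_mult by (intro mult_left_le_one_le) auto
  qed simp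
  also have "\<dots> \<le> E (\<lambda>s. E (\<lambda>t. (cmod (?Q s t))\<^sup>2))"
    by (rule E_jensen_square2)
  also have "\<dots> = E (\<lambda>s. E (\<lambda>t. (cmod (pgram h s t))\<^sup>2))"
    by (rule E_scale2[of "\<lambda>s t. (cmod (pgram h s t))\<^sup>2", OF _ _ units])
      (intro per_norm bdd_per bdd_gowers_intros h)+
  finally show ?thesis by simp
qed

subsection \<open>Kernels with two product structures\<close>

text \<open>Expanding the square isolates the twist \<open>k\<close>, which the triangle inequality
  removes; the mean square of the remaining correlation \<open>G\<close> is exactly the U2 average
  of \<open>f\<close>.\<close>

lemma E_twisted_autocorrelation:
  assumes f: "bdd f" and k: "bdd k"
  shows "(E (\<lambda>d. (cmod (E (\<lambda>x. k x * f (x + d))))\<^sup>2))\<^sup>2 \<le> cmod (U2_pow4 f)"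
proof -
  define q where "q = E (\<lambda>d. (cmod (E (\<lambda>x. k x * f (x + d))))\<^sup>2)"
  define G where "G x x' = E (\<lambda>d. f (x + d) * cnj (f (x' + d)))" for x x'
  have "complex_of_real q = E (\<lambda>d. E (\<lambda>x. E (\<lambda>x'. k x * f (x + d) * cnj (k x' * f (x' + d)))))"
    unfolding q_def E_of_real[symmetric] E_norm_square ..
  also have "\<dots> = E (\<lambda>x. E (\<lambda>x'. k x * cnj (k x') * G x x'))"
    unfolding G_def E_cmult[symmetric] by (subst E_rotate) (intro E_cong, simp add: mult_ac)
  finally have "q \<le> cmod (E (\<lambda>x. E (\<lambda>x'. k x * cnj (k x') * G x x')))"
    by (rule real_le_cmod)
  also have "\<dots> \<le> E (\<lambda>x. E (\<lambda>x'. cmod (G x x')))"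
  proof (intro order_trans[OF norm_E_le] E_mono)
    fix x x'
    have "cmod (k x) * cmod (k x') \<le> 1"
      using bdd_norm_le[OF k] by (intro mult_le_one) auto
    then show "cmod (k x * cnj (k x') * G x x') \<le> cmod (G x x')"
      unfolding norm_mult complex_mod_cnj by (intro mult_left_le_one_le) auto
  qed
  finally have "q \<le> E (\<lambda>x. E (\<lambda>x'. cmod (G x x')))" .
  moreover have "0 \<le> q"
    unfolding q_def by (intro E_nonneg) simp
  ultimately have "q\<^sup>2 \<le> (E (\<lambda>x. E (\<lambda>x'. cmod (G x x'))))\<^sup>2"
    by (intro power_mono)
  also have "\<dots> \<le> E (\<lambda>x. E (\<lambda>x'. (cmod (G x x'))\<^sup>2))"
    by (rule E_jensen_square2)
  finally have le: "q\<^sup>2 \<le> E (\<lambda>x. E (\<lambda>x'. (cmod (G x x'))\<^sup>2))" .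
  define g where "g y a b = f y * corners f y a b" for y a b
  have per: "per (\<lambda>y. g y a b)" "per (\<lambda>a. g y a b)" "per (\<lambda>b. g y a b)" for y a b
    unfolding g_def by (intro bdd_per bdd_mult bdd_corners f bdd_const bdd_norm_le compat_intros bdd_comp[OF f])+
  have "complex_of_real (E (\<lambda>x. E (\<lambda>x'. (cmod (G x x'))\<^sup>2)))
      = E (\<lambda>x. E (\<lambda>x'. E (\<lambda>d. E (\<lambda>d'. f (x + d) * cnj (f (x' + d)) * cnj (f (x + d') * cnj (f (x' + d')))))))"
    unfolding E_of_real[symmetric] G_def E_norm_square ..
  also have "\<dots> = E (\<lambda>x. E (\<lambda>d. E (\<lambda>d'. E (\<lambda>x'. g (x + d) (x - x') (d - d')))))"
    by (rule E_cong, subst E_rotate) (simp add: g_def corners_def algebra_simps)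
  also have "\<dots> = E (\<lambda>x. E (\<lambda>d. E (\<lambda>d'. E (\<lambda>a. g (x + d) a (d - d')))))"
    by (intro E_cong E_reflect per)
  also have "\<dots> = E (\<lambda>x. E (\<lambda>d. E (\<lambda>b. E (\<lambda>a. g (x + d) a b))))"
    by (intro E_cong E_reflect[of "\<lambda>b. E (\<lambda>a. g (_ + _) a b)"] per_E per)
  also have "\<dots> = E (\<lambda>d. E (\<lambda>x. E (\<lambda>b. E (\<lambda>a. g (x + d) a b))))"
    by (rule E_swap)
  also have "\<dots> = E (\<lambda>d. E (\<lambda>y. E (\<lambda>b. E (\<lambda>a. g y a b))))"
    by (intro E_cong E_shift[of "\<lambda>y. E (\<lambda>b. E (\<lambda>a. g y a b))"] per_E per)
  also have "\<dots> = E (\<lambda>b. E (\<lambda>a. pgram f a b))"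
    unfolding pgram_def g_def by (simp add: E_rotate[of "\<lambda>y b a. f y * corners f y a b"])
  also have "\<dots> = U2_pow4 f"
    unfolding U2_pow4_def by (rule E_swap)
  finally have "E (\<lambda>x. E (\<lambda>x'. (cmod (G x x'))\<^sup>2)) \<le> cmod (U2_pow4 f)"
    by (rule real_le_cmod)
  then show ?thesis
    using le unfolding q_def by linarith
qed

text \<open>
  For fixed \<open>d\<close> let \<open>b d\<close> be the Fourier transform of \<open>x \<mapsto> B x (x + d)\<close>. The first plane bounds
  \<open>\<Sum>\<^sub>\<xi> \<bar>b d \<xi>\<bar>\<close> by 1; the second one bounds \<open>\<bar>b d \<xi>\<bar>\<^sup>2\<close> by some \<open>w \<xi>\<close> that does not depend on \<open>d\<close> and
  has sum at most 1, because there \<open>d\<close> depends on \<open>s\<close> only.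
\<close>

lemma kernel_bound:
  assumes f: "bdd f" and B: "bdd2 B"
    and units: "unit_mod \<alpha>" "unit_mod \<beta>" "unit_mod (\<kappa>' - \<kappa>)" "unit_mod \<mu>"
    and rk1: "\<And>d. rk (\<lambda>s t. B (of_int \<alpha> * s + of_int \<beta> * t) (d + (of_int \<alpha> * s + of_int \<beta> * t)))"
    and rk2: "rk (\<lambda>s t. B (of_int \<kappa> * s + of_int \<mu> * t) (of_int \<kappa>' * s + of_int \<mu> * t))"
  shows "(cmod (E (\<lambda>x. E (\<lambda>y. cnj (f x) * f y * B x y)))) ^ 8 \<le> cmod (U2_pow4 f)"
proof -
  define F where "F d x = cnj (f x) * f (x + d)" for d x
  define b where "b d \<xi> = E (\<lambda>x. B x (x + d) * ch \<xi> x)" for d \<xi>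
  define N where "N d \<xi> = cmod (fourier (F d) \<xi>)" for d \<xi>
  define X where "X = E (\<lambda>x. E (\<lambda>y. cnj (f x) * f y * B x y))"
  note compats = compat_intros
  have bddF: "bdd (F d)" for d
    unfolding F_def by (intro bdd_mult bdd_cnj bdd_comp[OF f] compats)
  have perB: "per (\<lambda>x. B x (x + d) * ch \<xi> x)" for d \<xi>
    by (intro per_mult per_bdd2[OF B] per_ch compats)
  have E_line: "E (\<lambda>t. B (c + of_int k * t) (c + of_int k * t + d) * ch \<xi> (c + of_int k * t)) = b d \<xi>"
    if "unit_mod k" for k c d \<xi>
  proof -
    let ?H = "\<lambda>x. B x (x + d) * ch \<xi> x"
    have "E (\<lambda>t. ?H (c + of_int k * t)) = E (\<lambda>t. ?H (c + t))"
      by (rule E_scale[of "\<lambda>t. ?H (c + t)", OF _ that]) (intro per_comp[OF perB] compats)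
    also have "\<dots> = b d \<xi>"
      unfolding b_def by (rule E_shift_left[OF perB])
    finally show ?thesis .
  qed
  have sum_b: "(\<Sum>\<xi>\<in>S. cmod (b d \<xi>)) \<le> 1" for d
  proof -
    have "E (\<lambda>s. E (\<lambda>t. B (of_int \<alpha> * s + of_int \<beta> * t) (d + (of_int \<alpha> * s + of_int \<beta> * t)) *
        ch \<xi> (of_int \<alpha> * s + of_int \<beta> * t))) = b d \<xi>" for \<xi>
    proof -
      have "E (\<lambda>t. B (c + of_int \<beta> * t) (c + of_int \<beta> * t + d) * ch \<xi> (c + of_int \<beta> * t)) = b d \<xi>" for c
        by (rule E_line[OF units(2)])
      then show ?thesis by (simp add: add.commute[of d])
    qed
    then show ?thesis
      using rk_sum_fourier[OF rk1 units(1,2), of d] by simp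
  qed
  obtain w where w: "\<And>\<xi>. 0 \<le> w \<xi>" "(\<Sum>\<xi>\<in>S. w \<xi>) \<le> 1" and
    w2: "\<And>s \<xi>. (cmod (E (\<lambda>t. B (of_int \<kappa> * s + of_int \<mu> * t) (of_int \<kappa>' * s + of_int \<mu> * t) *
        ch \<xi> (of_int \<mu> * t))))\<^sup>2 \<le> w \<xi>"
    using rk_fibre_fourier[OF rk2 units(4)] by blast
  have b_w: "(cmod (b d \<xi>))\<^sup>2 \<le> w \<xi>" for d \<xi>
  proof -
    \<comment> \<open>The difference \<open>d\<close> is realised on the second plane at
      \<open>s = d / (\<kappa>' - \<kappa>)\<close>, hence the unit hypothesis.\<close>
    obtain k where k: "[k * (\<kappa>' - \<kappa>) = 1] (mod int p)"
      using unit_mod_inverse[OF units(3)] .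
    define s where "s = of_int k * d"
    have "red (of_int (\<kappa>' - \<kappa>) * s) = red d"
      using red_cong_scalar[OF k, of d] by (simp add: s_def mult_ac)
    then have "b d \<xi> = b (of_int (\<kappa>' - \<kappa>) * s) \<xi>"
      unfolding b_def
      by (intro perD[of "\<lambda>d. E (\<lambda>x. B x (x + d) * ch \<xi> x)"] per_E per_mult per_bdd2[OF B] per_ch compats per_const) simp
    also have "\<dots> = E (\<lambda>t. B (of_int \<kappa> * s + of_int \<mu> * t) (of_int \<kappa> * s + of_int \<mu> * t + of_int (\<kappa>' - \<kappa>) * s) *
        ch \<xi> (of_int \<kappa> * s + of_int \<mu> * t))"
      by (rule E_line[OF units(4), symmetric])
    also have "\<dots> = ch \<xi> (of_int \<kappa> * s) * E (\<lambda>t. B (of_int \<kappa> * s + of_int \<mu> * t) (of_int \<kappa>' * s + of_int \<mu> * t) *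
        ch \<xi> (of_int \<mu> * t))"
      unfolding E_cmult[symmetric] by (intro E_cong) (simp add: ch_add algebra_simps)
    finally show ?thesis
      using w2[of s \<xi>] by (simp add: norm_mult)
  qed
  have "X = E (\<lambda>x. E (\<lambda>d. cnj (f x) * f (x + d) * B x (x + d)))"
    unfolding X_def
    by (intro E_cong E_shift_left[symmetric, of "\<lambda>y. cnj (f _) * f y * B _ y"]
        per_mult per_const per_bdd[OF f] per_bdd2[OF B] compats)
  also have "\<dots> = E (\<lambda>d. E (\<lambda>x. F d x * B x (x + d)))"
    unfolding F_def by (rule E_swap)
  also have "\<dots> = E (\<lambda>d. \<Sum>\<xi>\<in>S. fourier (F d) \<xi> * b d \<xi>)"
    unfolding b_def by (intro E_cong fourier_pairing bdd_per bddF)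
  finally have "cmod X \<le> E (\<lambda>d. \<Sum>\<xi>\<in>S. N d \<xi> * cmod (b d \<xi>))"
    unfolding N_def norm_mult[symmetric]
    by (simp add: order_trans[OF norm_E_le E_mono[OF norm_sum]])
  then have "(cmod X)\<^sup>2 \<le> (E (\<lambda>d. \<Sum>\<xi>\<in>S. N d \<xi> * cmod (b d \<xi>)))\<^sup>2"
    by (intro power_mono) auto
  also have "\<dots> \<le> E (\<lambda>d. (\<Sum>\<xi>\<in>S. N d \<xi> * cmod (b d \<xi>))\<^sup>2)"
    by (rule E_jensen_square)
  \<comment> \<open>Cauchy-Schwarz with the weights \<open>cmod (b d \<xi>)\<close>, of total mass
    at most 1.\<close>
  also have "\<dots> \<le> E (\<lambda>d. \<Sum>\<xi>\<in>S. (N d \<xi>)\<^sup>2 * cmod (b d \<xi>))"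
  proof (rule E_mono)
    fix d
    have "(\<Sum>\<xi>\<in>S. N d \<xi> * cmod (b d \<xi>))\<^sup>2
        = (\<Sum>\<xi>\<in>S. (N d \<xi> * sqrt (cmod (b d \<xi>))) * sqrt (cmod (b d \<xi>)))\<^sup>2"
      by (simp add: mult.assoc)
    also have "\<dots> \<le> (\<Sum>\<xi>\<in>S. (N d \<xi> * sqrt (cmod (b d \<xi>)))\<^sup>2) * (\<Sum>\<xi>\<in>S. (sqrt (cmod (b d \<xi>)))\<^sup>2)"
      by (rule Cauchy_Schwarz_ineq_sum)
    also have "\<dots> = (\<Sum>\<xi>\<in>S. (N d \<xi>)\<^sup>2 * cmod (b d \<xi>)) * (\<Sum>\<xi>\<in>S. cmod (b d \<xi>))"
      by (simp add: power_mult_distrib)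
    also have "\<dots> \<le> (\<Sum>\<xi>\<in>S. (N d \<xi>)\<^sup>2 * cmod (b d \<xi>)) * 1"
      by (intro mult_left_mono sum_b sum_nonneg) auto
    finally show "(\<Sum>\<xi>\<in>S. N d \<xi> * cmod (b d \<xi>))\<^sup>2 \<le> (\<Sum>\<xi>\<in>S. (N d \<xi>)\<^sup>2 * cmod (b d \<xi>))"
      by simp
  qed
  finally have "((cmod X)\<^sup>2)\<^sup>2 \<le> (E (\<lambda>d. \<Sum>\<xi>\<in>S. (N d \<xi>)\<^sup>2 * cmod (b d \<xi>)))\<^sup>2"
    by (intro power_mono) auto
  also have "\<dots> \<le> E (\<lambda>d. (\<Sum>\<xi>\<in>S. (N d \<xi>)\<^sup>2 * cmod (b d \<xi>))\<^sup>2)"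
    by (rule E_jensen_square)
  \<comment> \<open>A second Cauchy-Schwarz, against Parseval for \<open>F d\<close>, squares the
    remaining weight, which is then bounded by \<open>w \<xi>\<close>. Now only \<open>N\<close>
    depends on \<open>d\<close>.\<close>
  also have "\<dots> \<le> E (\<lambda>d. \<Sum>\<xi>\<in>S. (N d \<xi>)\<^sup>2 * w \<xi>)"
  proof (rule E_mono)
    fix d
    have "(\<Sum>\<xi>\<in>S. (N d \<xi>)\<^sup>2 * cmod (b d \<xi>))\<^sup>2 = (\<Sum>\<xi>\<in>S. N d \<xi> * (N d \<xi> * cmod (b d \<xi>)))\<^sup>2"
      by (simp add: power2_eq_square mult.assoc)
    also have "\<dots> \<le> (\<Sum>\<xi>\<in>S. (N d \<xi>)\<^sup>2) * (\<Sum>\<xi>\<in>S. (N d \<xi> * cmod (b d \<xi>))\<^sup>2)"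
      by (rule Cauchy_Schwarz_ineq_sum)
    also have "\<dots> \<le> 1 * (\<Sum>\<xi>\<in>S. (N d \<xi>)\<^sup>2 * w \<xi>)"
      unfolding power_mult_distrib N_def
      by (intro mult_mono parseval_le_1 bddF sum_mono mult_left_mono b_w sum_nonneg) auto
    finally show "(\<Sum>\<xi>\<in>S. (N d \<xi>)\<^sup>2 * cmod (b d \<xi>))\<^sup>2 \<le> (\<Sum>\<xi>\<in>S. (N d \<xi>)\<^sup>2 * w \<xi>)"
      by simp
  qed
  also have "\<dots> = (\<Sum>\<xi>\<in>S. w \<xi> * E (\<lambda>d. (N d \<xi>)\<^sup>2))"
    by (simp add: E_sum E_cmult[symmetric] mult.commute)
  also have "\<dots> \<le> (\<Sum>\<xi>\<in>S. w \<xi> * sqrt (cmod (U2_pow4 f)))"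
  proof (intro sum_mono mult_left_mono w real_le_rsqrt)
    fix \<xi>
    \<comment> \<open>For fixed \<open>\<xi>\<close> the conjugate of \<open>f\<close> and the
      character merge into one bounded twist.\<close>
    have "fourier (F d) \<xi> = E (\<lambda>x. (cnj (f x) * cnj (ch \<xi> x)) * f (x + d))" for d
      unfolding fourier_def F_def by (intro E_cong) (simp add: mult_ac)
    then show "(E (\<lambda>d. (N d \<xi>)\<^sup>2))\<^sup>2 \<le> cmod (U2_pow4 f)"
      unfolding N_def using E_twisted_autocorrelation[OF f, of "\<lambda>x. cnj (f x) * cnj (ch \<xi> x)"]
      by (simp add: bdd_mult bdd_cnj f bdd_ch compat_id)
  qed
  also have "\<dots> \<le> 1 * sqrt (cmod (U2_pow4 f))"
    unfolding sum_distrib_right[symmetric] by (intro mult_right_mono w) simp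
  finally have "(cmod X) ^ 4 \<le> sqrt (cmod (U2_pow4 f))" by simp
  then have "((cmod X) ^ 4)\<^sup>2 \<le> (sqrt (cmod (U2_pow4 f)))\<^sup>2"
    by (intro power_mono) auto
  then show ?thesis
    unfolding X_def by simp
qed

subsection \<open>Positivity of Fourier coefficients\<close>

lemma Re_E: "Re (E f) = E (\<lambda>x. Re (f x))"
  by (simp add: E_def Re_divide_of_nat)

text \<open>The coefficients of \<open>\<phi> ^ m\<close> are \<open>m\<close>-fold convolutions of
  nonnegative weights, hence nonnegative; at \<open>m * \<xi>\<close> the diagonal term alone
  contributes \<open>\<mu> \<xi> ^ m\<close>.\<close>

lemma fourier_power_posdef:
  fixes \<mu> :: "'a \<Rightarrow> real"
  assumes \<mu>: "\<And>\<xi>. 0 \<le> \<mu> \<xi>"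
  defines "\<phi> \<equiv> \<lambda>a. \<Sum>\<xi>\<in>S. complex_of_real (\<mu> \<xi>) * ch \<xi> a"
  assumes \<xi>: "\<xi> \<in> S"
  shows "\<mu> \<xi> ^ m \<le> Re (fourier (\<lambda>a. \<phi> a ^ m) (of_nat m * \<xi>))"
proof -
  let ?c = "\<lambda>m \<eta>. fourier (\<lambda>a. \<phi> a ^ m) \<eta>"
  have step: "?c (Suc m) \<eta> = (\<Sum>\<xi>\<in>S. complex_of_real (\<mu> \<xi>) * ?c m (\<eta> - \<xi>))" for m \<eta>
  proof -
    have "?c (Suc m) \<eta> = E (\<lambda>a. \<Sum>\<xi>\<in>S. complex_of_real (\<mu> \<xi>) * (\<phi> a ^ m * cnj (ch (\<eta> - \<xi>) a)))"
      unfolding fourier_def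
      by (intro E_cong) (simp add: \<phi>_def sum_distrib_right sum_distrib_left ch_diff_left mult_ac)
    then show ?thesis
      by (simp add: E_sum E_cmult fourier_def)
  qed
  have pos: "Im (?c m \<eta>) = 0 \<and> 0 \<le> Re (?c m \<eta>)" for m \<eta>
  proof (induction m arbitrary: \<eta>)
    case 0
    show ?case by (simp add: fourier_def E_cnj E_ch)
  next
    case (Suc m)
    then show ?case
      unfolding step by (auto intro!: sum_nonneg mult_nonneg_nonneg \<mu>)
  qed
  show ?thesis
  proof (induction m)
    case 0
    show ?case by (simp add: fourier_def E_cnj E_ch)
  next
    case (Suc m)
    have "of_nat (Suc m) * \<xi> - \<xi> = of_nat m * \<xi>"
      by (simp add: algebra_simps)
    then have "\<mu> \<xi> * \<mu> \<xi> ^ m \<le> \<mu> \<xi> * Re (?c m (of_nat (Suc m) * \<xi> - \<xi>))"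
      using Suc \<mu> by (simp add: mult_left_mono)
    also have "\<dots> = Re (complex_of_real (\<mu> \<xi>) * ?c m (of_nat (Suc m) * \<xi> - \<xi>))"
      by simp
    also have "\<dots> \<le> (\<Sum>\<xi>'\<in>S. Re (complex_of_real (\<mu> \<xi>') * ?c m (of_nat (Suc m) * \<xi> - \<xi>')))"
      using pos \<mu> by (intro member_le_sum[OF \<xi> _ finite_S]) simp
    also have "\<dots> = Re (?c (Suc m) (of_nat (Suc m) * \<xi>))"
      by (simp only: step Re_sum)
    finally show ?case by simp
  qed
qed

section \<open>Spectra of multiplicative derivatives\<close>

definition power_spectrum :: "('a \<Rightarrow> complex) \<Rightarrow> 'a \<Rightarrow> 'a \<Rightarrow> real" where
  "power_spectrum h b \<xi> = (cmod (fourier (\<lambda>y. h y * cnj (h (y - b))) \<xi>))\<^sup>2"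

text \<open>As a function of \<open>a\<close> this is the autocorrelation of the derivative of
  \<open>h\<close> in direction \<open>b\<close>, so its Fourier coefficients are squared absolute
  values.\<close>

lemma pgram_eq_sum:
  assumes h: "bdd h"
  shows "pgram h a b = (\<Sum>\<xi>\<in>S. complex_of_real (power_spectrum h b \<xi>) * ch \<xi> a)"
proof -
  define F where "F y = h y * cnj (h (y - b))" for y
  have F: "per F"
    unfolding F_def by (intro per_mult per_cnj per_bdd[OF h] compat_intros)
  have shift: "fourier (\<lambda>y. F (y - a)) \<xi> = cnj (ch \<xi> a) * fourier F \<xi>" for \<xi>
  proof -
    have "fourier (\<lambda>y. F (y - a)) \<xi> = E (\<lambda>y. F (y + a - a) * cnj (ch \<xi> (y + a)))"
      unfolding fourier_def
      by (rule E_shift[symmetric]) (intro per_mult per_cnj per_comp[OF F] per_ch compat_intros)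
    then show ?thesis
      by (simp add: ch_add fourier_def E_cmult[symmetric] mult_ac)
  qed
  have "pgram h a b = E (\<lambda>y. F y * cnj (F (y - a)))"
    unfolding pgram_def F_def corners_def by (intro E_cong) (simp add: algebra_simps)
  also have "\<dots> = (\<Sum>\<xi>\<in>S. fourier F \<xi> * cnj (fourier (\<lambda>y. F (y - a)) \<xi>))"
    by (rule parseval_inner[OF F])
  also have "\<dots> = (\<Sum>\<xi>\<in>S. (fourier F \<xi> * cnj (fourier F \<xi>)) * ch \<xi> a)"
    by (simp add: shift mult_ac)
  also have "\<dots> = (\<Sum>\<xi>\<in>S. complex_of_real (power_spectrum h b \<xi>) * ch \<xi> a)"
    unfolding power_spectrum_def F_def[symmetric] complex_norm_square ..
  finally show ?thesis .
qed

lemma power_spectrum_nonneg [simp]: "0 \<le> power_spectrum h b \<xi>"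
  by (simp add: power_spectrum_def)

lemma sum_power_spectrum_le:
  assumes "bdd h" shows "(\<Sum>\<xi>\<in>S. power_spectrum h b \<xi>) \<le> 1"
  unfolding power_spectrum_def
  by (intro parseval_le_1 bdd_mult bdd_cnj bdd_comp[OF assms] compat_intros)

lemma E_norm_pgram:
  assumes h: "bdd h"
  shows "E (\<lambda>a. (cmod (pgram h a b))\<^sup>2) = (\<Sum>\<xi>\<in>S. (power_spectrum h b \<xi>)\<^sup>2)"
proof -
  have "per (\<lambda>a. pgram h a b)"
    by (intro bdd_per bdd_pgram h compat_intros)
  then have "E (\<lambda>a. (cmod (pgram h a b))\<^sup>2) = (\<Sum>\<xi>\<in>S. (cmod (fourier (\<lambda>a. pgram h a b) \<xi>))\<^sup>2)"
    by (rule parseval[symmetric])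
  also have "\<dots> = (\<Sum>\<xi>\<in>S. (power_spectrum h b \<xi>)\<^sup>2)"
  proof (rule sum.cong[OF refl])
    fix \<xi> assume \<xi>: "\<xi> \<in> S"
    have "fourier (\<lambda>a. pgram h a b) \<xi> = E (\<lambda>a. \<Sum>\<zeta>\<in>S. complex_of_real (power_spectrum h b \<zeta>) * ch (\<zeta> - \<xi>) a)"
      unfolding fourier_def pgram_eq_sum[OF h]
      by (intro E_cong) (simp add: sum_distrib_right ch_diff_left mult.assoc)
    also have "\<dots> = (\<Sum>\<zeta>\<in>S. complex_of_real (power_spectrum h b \<zeta>) * (if \<zeta> = \<xi> then 1 else 0))"
      unfolding E_sum E_cmult
      by (intro sum.cong refl) (use \<xi> in \<open>simp add: E_ch red_diff_zero_iff red_id\<close>)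
    also have "\<dots> = (\<Sum>\<zeta>\<in>S. if \<zeta> = \<xi> then complex_of_real (power_spectrum h b \<zeta>) else 0)"
      by (intro sum.cong) auto
    also have "\<dots> = complex_of_real (power_spectrum h b \<xi>)"
      using \<xi> finite_S by simp
    finally show "(cmod (fourier (\<lambda>a. pgram h a b) \<xi>))\<^sup>2 = (power_spectrum h b \<xi>)\<^sup>2"
      by simp
  qed
  finally show ?thesis .
qed

lemma pgram_cnj: "pgram (\<lambda>x. cnj (h x)) a b = cnj (pgram h a b)"
  by (simp add: pgram_def corners_def E_cnj[symmetric])

text \<open>Dilation by \<open>m\<close> moves the weight at \<open>\<xi>\<close> to the frequency
  \<open>m * \<xi>\<close>, where \<open>fourier_power_posdef\<close> bounds the coefficient of the
  \<open>m\<close>-th power from below. A dilation is thus traded for a power, so exponents grow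
  with the integer \<open>u\<close>.\<close>

lemma E_pgram_dilate_ge:
  fixes u :: int
  assumes h: "bdd h" and "u \<noteq> 0"
  defines "h' \<equiv> (if u > 0 then \<lambda>x. cnj (h x) else h)" and "m \<equiv> nat \<bar>u\<bar>"
  shows "(\<Sum>\<xi>\<in>S. power_spectrum h b \<xi> ^ Suc m) \<le> Re (E (\<lambda>a. pgram h (of_int u * a) b * pgram h' a b ^ m))"
proof -
  define \<phi> where "\<phi> a = pgram h a b" for a
  have \<phi>: "\<phi> = (\<lambda>a. \<Sum>\<xi>\<in>S. complex_of_real (power_spectrum h b \<xi>) * ch \<xi> a)"
    unfolding \<phi>_def pgram_eq_sum[OF h] ..
  define Q where "Q = E (\<lambda>a. \<phi> (of_nat m * a) * cnj (\<phi> a) ^ m)"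
  have "Q = E (\<lambda>a. \<Sum>\<xi>\<in>S. complex_of_real (power_spectrum h b \<xi>) *
      cnj (\<phi> a ^ m * cnj (ch (of_nat m * \<xi>) a)))"
    unfolding Q_def
  proof (rule E_cong)
    fix a
    have "\<phi> (of_nat m * a) * cnj (\<phi> a) ^ m
        = (\<Sum>\<xi>\<in>S. complex_of_real (power_spectrum h b \<xi>) * ch (of_nat m * \<xi>) a) * cnj (\<phi> a) ^ m"
      by (simp only: fun_cong[OF \<phi>, of "of_nat m * a"] ch_scale)
    also have "\<dots> = (\<Sum>\<xi>\<in>S. complex_of_real (power_spectrum h b \<xi>) *
        cnj (\<phi> a ^ m * cnj (ch (of_nat m * \<xi>) a)))"
      by (simp add: sum_distrib_right sum_distrib_left mult_ac)
    finally show "\<phi> (of_nat m * a) * cnj (\<phi> a) ^ m = \<dots>" .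
  qed
  also have "\<dots> = (\<Sum>\<xi>\<in>S. complex_of_real (power_spectrum h b \<xi>) *
      cnj (fourier (\<lambda>a. \<phi> a ^ m) (of_nat m * \<xi>)))"
    unfolding fourier_def by (simp only: E_sum E_cmult E_cnj)
  finally have Q: "Q = \<dots>" .
  have "(\<Sum>\<xi>\<in>S. power_spectrum h b \<xi> ^ Suc m) \<le> Re Q"
    unfolding Q Re_sum
  proof (rule sum_mono)
    fix \<xi> assume "\<xi> \<in> S"
    then have "power_spectrum h b \<xi> ^ m \<le> Re (fourier (\<lambda>a. \<phi> a ^ m) (of_nat m * \<xi>))"
      unfolding \<phi> by (intro fourier_power_posdef) simp_all
    then show "power_spectrum h b \<xi> ^ Suc m \<le> Re (complex_of_real (power_spectrum h b \<xi>) *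
        cnj (fourier (\<lambda>a. \<phi> a ^ m) (of_nat m * \<xi>)))"
      by (simp add: mult_left_mono)
  qed
  also have "Re Q = Re (E (\<lambda>a. pgram h (of_int u * a) b * pgram h' a b ^ m))"
  proof (cases "u > 0")
    case True
    then have u: "(of_nat m :: 'a) = of_int u"
      by (simp add: m_def)
    show ?thesis
      using True by (simp add: Q_def \<phi>_def h'_def pgram_cnj u)
  next
    case False
    then have "of_int u = - (of_nat m :: 'a)"
      by (simp add: m_def)
    then have u: "of_int u * a = - (of_nat m * a)" for a :: 'a
      by simp
    \<comment> \<open>For negative \<open>u\<close> this symmetry exchanges the power of the
      conjugate with the plain power, which is why \<open>h'\<close> depends on the sign.\<close>
    have "\<phi> (- a) = cnj (\<phi> a)" for a
      unfolding \<phi> by (simp add: ch_minus)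
    then have "E (\<lambda>a. pgram h (of_int u * a) b * pgram h' a b ^ m) = cnj Q"
      using False unfolding Q_def E_cnj[symmetric] by (simp add: u h'_def \<phi>_def)
    then show ?thesis by simp
  qed
  finally show ?thesis .
qed

text \<open>The spectra have, averaged over \<open>b\<close>, mass \<open>W\<close> at most 1 and
  second moment \<open>t\<close>; convexity bounds their moment of order \<open>m + 1\<close> below
  by \<open>t ^ m\<close>. The tangent at \<open>t\<close> gives this also when the mass is below
  1.\<close>

lemma E_pgram_power_ge:
  fixes u :: int
  assumes h: "bdd h" and u: "u \<noteq> 0"
  defines "h' \<equiv> (if u > 0 then \<lambda>x. cnj (h x) else h)" and "m \<equiv> nat \<bar>u\<bar>"
  shows "E (\<lambda>a. E (\<lambda>b. (cmod (pgram h a b))\<^sup>2)) ^ m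
    \<le> cmod (E (\<lambda>a. E (\<lambda>b. pgram h (of_int u * a) b * pgram h' a b ^ m)))"
proof -
  define t where "t = E (\<lambda>a. E (\<lambda>b. (cmod (pgram h a b))\<^sup>2))"
  define \<mu> where "\<mu> b \<xi> = power_spectrum h b \<xi>" for b \<xi>
  define W where "W = E (\<lambda>b. \<Sum>\<xi>\<in>S. \<mu> b \<xi>)"
  obtain n where n: "m = Suc n"
    using u by (cases m) (auto simp: m_def)
  have t: "t = E (\<lambda>b. \<Sum>\<xi>\<in>S. (\<mu> b \<xi>)\<^sup>2)"
    unfolding t_def \<mu>_def by (subst E_swap) (simp add: E_norm_pgram[OF h])
  have t0: "0 \<le> t"
    unfolding t_def by (intro E_nonneg) simp
  have W: "W \<le> 1"
    unfolding W_def \<mu>_def by (intro E_le_const sum_power_spectrum_le h)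
  have "t ^ m = t ^ m * 1" by simp
  \<comment> \<open>The right-hand side is what the tangent bound yields after averaging.\<close>
  also have "\<dots> \<le> t ^ m * (W + of_nat m * (1 - W))"
  proof (rule mult_left_mono)
    have "1 * (1 - W) \<le> of_nat m * (1 - W)"
      using W n by (intro mult_right_mono) auto
    then show "1 \<le> W + of_nat m * (1 - W)" by simp
  qed (use t0 in simp)
  also have "\<dots> = t ^ m * W + of_nat m * t ^ n * (t - t * W)"
    by (simp add: n algebra_simps)
  also have "\<dots> = E (\<lambda>b. \<Sum>\<xi>\<in>S. t ^ m * \<mu> b \<xi> + of_nat m * t ^ n * ((\<mu> b \<xi>)\<^sup>2 + (- t) * \<mu> b \<xi>))"
    unfolding sum.distrib sum_distrib_left[symmetric] E_add E_cmult t[symmetric] W_def[symmetric]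
    by simp
  also have "\<dots> \<le> E (\<lambda>b. \<Sum>\<xi>\<in>S. \<mu> b \<xi> ^ Suc m)"
  proof (intro E_mono sum_mono)
    fix b \<xi>
    have "0 \<le> \<mu> b \<xi>" by (simp add: \<mu>_def)
    then have "\<mu> b \<xi> * (t ^ Suc n + of_nat (Suc n) * t ^ n * (\<mu> b \<xi> - t)) \<le> \<mu> b \<xi> * \<mu> b \<xi> ^ Suc n"
      by (intro mult_left_mono power_Suc_ge_tangent t0)
    then show "t ^ m * \<mu> b \<xi> + of_nat m * t ^ n * ((\<mu> b \<xi>)\<^sup>2 + (- t) * \<mu> b \<xi>) \<le> \<mu> b \<xi> ^ Suc m"
      by (simp add: n power2_eq_square algebra_simps)
  qed
  also have "\<dots> \<le> E (\<lambda>b. Re (E (\<lambda>a. pgram h (of_int u * a) b * pgram h' a b ^ m)))"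
    unfolding \<mu>_def h'_def m_def by (intro E_mono E_pgram_dilate_ge h u)
  also have "\<dots> = Re (E (\<lambda>a. E (\<lambda>b. pgram h (of_int u * a) b * pgram h' a b ^ m)))"
    unfolding Re_E[symmetric] by (subst E_swap) (rule refl)
  also have "\<dots> \<le> cmod (E (\<lambda>a. E (\<lambda>b. pgram h (of_int u * a) b * pgram h' a b ^ m)))"
    by (rule complex_Re_le_cmod)
  finally show ?thesis unfolding t_def .
qed

subsection \<open>Dilation kernels\<close>

lemma E_into4:
  "E (\<lambda>q. E (\<lambda>a. E (\<lambda>b. E (\<lambda>a'. E (\<lambda>b'. F q a b a' b')))))
    = E (\<lambda>a. E (\<lambda>b. E (\<lambda>a'. E (\<lambda>b'. E (\<lambda>q. F q a b a' b')))))"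
  by (rule trans[OF E_swap], rule E_cong, rule trans[OF E_swap], rule E_cong,
      rule trans[OF E_swap], rule E_cong, rule E_swap)

text \<open>The \<open>m\<close>-th power of \<open>d\<close> is an average over \<open>m\<close>
  independent copies of \<open>q\<close>. One Cauchy-Schwarz over all of them removes every
  \<open>\<phi>\<close>, so the exponent on the left is 2 whatever \<open>m\<close> is; each copy
  contributes a factor \<open>L\<close>. The induction handles one copy at a time.\<close>

lemma tensor_cauchy_schwarz:
  fixes Z :: "'a \<Rightarrow> 'a \<Rightarrow> complex" and c :: "'a \<Rightarrow> 'a \<Rightarrow> 'a \<Rightarrow> complex"
  assumes \<phi>: "\<And>q. cmod (\<phi> q) \<le> 1"
  defines "d \<equiv> \<lambda>a b. E (\<lambda>q. \<phi> q * c a b q)"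
    and "L \<equiv> \<lambda>a b a' b'. E (\<lambda>q. c a b q * cnj (c a' b' q))"
  shows "(cmod (E (\<lambda>a. E (\<lambda>b. Z a b * d a b ^ m))))\<^sup>2
    \<le> Re (E (\<lambda>a. E (\<lambda>b. E (\<lambda>a'. E (\<lambda>b'. Z a b * cnj (Z a' b') * L a b a' b' ^ m)))))"
proof (induction m arbitrary: Z)
  case 0
  define X where "X = E (\<lambda>a. E (\<lambda>b. Z a b))"
  have "complex_of_real ((cmod X)\<^sup>2) = X * cnj X"
    by (rule complex_norm_square)
  also have "\<dots> = E (\<lambda>a. E (\<lambda>b. E (\<lambda>a'. E (\<lambda>b'. Z a b * cnj (Z a' b')))))"
    unfolding X_def by (simp only: E_cnj E_cmult E_mult_right)
  finally have "complex_of_real ((cmod X)\<^sup>2) = \<dots>" .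
  from arg_cong[OF this, of Re] show ?case
    by (simp add: X_def)
next
  case (Suc m)
  define R where "R q = E (\<lambda>a. E (\<lambda>b. E (\<lambda>a'. E (\<lambda>b'.
      (Z a b * c a b q) * cnj (Z a' b' * c a' b' q) * L a b a' b' ^ m))))" for q
  \<comment> \<open>The opened factor \<open>c a b q\<close> is absorbed into \<open>Z\<close>, so
    that the induction hypothesis applies for each fixed \<open>q\<close>.\<close>
  have "E (\<lambda>a. E (\<lambda>b. Z a b * d a b ^ Suc m)) = E (\<lambda>q. \<phi> q * E (\<lambda>a. E (\<lambda>b. (Z a b * c a b q) * d a b ^ m)))"
  proof -
    have "Z a b * d a b ^ Suc m = E (\<lambda>q. \<phi> q * ((Z a b * c a b q) * d a b ^ m))" for a b
    proof -
      have "Z a b * d a b ^ Suc m = E (\<lambda>q. \<phi> q * c a b q) * (Z a b * d a b ^ m)"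
        unfolding d_def power_Suc by (simp only: mult_ac)
      also have "\<dots> = E (\<lambda>q. \<phi> q * c a b q * (Z a b * d a b ^ m))"
        by (rule E_mult_right[symmetric])
      also have "\<dots> = E (\<lambda>q. \<phi> q * ((Z a b * c a b q) * d a b ^ m))"
        by (rule E_cong) (simp only: mult_ac)
      finally show ?thesis .
    qed
    then have "E (\<lambda>a. E (\<lambda>b. Z a b * d a b ^ Suc m))
        = E (\<lambda>a. E (\<lambda>b. E (\<lambda>q. \<phi> q * ((Z a b * c a b q) * d a b ^ m))))"
      by (intro E_cong)
    also have "\<dots> = E (\<lambda>q. E (\<lambda>a. E (\<lambda>b. \<phi> q * ((Z a b * c a b q) * d a b ^ m))))"
      by (rule E_rotate[symmetric])
    also have "\<dots> = E (\<lambda>q. \<phi> q * E (\<lambda>a. E (\<lambda>b. (Z a b * c a b q) * d a b ^ m)))"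
      by (simp only: E_cmult)
    finally show ?thesis .
  qed
  then have "(cmod (E (\<lambda>a. E (\<lambda>b. Z a b * d a b ^ Suc m))))\<^sup>2
      \<le> E (\<lambda>q. (cmod (E (\<lambda>a. E (\<lambda>b. (Z a b * c a b q) * d a b ^ m))))\<^sup>2)"
    using E_cauchy_schwarz_bdd[OF \<phi>] by simp
  also have "\<dots> \<le> E (\<lambda>q. Re (R q))"
    unfolding R_def by (intro E_mono Suc.IH)
  also have "\<dots> = Re (E R)"
    by (rule Re_E[symmetric])
  also have "E R = E (\<lambda>a. E (\<lambda>b. E (\<lambda>a'. E (\<lambda>b'. E (\<lambda>q.
      (Z a b * c a b q) * cnj (Z a' b' * c a' b' q) * L a b a' b' ^ m)))))"
    unfolding R_def by (rule E_into4)
  also have "\<dots> = E (\<lambda>a. E (\<lambda>b. E (\<lambda>a'. E (\<lambda>b'. Z a b * cnj (Z a' b') * L a b a' b' ^ Suc m))))"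
  proof (intro E_cong)
    fix a b a' b'
    have "Z a b * cnj (Z a' b') * L a b a' b' ^ Suc m
        = E (\<lambda>q. c a b q * cnj (c a' b' q)) * (Z a b * cnj (Z a' b') * L a b a' b' ^ m)"
      by (simp add: L_def)
    then show "E (\<lambda>q. (Z a b * c a b q) * cnj (Z a' b' * c a' b' q) * L a b a' b' ^ m)
        = Z a b * cnj (Z a' b') * L a b a' b' ^ Suc m"
      unfolding E_mult_right[symmetric] by (simp add: mult_ac)
  qed
  finally show ?case .
qed

text \<open>The Gram matrix \<open>L\<close> of \<open>tensor_cauchy_schwarz\<close> for corners:
  two parallelograms joined at the vertex \<open>q\<close>, where the function has been
  removed.\<close>

definition link :: "('a \<Rightarrow> complex) \<Rightarrow> 'a \<Rightarrow> 'a \<Rightarrow> 'a \<Rightarrow> 'a \<Rightarrow> complex" where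
  "link h a b a' b' = E (\<lambda>q. corners h q a b * cnj (corners h q a' b'))"

text \<open>
  Applying \<open>tensor_cauchy_schwarz\<close> to the average of \<open>pgram h (u a) b * pgram h' a b ^ m\<close>, in order to
  eliminate the \<open>m\<close> factors \<open>h'\<close> at the vertex \<open>q\<close>, leaves the quadratic form of this kernel at \<open>h\<close>.
\<close>

definition dil_kernel :: "('a \<Rightarrow> complex) \<Rightarrow> ('a \<Rightarrow> complex) \<Rightarrow> int \<Rightarrow> nat \<Rightarrow> 'a \<Rightarrow> 'a \<Rightarrow> complex" where
  "dil_kernel h h' u m y' y = E (\<lambda>a. E (\<lambda>b. E (\<lambda>a'. E (\<lambda>b'.
     cnj (corners h y' (of_int u * a') b') * corners h y (of_int u * a) b * link h' a b a' b' ^ m))))"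

lemma bdd_link:
  "bdd h \<Longrightarrow> compat k \<Longrightarrow> compat l \<Longrightarrow> compat m \<Longrightarrow> compat n \<Longrightarrow>
    bdd (\<lambda>x. link h (k x) (l x) (m x) (n x))"
  unfolding link_def by (intro bdd_E bdd_mult bdd_cnj bdd_corners compat_const)

lemma bdd_dil_integrand:
  assumes "bdd h" "bdd h'" "compat k" "compat l" "compat a" "compat b" "compat a'" "compat b'"
  shows "bdd (\<lambda>x. cnj (corners h (k x) (of_int u * a' x) (b' x)) * corners h (l x) (of_int u * a x) (b x) *
    link h' (a x) (b x) (a' x) (b' x) ^ m)"
  by (intro bdd_mult bdd_cnj bdd_power bdd_link bdd_corners compat_scale assms)

lemma bdd2_dil_kernel:
  assumes "bdd h" "bdd h'" shows "bdd2 (dil_kernel h h' u m)"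
  unfolding dil_kernel_def
  by (intro bdd2I bdd_E bdd_dil_integrand assms compat_const compat_id)

lemma E_shift4:
  assumes "\<And>b a' b'. per (\<lambda>a. F a b a' b')" "\<And>a a' b'. per (\<lambda>b. F a b a' b')"
    "\<And>a b b'. per (\<lambda>a'. F a b a' b')" "\<And>a b a'. per (\<lambda>b'. F a b a' b')"
  shows "E (\<lambda>a. E (\<lambda>b. E (\<lambda>a'. E (\<lambda>b'. F (a + c1) (b + c2) (a' + c3) (b' + c4)))))
    = E (\<lambda>a. E (\<lambda>b. E (\<lambda>a'. E (\<lambda>b'. F a b a' b'))))"
proof -
  have "E (\<lambda>a. E (\<lambda>b. E (\<lambda>a'. E (\<lambda>b'. F (a + c1) (b + c2) (a' + c3) (b' + c4)))))
      = E (\<lambda>a. E (\<lambda>b. E (\<lambda>a'. E (\<lambda>b'. F (a + c1) (b + c2) (a' + c3) b'))))"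
    by (intro E_cong E_shift assms)
  also have "\<dots> = E (\<lambda>a. E (\<lambda>b. E (\<lambda>a'. E (\<lambda>b'. F (a + c1) (b + c2) a' b'))))"
    by (intro E_cong E_shift[of "\<lambda>a'. E (\<lambda>b'. F (_ + c1) (_ + c2) a' b')"] per_E assms)
  also have "\<dots> = E (\<lambda>a. E (\<lambda>b. E (\<lambda>a'. E (\<lambda>b'. F (a + c1) b a' b'))))"
    by (intro E_cong E_shift[of "\<lambda>b. E (\<lambda>a'. E (\<lambda>b'. F (_ + c1) b a' b'))"] per_E assms)
  also have "\<dots> = E (\<lambda>a. E (\<lambda>b. E (\<lambda>a'. E (\<lambda>b'. F a b a' b'))))"
    by (intro E_shift[of "\<lambda>a. E (\<lambda>b. E (\<lambda>a'. E (\<lambda>b'. F a b a' b')))"] per_E assms)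
  finally show ?thesis .
qed

lemma dil_kernel_shift:
  assumes "bdd h" "bdd h'"
  shows "dil_kernel h h' u m y' y = E (\<lambda>a. E (\<lambda>b. E (\<lambda>a'. E (\<lambda>b'.
     cnj (corners h y' (of_int u * (a' + c3)) (b' + c4)) * corners h y (of_int u * (a + c1)) (b + c2) *
     link h' (a + c1) (b + c2) (a' + c3) (b' + c4) ^ m))))"
  unfolding dil_kernel_def
  by (rule E_shift4[symmetric, of "\<lambda>a b a' b'. cnj (corners h y' (of_int u * a') b') *
      corners h y (of_int u * a) b * link h' a b a' b' ^ m"])
    (intro bdd_per bdd_dil_integrand assms compat_const compat_id)+

lemma link_shift:
  assumes "bdd h"
  shows "link h a b a' b' = E (\<lambda>q. corners h (q + c) a b * cnj (corners h (q + c) a' b'))"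
  unfolding link_def
  by (rule E_shift[symmetric, of "\<lambda>q. corners h q a b * cnj (corners h q a' b')"])
    (intro bdd_per bdd_mult bdd_cnj bdd_corners assms compat_const compat_id)

text \<open>Replace \<open>a\<close> by \<open>a + s\<close> and \<open>b\<close> by
  \<open>b + t\<close>, likewise the primed pair, and \<open>q\<close> by
  \<open>q + (s + t)\<close>: every vertex then moves with \<open>s\<close> alone, with
  \<open>t\<close> alone or not at all.\<close>

lemma rk_dil_kernel_diag:
  assumes h: "bdd h" and h': "bdd h'"
  shows "rk (\<lambda>s t. dil_kernel h h' u m (y' + (of_int u * s + t)) (y + (of_int u * s + t)))"
proof -
  have c: "corners h (z + (of_int u * s + t)) (of_int u * (a + s)) (b + t)
      = cnj (h (z - of_int u * a + t)) * cnj (h (z - b + of_int u * s)) * h (z - of_int u * a - b)"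
    for z a b s t
    by (simp add: corners_def algebra_simps)
  have c': "corners h' (q + (s + t)) (a + s) (b + t)
      = cnj (h' (q - a + t)) * cnj (h' (q - b + s)) * h' (q - a - b)" for q a b s t
    by (simp add: corners_def algebra_simps)
  have "dil_kernel h h' u m (y' + (of_int u * s + t)) (y + (of_int u * s + t))
      = E (\<lambda>a. E (\<lambda>b. E (\<lambda>a'. E (\<lambda>b'.
     cnj (cnj (h (y' - of_int u * a' + t)) * cnj (h (y' - b' + of_int u * s)) * h (y' - of_int u * a' - b')) *
     (cnj (h (y - of_int u * a + t)) * cnj (h (y - b + of_int u * s)) * h (y - of_int u * a - b)) *
     E (\<lambda>q. (cnj (h' (q - a + t)) * cnj (h' (q - b + s)) * h' (q - a - b)) *
        cnj (cnj (h' (q - a' + t)) * cnj (h' (q - b' + s)) * h' (q - a' - b'))) ^ m))))" for s t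
    by (subst dil_kernel_shift[OF h h', of _ _ _ _ s t s t])
      (simp only: c link_shift[OF h', of _ _ _ _ "s + t"] c')
  then show ?thesis
    by (simp only:) (intro rk_E rk_power rk_mult rk_cnj rk_left[OF bdd_comp[OF h]] rk_right[OF bdd_comp[OF h]]
      rk_left[OF bdd_comp[OF h']] rk_right[OF bdd_comp[OF h']] compat_intros)
qed

text \<open>
  The primed half of the kernel is shifted with the roles of \<open>s\<close> and \<open>t\<close> exchanged; both halves of
  \<open>link\<close> still agree at the vertex \<open>q + (s + t)\<close>.
\<close>

lemma rk_dil_kernel_skew:
  assumes h: "bdd h" and h': "bdd h'"
  shows "rk (\<lambda>s t. dil_kernel h h' u m (y' + (s + of_int u * t)) (y + (of_int u * s + t)))"
proof -
  have c: "corners h (z + (of_int u * s + t)) (of_int u * (a + s)) (b + t)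
      = cnj (h (z - of_int u * a + t)) * cnj (h (z - b + of_int u * s)) * h (z - of_int u * a - b)"
    for z a b s t
    by (simp add: corners_def algebra_simps)
  have c2: "corners h (z + (s + of_int u * t)) (of_int u * (a + t)) (b + s)
      = cnj (h (z - of_int u * a + s)) * cnj (h (z - b + of_int u * t)) * h (z - of_int u * a - b)"
    for z a b s t
    by (simp add: corners_def algebra_simps)
  have c': "corners h' (q + (s + t)) (a + s) (b + t)
      = cnj (h' (q - a + t)) * cnj (h' (q - b + s)) * h' (q - a - b)" for q a b s t
    by (simp add: corners_def algebra_simps)
  have c2': "corners h' (q + (s + t)) (a + t) (b + s)
      = cnj (h' (q - a + s)) * cnj (h' (q - b + t)) * h' (q - a - b)" for q a b s t
    by (simp add: corners_def algebra_simps)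
  have "dil_kernel h h' u m (y' + (s + of_int u * t)) (y + (of_int u * s + t))
      = E (\<lambda>a. E (\<lambda>b. E (\<lambda>a'. E (\<lambda>b'.
     cnj (cnj (h (y' - of_int u * a' + s)) * cnj (h (y' - b' + of_int u * t)) * h (y' - of_int u * a' - b')) *
     (cnj (h (y - of_int u * a + t)) * cnj (h (y - b + of_int u * s)) * h (y - of_int u * a - b)) *
     E (\<lambda>q. (cnj (h' (q - a + t)) * cnj (h' (q - b + s)) * h' (q - a - b)) *
        cnj (cnj (h' (q - a' + s)) * cnj (h' (q - b' + t)) * h' (q - a' - b'))) ^ m))))" for s t
    by (subst dil_kernel_shift[OF h h', of _ _ _ _ t s s t])
      (simp only: c c2 link_shift[OF h', of _ _ _ _ "s + t"] c' c2')
  then show ?thesis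
    by (simp only:) (intro rk_E rk_power rk_mult rk_cnj rk_left[OF bdd_comp[OF h]] rk_right[OF bdd_comp[OF h]]
      rk_left[OF bdd_comp[OF h']] rk_right[OF bdd_comp[OF h']] compat_intros)
qed

text \<open>\<open>E_pgram_power_ge\<close> supplies the lower bound and
  \<open>tensor_cauchy_schwarz\<close> squares it, whence the exponent \<open>2 * m\<close>. Opening
  the remaining factors \<open>pgram h\<close> at \<open>y\<close> and \<open>y'\<close> exhibits
  the quadratic form of the kernel.\<close>

lemma dil_kernel_correlation:
  fixes u :: int
  assumes h: "bdd h" and u: "u \<noteq> 0"
  defines "h' \<equiv> (if u > 0 then \<lambda>x. cnj (h x) else h)" and "m \<equiv> nat \<bar>u\<bar>"
  shows "E (\<lambda>a. E (\<lambda>b. (cmod (pgram h a b))\<^sup>2)) ^ (2 * m)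
    \<le> cmod (E (\<lambda>y'. E (\<lambda>y. cnj (h y') * dil_kernel h h' u m y' y * h y)))"
proof -
  let ?X = "E (\<lambda>a. E (\<lambda>b. pgram h (of_int u * a) b * pgram h' a b ^ m))"
  let ?K = "E (\<lambda>y'. E (\<lambda>y. cnj (h y') * dil_kernel h h' u m y' y * h y))"
  have h': "bdd h'"
    using h by (simp add: h'_def bdd_cnj)
  have "E (\<lambda>a. E (\<lambda>b. (cmod (pgram h a b))\<^sup>2)) ^ (2 * m) \<le> (cmod ?X)\<^sup>2"
    unfolding power_mult mult.commute[of 2 m]
    by (intro power_mono E_pgram_power_ge[OF h u, folded h'_def m_def] zero_le_power E_nonneg) simp
  also have "\<dots> \<le> Re (E (\<lambda>a. E (\<lambda>b. E (\<lambda>a'. E (\<lambda>b'.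
      pgram h (of_int u * a) b * cnj (pgram h (of_int u * a') b') * link h' a b a' b' ^ m)))))"
    unfolding link_def pgram_def[of h']
    by (rule tensor_cauchy_schwarz) (rule bdd_norm_le[OF h'])
  also have "E (\<lambda>a. E (\<lambda>b. E (\<lambda>a'. E (\<lambda>b'.
      pgram h (of_int u * a) b * cnj (pgram h (of_int u * a') b') * link h' a b a' b' ^ m)))) = ?K"
  proof -
    have "?K = E (\<lambda>y'. E (\<lambda>y. E (\<lambda>a. E (\<lambda>b. E (\<lambda>a'. E (\<lambda>b'.
        cnj (h y' * corners h y' (of_int u * a') b') * (h y * corners h y (of_int u * a) b) * link h' a b a' b' ^ m))))))"
      unfolding dil_kernel_def E_cmult[symmetric] E_mult_right[symmetric]
      by (intro E_cong) (simp add: mult_ac)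
    also have "\<dots> = E (\<lambda>y'. E (\<lambda>a. E (\<lambda>b. E (\<lambda>a'. E (\<lambda>b'. E (\<lambda>y.
        cnj (h y' * corners h y' (of_int u * a') b') * (h y * corners h y (of_int u * a) b) * link h' a b a' b' ^ m))))))"
      by (intro E_cong E_into4)
    also have "\<dots> = E (\<lambda>a. E (\<lambda>b. E (\<lambda>a'. E (\<lambda>b'. E (\<lambda>y'. E (\<lambda>y.
        cnj (h y' * corners h y' (of_int u * a') b') * (h y * corners h y (of_int u * a) b) * link h' a b a' b' ^ m))))))"
      by (rule E_into4)
    also have "\<dots> = E (\<lambda>a. E (\<lambda>b. E (\<lambda>a'. E (\<lambda>b'.
        pgram h (of_int u * a) b * cnj (pgram h (of_int u * a') b') * link h' a b a' b' ^ m))))"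
      unfolding E_mult_right E_cmult E_cnj pgram_def[symmetric] by (simp add: mult_ac)
    finally show ?thesis by simp
  qed
  also have "Re ?K \<le> cmod ?K"
    by (rule complex_Re_le_cmod)
  finally show ?thesis .
qed

subsection \<open>Combining two product structures\<close>

lemma rk_diag_scaled:
  assumes "bdd h" "bdd h'"
  shows "rk (\<lambda>s t. dil_kernel h h' u m (y' + (of_int (u * k) * s + of_int l * t)) (y + (of_int (u * k) * s + of_int l * t)))"
  using rk_comp[OF rk_dil_kernel_diag[OF assms, of u m y' y] compat_scale[OF compat_id, of k] compat_scale[OF compat_id, of l]]
  by (simp add: mult.assoc)

lemma rk_skew_scaled:
  assumes "bdd h" "bdd h'"
  shows "rk (\<lambda>s t. dil_kernel h h' u m (y' + (of_int k * s + of_int (u * l) * t)) (y + (of_int (u * k) * s + of_int l * t)))"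
  using rk_comp[OF rk_dil_kernel_skew[OF assms, of u m y' y] compat_scale[OF compat_id, of k] compat_scale[OF compat_id, of l]]
  by (simp add: mult.assoc)

lemma rk_plane_scaled:
  assumes "rk (\<lambda>s t. T (x + (of_int a * s + of_int b * t)) (y + (of_int a' * s + of_int b' * t)))"
  shows "rk (\<lambda>s t. T (x + (of_int (k * a) * s + of_int (l * b) * t)) (y + (of_int (k * a') * s + of_int (l * b') * t)))"
  using rk_comp[OF assms compat_scale[OF compat_id, of k] compat_scale[OF compat_id, of l]]
  by (simp add: mult_ac)

text \<open>
  With \<open>(a1, a2)\<close> etc. the values of \<open>(\<phi>\<^sub>j, \<phi>\<^sub>e)\<close> at the directions of the two planes, the multiplier is
  \<open>u / v = b1 d2 / (b2 d1)\<close>: it makes the \<open>t\<close>-components of the two ends of the chain equal.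
\<close>

lemma pair_control:
  fixes a1 a2 b1 b2 c1 c2 d1 d2 :: int
  assumes f: "bdd f" and e: "bdd e" and T: "bdd2 T"
    and rk1: "\<And>x y. rk (\<lambda>s t. T (x + (of_int a1 * s + of_int b1 * t)) (y + (of_int a2 * s + of_int b2 * t)))"
    and rk2: "\<And>x y. rk (\<lambda>s t. T (x + (of_int c1 * s + of_int d1 * t)) (y + (of_int c2 * s + of_int d2 * t)))"
    and units: "unit_mod a1" "unit_mod a2" "unit_mod b1" "unit_mod b2"
      "unit_mod c1" "unit_mod c2" "unit_mod d1" "unit_mod d2"
    and nondeg: "unit_mod (a1 * b1 * c2 * d2 - a2 * b2 * c1 * d1)"
  defines "u \<equiv> b1 * d2" and "v \<equiv> b2 * d1"
  shows "(cmod (E (\<lambda>x. E (\<lambda>y. f x * e y * T x y)))) ^ (4096 * (nat \<bar>u\<bar> * nat \<bar>v\<bar>)) \<le> cmod (U2_pow4 f)"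
proof -
  note ci = compat_const compat_id
  have nz: "k \<noteq> 0" if "unit_mod k" for k
    using that by (auto simp: unit_mod_def)
  have uv: "unit_mod u" "unit_mod v" "u \<noteq> 0" "v \<noteq> 0"
    using units nz by (auto simp: u_def v_def intro: unit_mod_mult)
  define mu where "mu = nat \<bar>u\<bar>"
  define mv where "mv = nat \<bar>v\<bar>"
  define \<eta> where "\<eta> h = E (\<lambda>s. E (\<lambda>t. (cmod (pgram h s t))\<^sup>2))" for h
  have \<eta>_nonneg: "0 \<le> \<eta> h" for h
    unfolding \<eta>_def by (intro E_nonneg) simp
  \<comment> \<open>The dual function: pairing \<open>h\<close> with \<open>g\<close> puts
    \<open>h\<close> in the place of \<open>e\<close>.\<close>
  define g where "g y = E (\<lambda>x. f x * T x y)" for y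
  have g: "bdd g"
    unfolding g_def by (intro bdd_E bdd_mult bdd_comp[OF f] bdd2_comp[OF T] ci)
  have dual: "E (\<lambda>x. E (\<lambda>y. f x * h y * T x y)) = E (\<lambda>y. h y * g y)" for h
    unfolding g_def E_cmult[symmetric] by (subst E_swap) (intro E_cong, simp add: mult_ac)
  \<comment> \<open>\<open>U3_control\<close> holds for every bounded function in the second slot,
    so whatever correlates with \<open>g\<close> has large U3 norm.\<close>
  have dual_\<eta>: "(cmod (E (\<lambda>y. cnj (h y) * g y))) ^ 8 \<le> \<eta> h" if "bdd h" for h
    using U3_control[OF f bdd_cnj[OF that] T rk1 units(2,4)]
    unfolding dual \<eta>_def by (simp add: pgram_cnj)
  define \<delta> where "\<delta> = cmod (E (\<lambda>x. E (\<lambda>y. f x * e y * T x y)))"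
  \<comment> \<open>Cauchy-Schwarz removes \<open>e\<close> and leaves the correlation of
    \<open>g\<close> with itself.\<close>
  have "\<delta>\<^sup>2 \<le> E (\<lambda>y. (cmod (g y))\<^sup>2)"
    unfolding \<delta>_def dual by (intro E_cauchy_schwarz_bdd bdd_norm_le e)
  also have "complex_of_real (E (\<lambda>y. (cmod (g y))\<^sup>2)) = E (\<lambda>y. cnj (g y) * g y)"
    unfolding E_of_real[symmetric] complex_norm_square by (simp only: mult.commute)
  then have "E (\<lambda>y. (cmod (g y))\<^sup>2) \<le> cmod (E (\<lambda>y. cnj (g y) * g y))"
    by (rule real_le_cmod)
  finally have "(\<delta>\<^sup>2) ^ 8 \<le> (cmod (E (\<lambda>y. cnj (g y) * g y))) ^ 8"
    by (intro power_mono) auto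
  also have "\<dots> \<le> \<eta> g"
    by (rule dual_\<eta>[OF g])
  finally have \<eta>g: "\<delta> ^ 16 \<le> \<eta> g" by simp
  define gv where "gv = (if v > 0 then \<lambda>x. cnj (g x) else g)"
  have gv: "bdd gv"
    using g by (simp add: gv_def bdd_cnj)
  define Kv where "Kv = dil_kernel g gv v mv"
  have Kv: "bdd2 Kv"
    unfolding Kv_def by (rule bdd2_dil_kernel[OF g gv])
  \<comment> \<open>Since \<open>g\<close> has large U3 norm, it correlates with its image
    \<open>h\<close> under \<open>Kv\<close>; so \<open>h\<close> has large U3 norm as well, and a
    second dilation kernel can be inserted.\<close>
  define h where "h y' = E (\<lambda>y. Kv y' y * g y)" for y'
  have h: "bdd h"
    unfolding h_def by (intro bdd_E bdd_mult bdd_comp[OF g] bdd2_comp[OF Kv] ci)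
  have "(\<delta> ^ 16) ^ (2 * mv) \<le> \<eta> g ^ (2 * mv)"
    using \<eta>g by (intro power_mono) (simp_all add: \<delta>_def)
  also have "\<dots> \<le> cmod (E (\<lambda>y'. E (\<lambda>y. cnj (g y') * Kv y' y * g y)))"
    unfolding \<eta>_def Kv_def gv_def mv_def by (rule dil_kernel_correlation[OF g uv(4)])
  also have "E (\<lambda>y'. E (\<lambda>y. cnj (g y') * Kv y' y * g y)) = cnj (E (\<lambda>y. cnj (h y) * g y))"
    unfolding E_cnj[symmetric] h_def complex_cnj_mult complex_cnj_cnj E_mult_right[symmetric]
    by (intro E_cong) (simp add: mult_ac)
  finally have "((\<delta> ^ 16) ^ (2 * mv)) ^ 8 \<le> (cmod (E (\<lambda>y. cnj (h y) * g y))) ^ 8"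
    by (intro power_mono) (simp_all add: \<delta>_def)
  also have "\<dots> \<le> \<eta> h"
    by (rule dual_\<eta>[OF h])
  finally have \<eta>h: "\<delta> ^ (256 * mv) \<le> \<eta> h"
    by (simp add: power_mult[symmetric] mult.assoc)
  define hu where "hu = (if u > 0 then \<lambda>x. cnj (h x) else h)"
  have hu: "bdd hu"
    using h by (simp add: hu_def bdd_cnj)
  define Ku where "Ku = dil_kernel h hu u mu"
  have Ku: "bdd2 Ku"
    unfolding Ku_def by (rule bdd2_dil_kernel[OF h hu])
  \<comment> \<open>The chain from \<open>x'\<close> to \<open>x\<close> runs through
    \<open>y1\<close>, \<open>y'\<close>, \<open>y\<close>, \<open>y2\<close> along
    \<open>T\<close>, \<open>Kv\<close>, \<open>Ku\<close>, \<open>Kv\<close>, \<open>T\<close>, the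
    first two conjugated.\<close>
  define G where "G x' x y1 y' y y2
    = cnj (T x' y1) * cnj (Kv y' y1) * Ku y' y * Kv y y2 * T x y2" for x' x y1 y' y y2
  define B where "B x' x = E (\<lambda>y1. E (\<lambda>y'. E (\<lambda>y. E (\<lambda>y2. G x' x y1 y' y y2))))" for x' x
  have bddG: "bdd (\<lambda>z. G (k1 z) (k2 z) (k3 z) (k4 z) (k5 z) (k6 z))"
    if "compat k1" "compat k2" "compat k3" "compat k4" "compat k5" "compat k6" for k1 k2 k3 k4 k5 k6
    unfolding G_def by (intro bdd_mult bdd_cnj bdd2_comp[OF T] bdd2_comp[OF Kv] bdd2_comp[OF Ku] that)
  have B: "bdd2 B"
    unfolding B_def by (intro bdd2I bdd_E bddG ci)
  have B_shift: "B x' x = E (\<lambda>y1. E (\<lambda>y'. E (\<lambda>y. E (\<lambda>y2. G x' x (y1 + k1) (y' + k2) (y + k3) (y2 + k4)))))"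
    for x' x k1 k2 k3 k4
    unfolding B_def by (rule E_shift4[symmetric]) (intro bdd_per bddG ci)+
  have "(\<delta> ^ (256 * mv)) ^ (2 * mu) \<le> \<eta> h ^ (2 * mu)"
    using \<eta>h by (intro power_mono) (simp_all add: \<delta>_def)
  also have "\<dots> \<le> cmod (E (\<lambda>y'. E (\<lambda>y. cnj (h y') * Ku y' y * h y)))"
    unfolding \<eta>_def Ku_def hu_def mu_def by (rule dil_kernel_correlation[OF h uv(3)])
  also have "E (\<lambda>y'. E (\<lambda>y. cnj (h y') * Ku y' y * h y)) = E (\<lambda>x'. E (\<lambda>x. cnj (f x') * f x * B x' x))"
  proof -
    let ?H = "\<lambda>x' x y1 y' y y2. cnj (f x' * T x' y1) * (f x * T x y2) * (cnj (Kv y' y1) * Ku y' y * Kv y y2)"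
    have "E (\<lambda>x'. E (\<lambda>x. cnj (f x') * f x * B x' x))
        = E (\<lambda>x'. E (\<lambda>x. E (\<lambda>y1. E (\<lambda>y'. E (\<lambda>y. E (\<lambda>y2. ?H x' x y1 y' y y2))))))"
      unfolding B_def E_cmult[symmetric] G_def by (intro E_cong) (simp add: mult_ac)
    also have "\<dots> = E (\<lambda>x'. E (\<lambda>y1. E (\<lambda>y'. E (\<lambda>y. E (\<lambda>y2. E (\<lambda>x. ?H x' x y1 y' y y2))))))"
      by (intro E_cong E_into4)
    also have "\<dots> = E (\<lambda>y1. E (\<lambda>y'. E (\<lambda>y. E (\<lambda>y2. E (\<lambda>x'. E (\<lambda>x. ?H x' x y1 y' y y2))))))"
      by (rule E_into4)
    also have "\<dots> = E (\<lambda>y1. E (\<lambda>y'. E (\<lambda>y. E (\<lambda>y2. cnj (g y1) * g y2 * (cnj (Kv y' y1) * Ku y' y * Kv y y2)))))"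
      by (simp only: E_mult_right E_cmult E_cnj g_def)
    also have "\<dots> = E (\<lambda>y'. E (\<lambda>y. E (\<lambda>y1. E (\<lambda>y2. cnj (g y1) * g y2 * (cnj (Kv y' y1) * Ku y' y * Kv y y2)))))"
      by (rule E_rotate)
    also have "\<dots> = E (\<lambda>y'. E (\<lambda>y. E (\<lambda>y1. E (\<lambda>y2. cnj (Kv y' y1 * g y1) * (Ku y' y * (Kv y y2 * g y2))))))"
      by (intro E_cong) (simp add: mult_ac)
    also have "\<dots> = E (\<lambda>y'. E (\<lambda>y. cnj (h y') * (Ku y' y * h y)))"
      by (simp only: E_mult_right E_cmult E_cnj h_def)
    finally show ?thesis by (simp only: mult.assoc)
  qed
  finally have corr: "\<delta> ^ (512 * (mu * mv)) \<le> cmod (E (\<lambda>x'. E (\<lambda>x. cnj (f x') * f x * B x' x)))"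
    by (simp add: power_mult[symmetric] mult_ac)
  have rkB: "rk (\<lambda>s t. B (x' + (of_int (u * v * a1) * s + of_int b1 * t)) (x + (of_int (u * v * a1) * s + of_int b1 * t)))" for x' x
  proof -
    \<comment> \<open>First plane: the four inner variables move in parallel. The factor
      \<open>u * v\<close> of \<open>s\<close> makes the diagonal structures of \<open>Kv\<close>
      and \<open>Ku\<close> available together.\<close>
    let ?l = "\<lambda>s t. of_int (u * v * a2) * s + of_int b2 * t"
    have "rk (\<lambda>s t. T (z + (of_int (u * v * a1) * s + of_int b1 * t)) (y + ?l s t))" for z y
      using rk_plane_scaled[of T z a1 b1 y a2 b2 "u * v" 1, OF rk1] by simp
    moreover have "rk (\<lambda>s t. Kv (y' + ?l s t) (y + ?l s t))" for y' y
      using rk_diag_scaled[OF g gv, of v mv y' "u * a2" b2 y] by (simp add: Kv_def mult_ac)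
    moreover have "rk (\<lambda>s t. Ku (y' + ?l s t) (y + ?l s t))" for y' y
      using rk_diag_scaled[OF h hu, of u mu y' "v * a2" b2 y] by (simp add: Ku_def mult_ac)
    ultimately have "rk (\<lambda>s t. E (\<lambda>y1. E (\<lambda>y'. E (\<lambda>y. E (\<lambda>y2.
        G (x' + (of_int (u * v * a1) * s + of_int b1 * t)) (x + (of_int (u * v * a1) * s + of_int b1 * t))
          (y1 + ?l s t) (y' + ?l s t) (y + ?l s t) (y2 + ?l s t))))))"
      unfolding G_def by (intro rk_E rk_mult rk_cnj)
    then show ?thesis
      by (simp flip: B_shift)
  qed
  \<comment> \<open>Second plane: \<open>x'\<close> moves along the plane of \<open>c\<close>,
    \<open>d\<close> and \<open>x\<close> along that of \<open>a\<close>, \<open>b\<close>. Both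
    have the \<open>t\<close>-component \<open>\<mu>\<close>, while
    \<open>\<kappa>' - \<kappa>\<close> is \<open>v\<close> times the unit in
    \<open>nondeg\<close>.\<close>
  define \<kappa> where "\<kappa> = v * (a2 * b2 * c1 * d1)"
  define \<kappa>' where "\<kappa>' = v * (a1 * b1 * c2 * d2)"
  define \<mu> where "\<mu> = b1 * b2 * d1 * d2"
  have rkB': "rk (\<lambda>s t. B (of_int \<kappa> * s + of_int \<mu> * t) (of_int \<kappa>' * s + of_int \<mu> * t))"
  proof -
    \<comment> \<open>The skew structures of \<open>Kv\<close> and then \<open>Ku\<close> match the
      displacements of \<open>y1\<close>, \<open>y'\<close> and \<open>y\<close>: the
      \<open>s\<close>-coefficient is divided by \<open>v\<close> and multiplied by
      \<open>u\<close>, the \<open>t\<close>-coefficient the other way round.\<close>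
    let ?l1 = "\<lambda>s t. of_int (v * (v * (a2 * c2))) * s + of_int (u * (b2 * d2)) * t"
    let ?l' = "\<lambda>s t. of_int (v * (a2 * c2)) * s + of_int (u * (v * (b2 * d2))) * t"
    let ?l = "\<lambda>s t. of_int (u * (v * (a2 * c2))) * s + of_int (v * (b2 * d2)) * t"
    let ?k' = "\<lambda>s t. of_int \<kappa> * s + of_int \<mu> * t"
    let ?k = "\<lambda>s t. of_int \<kappa>' * s + of_int \<mu> * t"
    have "rk (\<lambda>s t. T (?k' s t) (y + ?l1 s t))" for y
      using rk_plane_scaled[of T 0 c1 d1 y c2 d2 "v * v * a2" "u * b2", OF rk2]
      by (simp add: u_def v_def \<kappa>_def \<mu>_def mult_ac)
    moreover have "rk (\<lambda>s t. T (?k s t) (y + ?l s t))" for y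
      using rk_plane_scaled[of T 0 a1 b1 y a2 b2 "v * u * c2" "v * d2", OF rk1]
      by (simp add: u_def v_def \<kappa>'_def \<mu>_def mult_ac)
    moreover have "rk (\<lambda>s t. Kv (y' + ?l' s t) (y + ?l1 s t))" for y' y
      using rk_skew_scaled[OF g gv, of v mv y' "v * (a2 * c2)" "u * (b2 * d2)" y] by (simp add: Kv_def mult_ac)
    moreover have "rk (\<lambda>s t. Kv (y' + ?l s t) (y + ?l s t))" for y' y
      using rk_diag_scaled[OF g gv, of v mv y' "u * (a2 * c2)" "v * (b2 * d2)" y] by (simp add: Kv_def mult_ac)
    moreover have "rk (\<lambda>s t. Ku (y' + ?l' s t) (y + ?l s t))" for y' y
      using rk_skew_scaled[OF h hu, of u mu y' "v * (a2 * c2)" "v * (b2 * d2)" y] by (simp add: Ku_def mult_ac)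
    ultimately have "rk (\<lambda>s t. E (\<lambda>y1. E (\<lambda>y'. E (\<lambda>y. E (\<lambda>y2.
        G (?k' s t) (?k s t) (y1 + ?l1 s t) (y' + ?l' s t) (y + ?l s t) (y2 + ?l s t))))))"
      unfolding G_def by (intro rk_E rk_mult rk_cnj)
    then show ?thesis
      by (simp flip: B_shift)
  qed
  have "(\<delta> ^ (512 * (mu * mv))) ^ 8 \<le> (cmod (E (\<lambda>x'. E (\<lambda>x. cnj (f x') * f x * B x' x)))) ^ 8"
    using corr by (intro power_mono) (simp_all add: \<delta>_def)
  also have "\<dots> \<le> cmod (U2_pow4 f)"
  proof (rule kernel_bound[OF f B])
    show "unit_mod (u * v * a1)" "unit_mod b1" "unit_mod \<mu>"
      unfolding \<mu>_def by (intro unit_mod_mult units uv)+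
    show "unit_mod (\<kappa>' - \<kappa>)"
      using unit_mod_mult[OF uv(2) nondeg] by (simp add: \<kappa>_def \<kappa>'_def right_diff_distrib mult_ac)
    show "rk (\<lambda>s t. B (of_int (u * v * a1) * s + of_int b1 * t) (d + (of_int (u * v * a1) * s + of_int b1 * t)))" for d
      using rkB[of 0 d] by simp
  qed (rule rkB')
  finally show ?thesis
    unfolding \<delta>_def mu_def mv_def by (simp add: power_mult[symmetric] mult_ac)
qed

subsection \<open>Systems of linear forms\<close>

lemma bdd_prod: "finite I \<Longrightarrow> (\<And>i. i \<in> I \<Longrightarrow> bdd (F i)) \<Longrightarrow> bdd (\<lambda>x. \<Prod>i\<in>I. F i x)"
proof (induction I rule: finite_induct)
  case empty
  show ?case using bdd_const[of 1] by simp
next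
  case (insert i I)
  have "bdd (\<lambda>x. F i x * (\<Prod>i\<in>I. F i x))"
    by (intro bdd_mult insert.IH insert.prems) auto
  then show ?case using insert.hyps by simp
qed

lemma rk_prod: "finite I \<Longrightarrow> (\<And>i. i \<in> I \<Longrightarrow> rk (\<Psi> i)) \<Longrightarrow> rk (\<lambda>s t. \<Prod>i\<in>I. \<Psi> i s t)"
proof (induction I rule: finite_induct)
  case empty
  show ?case using rk_const[of 1] by simp
next
  case (insert i I)
  have "rk (\<lambda>s t. \<Psi> i s t * (\<Prod>i\<in>I. \<Psi> i s t))"
    by (intro rk_mult insert.IH insert.prems) auto
  then show ?case using insert.hyps by simp
qed

definition lin :: "int^3 \<Rightarrow> 'a \<Rightarrow> 'a \<Rightarrow> 'a \<Rightarrow> 'a" where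
  "lin a w1 w2 w3 = of_int (a $ 1) * w1 + of_int (a $ 2) * w2 + of_int (a $ 3) * w3"

lemma lin_shift:
  "lin a (w1 + (of_int (v $ 1) * s + of_int (v' $ 1) * t)) (w2 + (of_int (v $ 2) * s + of_int (v' $ 2) * t))
      (w3 + (of_int (v $ 3) * s + of_int (v' $ 3) * t))
    = lin a w1 w2 w3 + (of_int (linear_form a v) * s + of_int (linear_form a v') * t)"
  by (simp add: lin_def linear_form_3 algebra_simps)

lemma compat_lin: "compat l1 \<Longrightarrow> compat l2 \<Longrightarrow> compat l3 \<Longrightarrow> compat (\<lambda>x. lin a (l1 x) (l2 x) (l3 x))"
  unfolding lin_def by (intro compat_intros)

lemma E_shift3:
  assumes "\<And>b c. per (\<lambda>a. F a b c)" "\<And>a c. per (\<lambda>b. F a b c)" "\<And>a b. per (\<lambda>c. F a b c)"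
  shows "E (\<lambda>a. E (\<lambda>b. E (\<lambda>c. F (a + k1) (b + k2) (c + k3)))) = E (\<lambda>a. E (\<lambda>b. E (\<lambda>c. F a b c)))"
  using E_shift4[of "\<lambda>a b c _. F a b c" k1 k2 k3 0] assms by (simp add: per_const)

section \<open>Reduction of the system to a kernel in two variables\<close>

context
  fixes \<Phi> :: "int^3^6" and f :: "6 \<Rightarrow> 'a \<Rightarrow> complex" and j e :: 6 and p1 p2 :: "int^3" and I :: "6 set"
  assumes f: "\<And>i. bdd (f i)"
    and je: "j \<noteq> e" and I: "I = UNIV - {j, e}"
    and p1: "[linear_form (\<Phi> $ j) p1 = 1] (mod int p)" "[linear_form (\<Phi> $ e) p1 = 0] (mod int p)"
    and p2: "[linear_form (\<Phi> $ j) p2 = 0] (mod int p)" "[linear_form (\<Phi> $ e) p2 = 1] (mod int p)"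
begin

text \<open>
  The value of \<open>\<phi>\<^sub>i\<close> at the point obtained from \<open>w\<close> by moving along \<open>p1\<close>, \<open>p2\<close> until
  \<open>\<phi>\<^sub>j\<close> and \<open>\<phi>\<^sub>e\<close> take the values \<open>x\<close> and \<open>y\<close>.
\<close>

definition moved :: "6 \<Rightarrow> 'a \<Rightarrow> 'a \<Rightarrow> 'a \<Rightarrow> 'a \<Rightarrow> 'a \<Rightarrow> 'a" where
  "moved i w1 w2 w3 x y = lin (\<Phi> $ i) w1 w2 w3 + (of_int (linear_form (\<Phi> $ i) p1) * (x - lin (\<Phi> $ j) w1 w2 w3)
     + of_int (linear_form (\<Phi> $ i) p2) * (y - lin (\<Phi> $ e) w1 w2 w3))"

definition pair_kernel :: "'a \<Rightarrow> 'a \<Rightarrow> complex" where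
  "pair_kernel x y = E (\<lambda>w1. E (\<lambda>w2. E (\<lambda>w3. \<Prod>i\<in>I. f i (moved i w1 w2 w3 x y))))"

lemma finite_I: "finite I"
  by (rule finite)

lemma bdd_moved:
  assumes "compat l1" "compat l2" "compat l3" "compat l" "compat l'"
  shows "bdd (\<lambda>z. f i (moved i (l1 z) (l2 z) (l3 z) (l z) (l' z)))"
  unfolding moved_def by (intro bdd_comp[OF f] compat_intros compat_lin assms)

lemma bdd2_pair_kernel: "bdd2 pair_kernel"
  unfolding pair_kernel_def
  by (intro bdd2I bdd_E bdd_prod finite_I bdd_moved compat_const compat_id)

text \<open>Translating the base point by \<open>s v + t v'\<close> along with \<open>x\<close> and
  \<open>y\<close> moves the argument of each remaining form by its own values at \<open>v\<close>
  and \<open>v'\<close>, one of which is zero.\<close>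

lemma rk_pair_kernel:
  assumes "\<And>i. i \<in> I \<Longrightarrow> linear_form (\<Phi> $ i) v = 0 \<or> linear_form (\<Phi> $ i) v' = 0"
  shows "rk (\<lambda>s t. pair_kernel
      (x + (of_int (linear_form (\<Phi> $ j) v) * s + of_int (linear_form (\<Phi> $ j) v') * t))
      (y + (of_int (linear_form (\<Phi> $ e) v) * s + of_int (linear_form (\<Phi> $ e) v') * t)))"
proof -
  have step: "moved i (w1 + (of_int (v $ 1) * s + of_int (v' $ 1) * t)) (w2 + (of_int (v $ 2) * s + of_int (v' $ 2) * t))
      (w3 + (of_int (v $ 3) * s + of_int (v' $ 3) * t))
      (x + (of_int (linear_form (\<Phi> $ j) v) * s + of_int (linear_form (\<Phi> $ j) v') * t))
      (y + (of_int (linear_form (\<Phi> $ e) v) * s + of_int (linear_form (\<Phi> $ e) v') * t))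
    = moved i w1 w2 w3 x y + (of_int (linear_form (\<Phi> $ i) v) * s + of_int (linear_form (\<Phi> $ i) v') * t)"
    for i w1 w2 w3 s t
    unfolding moved_def lin_shift by (simp add: algebra_simps)
  have shift: "pair_kernel x y = E (\<lambda>w1. E (\<lambda>w2. E (\<lambda>w3. \<Prod>i\<in>I. f i (moved i (w1 + k1) (w2 + k2) (w3 + k3) x y))))"
    for x y k1 k2 k3
    unfolding pair_kernel_def
    by (rule E_shift3[symmetric, of "\<lambda>w1 w2 w3. \<Prod>i\<in>I. f i (moved i w1 w2 w3 x y)"])
      (intro bdd_per bdd_prod finite_I bdd_moved compat_const compat_id)+
  have eq: "pair_kernel
      (x + (of_int (linear_form (\<Phi> $ j) v) * s + of_int (linear_form (\<Phi> $ j) v') * t))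
      (y + (of_int (linear_form (\<Phi> $ e) v) * s + of_int (linear_form (\<Phi> $ e) v') * t))
    = E (\<lambda>w1. E (\<lambda>w2. E (\<lambda>w3. \<Prod>i\<in>I. f i (moved i w1 w2 w3 x y +
        (of_int (linear_form (\<Phi> $ i) v) * s + of_int (linear_form (\<Phi> $ i) v') * t)))))" for s t
    by (subst shift[of _ _ "of_int (v $ 1) * s + of_int (v' $ 1) * t" "of_int (v $ 2) * s + of_int (v' $ 2) * t"
          "of_int (v $ 3) * s + of_int (v' $ 3) * t"]) (simp only: step)
  have "rk (\<lambda>s t. f i (c + (of_int (linear_form (\<Phi> $ i) v) * s + of_int (linear_form (\<Phi> $ i) v') * t)))"
    if "i \<in> I" for i c
    using assms[OF that]
  proof
    assume "linear_form (\<Phi> $ i) v = 0"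
    then show ?thesis
      by simp (intro rk_right bdd_comp[OF f] compat_intros)
  next
    assume "linear_form (\<Phi> $ i) v' = 0"
    then show ?thesis
      by simp (intro rk_left bdd_comp[OF f] compat_intros)
  qed
  then show ?thesis
    unfolding eq by (intro rk_E rk_prod finite_I)
qed

text \<open>Modulo \<open>p\<close>, \<open>p1\<close> and \<open>p2\<close> are dual to the forms
  \<open>j\<close> and \<open>e\<close>. Shift the base point by \<open>s p1 + t p2\<close> and
  substitute \<open>s = x - lin (\<Phi> $ j) w1 w2 w3\<close>, and likewise \<open>t\<close>: the
  two forms then take the values \<open>x\<close> and \<open>y\<close>.\<close>

lemma system_eq_pair:
  "E (\<lambda>w1. E (\<lambda>w2. E (\<lambda>w3. \<Prod>i\<in>UNIV. f i (lin (\<Phi> $ i) w1 w2 w3))))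
    = E (\<lambda>x. E (\<lambda>y. f j x * f e y * pair_kernel x y))"
proof -
  let ?F = "\<lambda>w1 w2 w3. \<Prod>i\<in>UNIV. f i (lin (\<Phi> $ i) w1 w2 w3)"
  let ?G = "\<lambda>w1 w2 w3 s t. \<Prod>i\<in>UNIV. f i (lin (\<Phi> $ i) w1 w2 w3 +
    (of_int (linear_form (\<Phi> $ i) p1) * s + of_int (linear_form (\<Phi> $ i) p2) * t))"
  have pers: "per (\<lambda>z. ?G (l1 z) (l2 z) (l3 z) (l z) (l' z))"
    if "compat l1" "compat l2" "compat l3" "compat l" "compat l'" for l1 l2 l3 l l'
    by (intro bdd_per bdd_prod finite bdd_comp[OF f] compat_intros compat_lin that)
  have shift: "E (\<lambda>w1. E (\<lambda>w2. E (\<lambda>w3. ?F w1 w2 w3))) = E (\<lambda>w1. E (\<lambda>w2. E (\<lambda>w3. ?G w1 w2 w3 s t)))" for s t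
    unfolding lin_shift[symmetric]
    by (rule E_shift3[symmetric, of ?F])
      (intro bdd_per bdd_prod finite bdd_comp[OF f] compat_lin compat_const compat_id)+
  have moved: "?G w1 w2 w3 (x - lin (\<Phi> $ j) w1 w2 w3) (y - lin (\<Phi> $ e) w1 w2 w3)
      = f j x * f e y * (\<Prod>i\<in>I. f i (moved i w1 w2 w3 x y))" for w1 w2 w3 x y
  proof -
    have "f j (moved j w1 w2 w3 x y) = f j x"
    proof (rule perD[OF bdd_per[OF f]])
      have "red (moved j w1 w2 w3 x y) = red (lin (\<Phi> $ j) w1 w2 w3 +
          (of_int 1 * (x - lin (\<Phi> $ j) w1 w2 w3) + of_int 0 * (y - lin (\<Phi> $ e) w1 w2 w3)))"
        unfolding moved_def by (intro red_add red_cong_scalar p1 p2 refl)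
      then show "red (moved j w1 w2 w3 x y) = red x" by simp
    qed
    moreover have "f e (moved e w1 w2 w3 x y) = f e y"
    proof (rule perD[OF bdd_per[OF f]])
      have "red (moved e w1 w2 w3 x y) = red (lin (\<Phi> $ e) w1 w2 w3 +
          (of_int 0 * (x - lin (\<Phi> $ j) w1 w2 w3) + of_int 1 * (y - lin (\<Phi> $ e) w1 w2 w3)))"
        unfolding moved_def by (intro red_add red_cong_scalar p1 p2 refl)
      then show "red (moved e w1 w2 w3 x y) = red y" by simp
    qed
    moreover have "(\<Prod>i\<in>UNIV. f i (moved i w1 w2 w3 x y))
        = f j (moved j w1 w2 w3 x y) * (f e (moved e w1 w2 w3 x y) * (\<Prod>i\<in>I. f i (moved i w1 w2 w3 x y)))"
    proof -
      have U: "UNIV = insert j (insert e I)" and ni: "j \<notin> insert e I" "e \<notin> I"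
        using je I by auto
      show ?thesis
        unfolding U using ni by (simp add: finite_I)
    qed
    ultimately show ?thesis
      unfolding moved_def by (simp add: mult.assoc)
  qed
  have "E (\<lambda>w1. E (\<lambda>w2. E (\<lambda>w3. ?F w1 w2 w3))) = E (\<lambda>s. E (\<lambda>t. E (\<lambda>w1. E (\<lambda>w2. E (\<lambda>w3. ?G w1 w2 w3 s t)))))"
    unfolding shift[symmetric] by simp
  also have "\<dots> = E (\<lambda>w1. E (\<lambda>s. E (\<lambda>t. E (\<lambda>w2. E (\<lambda>w3. ?G w1 w2 w3 s t)))))"
    by (rule E_rotate[symmetric])
  also have "\<dots> = E (\<lambda>w1. E (\<lambda>w2. E (\<lambda>w3. E (\<lambda>s. E (\<lambda>t. ?G w1 w2 w3 s t)))))"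
    by (intro E_cong E_swap_pairs)
  also have "\<dots> = E (\<lambda>w1. E (\<lambda>w2. E (\<lambda>w3. E (\<lambda>x. E (\<lambda>y.
      ?G w1 w2 w3 (x - lin (\<Phi> $ j) w1 w2 w3) (y - lin (\<Phi> $ e) w1 w2 w3))))))"
  proof (rule E_cong, rule E_cong, rule E_cong)
    fix w1 w2 w3
    have *: "E (\<lambda>x. E (\<lambda>y. ?G w1 w2 w3 (x - c) (y - d))) = E (\<lambda>s. E (\<lambda>t. ?G w1 w2 w3 s t))" for c d
    proof -
      have "E (\<lambda>x. E (\<lambda>y. ?G w1 w2 w3 (x - c) (y - d))) = E (\<lambda>x. E (\<lambda>y. ?G w1 w2 w3 (x - c) y))"
        by (intro E_cong E_shift_diff[of "\<lambda>y. ?G w1 w2 w3 _ y"] pers compat_const compat_id)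
      also have "\<dots> = E (\<lambda>x. E (\<lambda>y. ?G w1 w2 w3 x y))"
        by (intro E_shift_diff[of "\<lambda>x. E (\<lambda>y. ?G w1 w2 w3 x y)"] per_E pers compat_const compat_id)
      finally show ?thesis .
    qed
    show "E (\<lambda>s. E (\<lambda>t. ?G w1 w2 w3 s t))
        = E (\<lambda>x. E (\<lambda>y. ?G w1 w2 w3 (x - lin (\<Phi> $ j) w1 w2 w3) (y - lin (\<Phi> $ e) w1 w2 w3)))"
      by (rule *[symmetric])
  qed
  also have "\<dots> = E (\<lambda>w1. E (\<lambda>x. E (\<lambda>y. E (\<lambda>w2. E (\<lambda>w3. f j x * f e y * (\<Prod>i\<in>I. f i (moved i w1 w2 w3 x y)))))))"
    unfolding moved by (intro E_cong E_swap_pairs)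
  also have "\<dots> = E (\<lambda>x. E (\<lambda>y. E (\<lambda>w1. E (\<lambda>w2. E (\<lambda>w3. f j x * f e y * (\<Prod>i\<in>I. f i (moved i w1 w2 w3 x y)))))))"
    by (rule E_rotate)
  also have "\<dots> = E (\<lambda>x. E (\<lambda>y. f j x * f e y * pair_kernel x y))"
    unfolding pair_kernel_def E_cmult ..
  finally show ?thesis .
qed

end

lemma rk_degenerate:
  assumes f: "bdd f" and "\<not> unit_mod a \<or> \<not> unit_mod b"
  shows "rk (\<lambda>s t. f (y + (of_int a * s + of_int b * t)))"
  using assms(2)
proof
  assume "\<not> unit_mod a"
  then have "red (y + (of_int a * s + of_int b * t)) = red (y + (of_int 0 * s + of_int b * t))" for s t
    unfolding unit_mod_def by (intro red_add red_cong_scalar refl) simp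
  then have "f (y + (of_int a * s + of_int b * t)) = f (y + of_int b * t)" for s t
    by (intro perD[OF bdd_per[OF f]]) simp
  then show ?thesis
    by (simp only:) (intro rk_right bdd_comp[OF f] compat_intros)
next
  assume "\<not> unit_mod b"
  then have "red (y + (of_int a * s + of_int b * t)) = red (y + (of_int a * s + of_int 0 * t))" for s t
    unfolding unit_mod_def by (intro red_add red_cong_scalar refl) simp
  then have "f (y + (of_int a * s + of_int b * t)) = f (y + of_int a * s)" for s t
    by (intro perD[OF bdd_per[OF f]]) simp
  then show ?thesis
    by (simp only:) (intro rk_left bdd_comp[OF f] compat_intros)
qed

text \<open>If the form \<open>e\<close> vanishes modulo \<open>p\<close> at a direction of one of
  the planes, its function joins the kernel and \<open>U2_control\<close> suffices; otherwise
  \<open>pair_control\<close> applies, with \<open>cross_ratios_differ\<close> as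
  nondegeneracy.\<close>

lemma system_bound:
  fixes \<Phi> :: "int^3^6" and f :: "6 \<Rightarrow> 'a \<Rightarrow> complex"
  defines "D \<equiv> \<lambda>i k l. linear_form (\<Phi> $ i) (cross (\<Phi> $ k) (\<Phi> $ l))"
  assumes tc: "true_complexity_1 p \<Phi>" and f: "\<And>i. bdd (f i)"
    and H: "\<And>i k l. nat \<bar>D i k l\<bar> \<le> H" "0 < H"
  shows "(cmod (E (\<lambda>w1. E (\<lambda>w2. E (\<lambda>w3. \<Prod>i\<in>UNIV. f i (lin (\<Phi> $ i) w1 w2 w3)))))) ^ (4096 * H ^ 4)
    \<le> cmod (U2_pow4 (f j))"
proof -
  define X where "X = cmod (E (\<lambda>w1. E (\<lambda>w2. E (\<lambda>w3. \<Prod>i\<in>UNIV. f i (lin (\<Phi> $ i) w1 w2 w3)))))"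
  note unit_iff = unit_mod_def cong_0_iff
  obtain e k l m n where cover: "UNIV = {j, e, k, l, m, n}" "distinct [j, e, k, l, m, n]"
    and nz: "\<not> int p dvd D j k l" "\<not> int p dvd D j m n" "\<not> int p dvd D j k m" "\<not> int p dvd D j l n"
    using good_cycle[OF prime_p tc, of j] unfolding D_def by blast
  have je: "j \<noteq> e" using cover(2) by simp
  obtain a where "\<not> int p dvd linear_form a (cross (\<Phi> $ j) (\<Phi> $ e))"
    using cross_nonzero[OF prime_p tc je] .
  then have "unit_mod (linear_form a (cross (\<Phi> $ j) (\<Phi> $ e)))"
    by (simp add: unit_iff)
  then obtain r where r: "[r * linear_form a (cross (\<Phi> $ j) (\<Phi> $ e)) = 1] (mod int p)"
    using unit_mod_inverse by blast
  \<comment> \<open>Cramer's rule: \<open>r\<close> inverts the determinant of the forms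
    \<open>j\<close>, \<open>e\<close> and \<open>a\<close> modulo \<open>p\<close>.\<close>
  define p1 where "p1 = r *s cross (\<Phi> $ e) a"
  define p2 where "p2 = r *s cross a (\<Phi> $ j)"
  have smult: "linear_form b (r *s v) = r * linear_form b v" for b v :: "int^3"
    by (simp add: linear_form_3 algebra_simps)
  have p1: "[linear_form (\<Phi> $ j) p1 = 1] (mod int p)" "[linear_form (\<Phi> $ e) p1 = 0] (mod int p)"
    using r unfolding p1_def smult linear_form_cross_rotate[of "\<Phi> $ j" "\<Phi> $ e" a]
      linear_form_cross_rotate[of "\<Phi> $ e" a "\<Phi> $ j"] by simp_all
  have p2: "[linear_form (\<Phi> $ j) p2 = 0] (mod int p)" "[linear_form (\<Phi> $ e) p2 = 1] (mod int p)"
    using r unfolding p2_def smult linear_form_cross_rotate[of "\<Phi> $ e" a "\<Phi> $ j"] by simp_all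
  define I where "I = UNIV - {j, e}"
  have I: "I = {k, l, m, n}"
    using cover unfolding I_def by auto
  define T where "T = pair_kernel \<Phi> f j e p1 p2 I"
  note ctx = f je I_def p1 p2
  have X: "X = cmod (E (\<lambda>x. E (\<lambda>y. f j x * f e y * T x y)))"
    unfolding X_def T_def system_eq_pair[OF ctx] ..
  have T: "bdd2 T"
    unfolding T_def by (rule bdd2_pair_kernel[OF ctx])
  \<comment> \<open>Each direction is a cross product killed by two of the four remaining forms; the
    two planes correspond to the pairings \<open>k l\<close>, \<open>m n\<close> and
    \<open>k m\<close>, \<open>l n\<close>.\<close>
  have rk1: "rk (\<lambda>s t. T (x + (of_int (D j k l) * s + of_int (D j m n) * t)) (y + (of_int (D e k l) * s + of_int (D e m n) * t)))" for x y
    unfolding T_def D_def by (rule rk_pair_kernel[OF ctx]) (auto simp: I)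
  have rk2: "rk (\<lambda>s t. T (x + (of_int (D j k m) * s + of_int (D j l n) * t)) (y + (of_int (D e k m) * s + of_int (D e l n) * t)))" for x y
    unfolding T_def D_def by (rule rk_pair_kernel[OF ctx]) (auto simp: I)
  have units: "unit_mod (D j k l)" "unit_mod (D j m n)" "unit_mod (D j k m)" "unit_mod (D j l n)"
    using nz by (simp_all add: unit_iff)
  have X1: "0 \<le> X" "X \<le> 1"
  proof -
    show "0 \<le> X" by (simp add: X_def)
    have "bdd (\<lambda>_. f j x * f e y * T x y)" for x y
      by (intro bdd_mult bdd_const bdd_norm_le[OF f] bdd2_norm_le[OF T])
    then show "X \<le> 1"
      unfolding X by (intro norm_E_le_const) (rule bdd_norm_le)
  qed
  \<comment> \<open>As \<open>X\<close> lies between 0 and 1, a smaller exponent implies the uniform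
    one.\<close>
  have "\<exists>N \<le> 4096 * H ^ 4. X ^ N \<le> cmod (U2_pow4 (f j))"
  proof -
    have four: "4 \<le> 4096 * H ^ 4"
      using H(2) by (simp add: Suc_le_eq)
    consider "\<not> unit_mod (D e k l) \<or> \<not> unit_mod (D e m n)" | "\<not> unit_mod (D e k m) \<or> \<not> unit_mod (D e l n)"
      | "unit_mod (D e k l)" "unit_mod (D e m n)" "unit_mod (D e k m)" "unit_mod (D e l n)"
      by blast
    then show ?thesis
    proof cases
      case 1
      have "X ^ 4 \<le> cmod (U2_pow4 (f j))"
        unfolding X by (rule U2_control[OF f f T rk_mult[OF rk_degenerate[OF f 1] rk1] units(1,2)])
      then show ?thesis using four by blast
    next
      case 2
      have "X ^ 4 \<le> cmod (U2_pow4 (f j))"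
        unfolding X by (rule U2_control[OF f f T rk_mult[OF rk_degenerate[OF f 2] rk2] units(3,4)])
      then show ?thesis using four by blast
    next
      case 3
      let ?u = "D j m n * D e l n" and ?v = "D e m n * D j l n"
      have "unit_mod (D j k l * D j m n * D e k m * D e l n - D e k l * D e m n * D j k m * D j l n)"
        using cross_ratios_differ[OF prime_p tc cover nz[unfolded D_def]] unfolding unit_iff D_def .
      from pair_control[OF f f T rk1 rk2 units(1) 3(1) units(2) 3(2) units(3) 3(3) units(4) 3(4) this]
      have "X ^ (4096 * (nat \<bar>?u\<bar> * nat \<bar>?v\<bar>)) \<le> cmod (U2_pow4 (f j))"
        unfolding X .
      moreover have "nat \<bar>?u\<bar> * nat \<bar>?v\<bar> \<le> H ^ 4"
      proof -
        have "nat \<bar>?u\<bar> * nat \<bar>?v\<bar>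
            = (nat \<bar>D j m n\<bar> * nat \<bar>D e l n\<bar>) * (nat \<bar>D e m n\<bar> * nat \<bar>D j l n\<bar>)"
          by (simp add: abs_mult nat_mult_distrib)
        also have "\<dots> \<le> (H * H) * (H * H)"
          by (intro mult_le_mono H)
        finally show ?thesis by (simp add: power4_eq_xxxx mult.assoc)
      qed
      ultimately show ?thesis
        by (intro exI[of _ "4096 * (nat \<bar>?u\<bar> * nat \<bar>?v\<bar>)"]) simp
    qed
  qed
  then show ?thesis
    using power_decreasing[OF _ X1] unfolding X_def by (meson order_trans)
qed

end

subsection \<open>The group \<open>\<F>\<^sub>p\<^sup>n\<close>\<close>

text \<open>Lifts are arbitrary integer sequences under pointwise operations; restricting to the
  first \<open>n\<close> coordinates gives the extensional functions that make up the
  carrier.\<close>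

definition fp_red :: "nat \<Rightarrow> nat \<Rightarrow> (nat \<Rightarrow> int) \<Rightarrow> nat \<Rightarrow> int" where
  "fp_red p n x = (\<lambda>i\<in>{..<n}. x i mod int p)"

definition fp_char :: "nat \<Rightarrow> nat \<Rightarrow> (nat \<Rightarrow> int) \<Rightarrow> (nat \<Rightarrow> int) \<Rightarrow> complex" where
  "fp_char p n \<xi> x = cis (2 * pi * real_of_int (\<Sum>i<n. \<xi> i * x i) / real p)"

lemma fp_red_eq_iff: "fp_red p n x = fp_red p n y \<longleftrightarrow> (\<forall>i<n. x i mod int p = y i mod int p)"
  by (auto simp: fp_red_def fun_eq_iff restrict_def)

lemma of_int_fun_apply: "(of_int k :: nat \<Rightarrow> int) i = k"
proof -
  have nat: "(of_nat m :: nat \<Rightarrow> int) i = int m" for m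
    by (induction m) simp_all
  show ?thesis
    by (cases k) (simp_all add: nat)
qed

lemma carrier_Fp_vectors: "p > 0 \<Longrightarrow> carrier (Fp_vectors p n) = (\<Pi>\<^sub>E i\<in>{..<n}. {0..<int p})"
  by (simp add: Fp_vectors_def carrier_integer_mod_group)

lemma cis_2pi_int: "cis (2 * pi * real_of_int k) = 1"
  by (metis cis_multiple_2pi Ints_of_int)

lemma cis_2pi_frac_cong:
  assumes "p > 0" "[a = b] (mod int p)"
  shows "cis (2 * pi * real_of_int a / real p) = cis (2 * pi * real_of_int b / real p)"
proof -
  obtain m where "a = b + int p * m"
    using iffD1[OF cong_iff_lin cong_sym[OF assms(2)]] by blast
  then have "2 * pi * real_of_int a / real p = 2 * pi * real_of_int b / real p + 2 * pi * real_of_int m"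
    using assms(1) by (simp add: field_simps)
  then show ?thesis
    by (simp only: cis_mult[symmetric] cis_2pi_int mult_1_right)
qed

lemma cis_2pi_div_ne_1:
  assumes "1 < p" shows "cis (2 * pi / real p) \<noteq> 1"
proof
  assume "cis (2 * pi / real p) = 1"
  then have "cos (2 * pi / real p) = 1"
    by (simp add: complex_eq_iff)
  then obtain m :: int where "2 * pi / real p = of_int m * (2 * pi)"
    by (auto simp: cos_one_2pi_int)
  then have "1 = real_of_int (m * int p)"
    using assms by (simp add: field_simps)
  then have "1 = m * int p" by linarith
  then have "int p dvd 1" by (rule dvdI[of _ _ m, OF trans[OF _ mult.commute]])
  then show False
    using assms by simp
qed

lemma averaging_Fp:
  assumes p: "Factorial_Ring.prime p"
  shows "averaging (carrier (Fp_vectors p n)) p (fp_red p n) (fp_char p n)"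
proof
  have p0: "p > 0" and p1: "1 < p"
    using prime_gt_0_nat[OF p] prime_gt_1_nat[OF p] by auto
  note carr = carrier_Fp_vectors[OF p0]
  show "Factorial_Ring.prime p" by fact
  show "finite (carrier (Fp_vectors p n))"
    unfolding carr by (intro finite_PiE) auto
  show "fp_red p n x \<in> carrier (Fp_vectors p n)" for x
    unfolding carr fp_red_def using p0 by auto
  show "fp_red p n x = x" if "x \<in> carrier (Fp_vectors p n)" for x
    using that unfolding carr fp_red_def by (auto simp: PiE_def Pi_def extensional_def fun_eq_iff)
  show "fp_red p n (x + y) = fp_red p n (x' + y')"
    if "fp_red p n x = fp_red p n x'" "fp_red p n y = fp_red p n y'" for x x' y y'
    using that unfolding fp_red_eq_iff by (auto intro: mod_add_cong)
  show "fp_red p n (of_int k * x) = fp_red p n (of_int k * x')" if "fp_red p n x = fp_red p n x'" for k x x'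
    using that unfolding fp_red_eq_iff by (auto simp: of_int_fun_apply intro: mod_mult_cong)
  show "fp_red p n (of_int (int p) * x) = fp_red p n 0" for x
    unfolding fp_red_eq_iff times_fun_apply of_int_fun_apply by simp
  show "fp_char p n \<xi> (x + y) = fp_char p n \<xi> x * fp_char p n \<xi> y" for \<xi> x y
    by (simp add: fp_char_def cis_mult sum.distrib algebra_simps add_divide_distrib)
  show "fp_char p n \<xi> x = fp_char p n x \<xi>" for \<xi> x
    by (simp add: fp_char_def mult.commute)
  show "cmod (fp_char p n \<xi> x) = 1" for \<xi> x
    by (simp add: fp_char_def)
  show "fp_char p n \<xi> x = fp_char p n \<xi> y" if "fp_red p n x = fp_red p n y" for \<xi> x y
    unfolding fp_char_def
  proof (rule cis_2pi_frac_cong[OF p0], rule cong_sum)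
    fix i assume "i \<in> {..<n}"
    then have "[x i = y i] (mod int p)"
      using that by (simp add: fp_red_eq_iff cong_def)
    then show "[\<xi> i * x i = \<xi> i * y i] (mod int p)"
      by (intro cong_mult cong_refl)
  qed
  show "fp_char p n (c * \<xi>) x = fp_char p n \<xi> (c * x)" for c \<xi> x
    by (simp add: fp_char_def mult_ac)
  show "\<exists>x. fp_char p n \<xi> x \<noteq> 1" if "fp_red p n \<xi> \<noteq> fp_red p n 0" for \<xi>
  proof -
    have "\<exists>i<n. \<not> int p dvd \<xi> i"
      using that unfolding fp_red_eq_iff by (simp add: dvd_eq_mod_eq_0)
    then obtain i where i: "i < n" "\<not> int p dvd \<xi> i"
      by blast
    have "Factorial_Ring.prime (int p)" using p by simp
    then have "coprime (\<xi> i) (int p)"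
      using i(2) by (metis prime_imp_coprime coprime_commute)
    then obtain k where k: "[\<xi> i * k = 1] (mod int p)"
      using cong_solve_coprime_int by blast
    \<comment> \<open>Supported at a single coordinate where \<open>\<xi>\<close> is invertible,
      \<open>x\<close> makes the character value \<open>cis (2 * pi / p)\<close>.\<close>
    define x where "x l = (if l = i then k else 0)" for l
    have "(\<Sum>l<n. \<xi> l * x l) = \<xi> i * k"
      using i(1) by (simp add: x_def if_distrib[of "(*) _"] cong: if_cong)
    then have "fp_char p n \<xi> x = cis (2 * pi / real p)"
      using cis_2pi_frac_cong[OF p0 k] by (simp add: fp_char_def)
    then show ?thesis
      using cis_2pi_div_ne_1[OF p1] by metis
  qed
qed

section \<open>The defined quantities as averages over lifts\<close>

context
  fixes p n :: nat and G
  assumes p: "Factorial_Ring.prime p"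
  defines "G \<equiv> Fp_vectors p n"
begin

lemma Fp_comm_group: "comm_group G"
proof -
  have "group G"
    unfolding G_def Fp_vectors_def by (rule product_group) simp
  then show ?thesis
    by (rule group.group_comm_groupI)
      (auto simp: G_def Fp_vectors_def add.commute intro!: restrict_ext)
qed

interpretation comm_group G
  by (rule Fp_comm_group)

interpretation averaging "carrier G" p "fp_red p n" "fp_char p n"
  unfolding G_def by (rule averaging_Fp[OF p])

lemma Fp_mult: "x \<otimes>\<^bsub>G\<^esub> y = fp_red p n (x + y)"
  using prime_gt_0_nat[OF p] by (auto simp: G_def Fp_vectors_def fp_red_def)

lemma Fp_one: "\<one>\<^bsub>G\<^esub> = fp_red p n 0"
  by (auto simp: G_def Fp_vectors_def fp_red_def)

lemma red_red_add: "fp_red p n (fp_red p n x + y) = fp_red p n (x + y)"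
  "fp_red p n (x + fp_red p n y) = fp_red p n (x + y)"
  by (rule red_add; simp)+

lemma Fp_pow: "fp_red p n x [^]\<^bsub>G\<^esub> (k :: int) = fp_red p n (of_int k * x)"
proof -
  have nat: "fp_red p n x [^]\<^bsub>G\<^esub> (m :: nat) = fp_red p n (of_nat m * x)" for m
  proof (induction m)
    case 0
    show ?case by (simp only: nat_pow_0 Fp_one of_nat_0 mult_zero_left)
  next
    case (Suc m)
    show ?case
      by (simp only: nat_pow_Suc Suc.IH Fp_mult red_red_add of_nat_Suc distrib_right mult_1_left add.commute)
  qed
  show ?thesis
  proof (cases k)
    case (nonneg m)
    then show ?thesis using nat by (simp add: int_pow_int)
  next
    case (neg m)
    have "fp_red p n (- (of_nat (Suc m) * x)) \<otimes>\<^bsub>G\<^esub> fp_red p n (of_nat (Suc m) * x) = \<one>\<^bsub>G\<^esub>"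
      unfolding Fp_mult Fp_one red_red_add by simp
    then have "inv\<^bsub>G\<^esub> (fp_red p n (of_nat (Suc m) * x)) = fp_red p n (- (of_nat (Suc m) * x))"
      by (intro inv_equality red_in)
    then show ?thesis
      unfolding neg by (simp only: int_pow_neg[OF red_in] int_pow_int nat of_int_minus of_int_of_nat_eq mult_minus_left)
  qed
qed

lemma Fp_induced_form:
  fixes x :: "3 \<Rightarrow> nat \<Rightarrow> int"
  assumes "\<And>k. x k \<in> carrier G"
  shows "induced_form G a x = fp_red p n (of_int (a $ 1) * x 1 + of_int (a $ 2) * x 2 + of_int (a $ 3) * x 3)"
proof -
  have pow: "x k [^]\<^bsub>G\<^esub> (m :: int) = fp_red p n (of_int m * x k)" for k m
    using Fp_pow[of "x k" m] red_id[OF assms[of k]] by simp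
  have "induced_form G a x = x 1 [^]\<^bsub>G\<^esub> (a $ 1) \<otimes>\<^bsub>G\<^esub> (x 2 [^]\<^bsub>G\<^esub> (a $ 2) \<otimes>\<^bsub>G\<^esub> x 3 [^]\<^bsub>G\<^esub> (a $ 3))"
    unfolding induced_form_def UNIV_3 using assms by (simp add: finprod_insert Pi_def)
  then show ?thesis
    by (simp add: pow Fp_mult red_red_add add.assoc)
qed

lemma Fp_expect_triple:
  "expect (UNIV \<rightarrow> carrier G) F
    = E (\<lambda>w1. E (\<lambda>w2. E (\<lambda>w3. F (\<lambda>k::3. if k = 1 then w1 else if k = 2 then w2 else w3))))"
proof -
  let ?S = "carrier G"
  let ?v = "\<lambda>(w1, w2, w3). (\<lambda>k::3. if k = 1 then w1 else if k = 2 then w2 else w3)"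
  have bij: "bij_betw ?v (?S \<times> ?S \<times> ?S) (UNIV \<rightarrow> ?S)"
  proof (rule bij_betw_byWitness[where f' = "\<lambda>x. (x 1, x 2, x 3)"])
    show "\<forall>x\<in>UNIV \<rightarrow> ?S. ?v (x 1, x 2, x 3) = x"
      using exhaust_3 by (auto simp: fun_eq_iff)
  qed auto
  have "(\<Sum>x\<in>UNIV \<rightarrow> ?S. F x) = (\<Sum>w\<in>?S \<times> ?S \<times> ?S. F (?v w))"
    by (rule sum.reindex_bij_betw[OF bij, symmetric])
  moreover have "card (UNIV \<rightarrow> ?S :: (3 \<Rightarrow> _) set) = card ?S * (card ?S * card ?S)"
    using bij_betw_same_card[OF bij] by (simp add: card_cartesian_product)
  ultimately show ?thesis
    by (simp add: expect_def E_def sum_divide_distrib[symmetric] mult.assoc)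
      (simp add: sum.cartesian_product split_def)
qed

lemma Fp_Lambda_form:
  fixes \<Phi> :: "int^3^6"
  shows "Lambda_form G \<Phi> f = E (\<lambda>w1. E (\<lambda>w2. E (\<lambda>w3. \<Prod>i\<in>UNIV.
    f i (fp_red p n (of_int (\<Phi> $ i $ 1) * w1 + of_int (\<Phi> $ i $ 2) * w2 + of_int (\<Phi> $ i $ 3) * w3)))))"
  unfolding Lambda_form_def Fp_expect_triple E_def
  by (intro arg_cong2[where f = "(/)"] sum.cong refl prod.cong) (simp add: Fp_induced_form)

text \<open>Reflecting \<open>h\<close> and \<open>h'\<close> turns the sums of the norm's
  definition into the differences of \<open>corners\<close>.\<close>

lemma Fp_U2_average: "U2_average G f = U2_pow4 (\<lambda>x. f (fp_red p n x))"
proof -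
  let ?S = "carrier G"
  let ?F = "\<lambda>x. f (fp_red p n x)"
  let ?g = "\<lambda>x h h'. ?F x * cnj (?F (x + h)) * cnj (?F (x + h')) * ?F (x + h + h')"
  have F: "per ?F"
    by (rule perI) simp
  have "U2_average G f = E (\<lambda>x. E (\<lambda>h. E (\<lambda>h'. ?g x h h')))"
    unfolding U2_average_def expect_def E_def sum_divide_distrib[symmetric]
    by (simp add: sum.cartesian_product[symmetric] card_cartesian_product Fp_mult red_red_add red_id mult.assoc)
  also have "\<dots> = E (\<lambda>h. E (\<lambda>h'. E (\<lambda>x. ?g x h h')))"
    by (rule E_rotate)
  also have "\<dots> = E (\<lambda>h. E (\<lambda>h'. E (\<lambda>x. ?g x (0 - h) h')))"
    by (rule E_reflect[symmetric, of "\<lambda>h. E (\<lambda>h'. E (\<lambda>x. ?g x h h'))"])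
      (intro per_E per_mult per_cnj per_const per_comp[OF F] compat_intros)
  also have "\<dots> = E (\<lambda>h. E (\<lambda>h'. E (\<lambda>x. ?g x (0 - h) (0 - h'))))"
    by (intro E_cong E_reflect[symmetric, of "\<lambda>h'. E (\<lambda>x. ?g x (0 - _) h')"]
        per_E per_mult per_cnj per_const per_comp[OF F] compat_intros)
  also have "\<dots> = U2_pow4 ?F"
    unfolding U2_pow4_def pgram_def corners_def by (simp add: mult.assoc)
  finally show ?thesis .
qed

lemma Fp_U2_norm: "U2_norm G f ^ 4 = cmod (U2_pow4 (\<lambda>x. f (fp_red p n x)))" "0 \<le> U2_norm G f"
proof -
  have eq: "complex_of_real (U2_norm G f ^ 4) = U2_average G f"
    by (rule U2_norm_power4[OF Fp_comm_group finite_S])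
  have "0 \<le> U2_norm G f ^ 4" by simp
  then show "U2_norm G f ^ 4 = cmod (U2_pow4 (\<lambda>x. f (fp_red p n x)))"
    unfolding Fp_U2_average[symmetric] eq[symmetric] norm_of_real by simp
  have "0 \<le> Re (U2_average G f)"
    unfolding eq[symmetric] by simp
  then show "0 \<le> U2_norm G f"
    unfolding U2_norm_def by (rule real_root_ge_zero)
qed

end

section \<open>A uniform exponent from the determinants of the forms\<close>

theorem theorem1p5:
  fixes \<Phi> :: "int^3^6" and j :: 6
  shows "\<exists>C::real. C > 0 \<and>
    (\<forall>(p::nat) (n::nat) (f :: 6 \<Rightarrow> (nat \<Rightarrow> int) \<Rightarrow> complex).
       Factorial_Ring.prime p \<longrightarrow> n \<ge> 1 \<longrightarrow> true_complexity_1 p \<Phi> \<longrightarrow>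
       (\<forall>i. \<forall>x\<in>carrier (Fp_vectors p n). cmod (f i x) \<le> 1) \<longrightarrow>
       cmod (Lambda_form (Fp_vectors p n) \<Phi> f) \<le> U2_norm (Fp_vectors p n) (f j) powr (1 / C))"
proof -
  define D where "D i k l = nat \<bar>linear_form (\<Phi> $ i) (cross (\<Phi> $ k) (\<Phi> $ l))\<bar>" for i k l
  \<comment> \<open>The sum of all determinants bounds each of them and depends on
    \<open>\<Phi>\<close> only; \<open>Suc\<close> keeps it positive.\<close>
  define H where "H = Suc (\<Sum>i\<in>UNIV. \<Sum>k\<in>UNIV. \<Sum>l\<in>UNIV. D i k l)"
  have H: "D i k l \<le> H" for i k l
  proof -
    have "D i k l \<le> (\<Sum>l\<in>UNIV. D i k l)"
      by (rule member_le_sum) auto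
    also have "\<dots> \<le> (\<Sum>k\<in>UNIV. \<Sum>l\<in>UNIV. D i k l)"
      by (rule member_le_sum[of k UNIV "\<lambda>k. \<Sum>l\<in>UNIV. D i k l"]) auto
    also have "\<dots> \<le> (\<Sum>i\<in>UNIV. \<Sum>k\<in>UNIV. \<Sum>l\<in>UNIV. D i k l)"
      by (rule member_le_sum[of i UNIV "\<lambda>i. \<Sum>k\<in>UNIV. \<Sum>l\<in>UNIV. D i k l"]) auto
    finally show ?thesis by (simp add: H_def)
  qed
  \<comment> \<open>A quarter of the exponent in \<open>system_bound\<close>, whose right-hand side
    is the fourth power of the U2 norm.\<close>
  define M where "M = 1024 * H ^ 4"
  have M: "M > 0" by (simp add: M_def H_def)
  have "cmod (Lambda_form (Fp_vectors p n) \<Phi> f) \<le> U2_norm (Fp_vectors p n) (f j) powr (1 / real M)"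
    if p: "Factorial_Ring.prime p" and tc: "true_complexity_1 p \<Phi>"
      and f: "\<forall>i. \<forall>x\<in>carrier (Fp_vectors p n). cmod (f i x) \<le> 1"
    for p n :: nat and f :: "6 \<Rightarrow> (nat \<Rightarrow> int) \<Rightarrow> complex"
  proof -
    interpret averaging "carrier (Fp_vectors p n)" p "fp_red p n" "fp_char p n"
      by (rule averaging_Fp[OF p])
    \<comment> \<open>Composing with the reduction makes the functions invariant and extends their
      bound from the carrier to all lifts.\<close>
    define F where "F i x = f i (fp_red p n x)" for i x
    have F: "bdd (F i)" for i
      unfolding bdd_def F_def using f by (auto intro: perI)
    let ?\<Lambda> = "cmod (Lambda_form (Fp_vectors p n) \<Phi> f)" and ?U = "U2_norm (Fp_vectors p n) (f j)"
    have "?\<Lambda> ^ (4096 * H ^ 4) \<le> cmod (U2_pow4 (F j))"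
      unfolding Fp_Lambda_form[OF p] lin_def[symmetric] F_def[symmetric]
      by (rule system_bound[OF tc F H[unfolded D_def]]) (simp add: H_def)
    also have "\<dots> = ?U ^ 4"
      unfolding F_def Fp_U2_norm(1)[OF p] ..
    finally have "(?\<Lambda> ^ M) ^ 4 \<le> ?U ^ 4"
      by (simp add: M_def power_mult[symmetric] mult.commute)
    then have "(?\<Lambda> ^ M) ^ Suc 3 \<le> ?U ^ Suc 3" by simp
    then have "?\<Lambda> ^ M \<le> ?U"
      by (rule power_le_imp_le_base) (rule Fp_U2_norm(2)[OF p])
    then have "root M (?\<Lambda> ^ M) \<le> root M ?U"
      using M by simp
    moreover have "root M (?\<Lambda> ^ M) = ?\<Lambda>"
      using M by (simp add: real_root_power_cancel)
    moreover have "root M ?U = ?U powr (1 / real M)"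
      using M Fp_U2_norm(2)[OF p] by (simp add: root_powr_inverse)
    ultimately show ?thesis by simp
  qed
  then show ?thesis
    using M by (intro exI[of _ "real M"]) auto
qed

end
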